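(* Let $d$ be any positive integer. Let $\bar\psi:\mathrm{Br}_4(d)\to \mathrm{Br}_3(d)$ be the surjective homomorphism of truncated braid groups determined by $\sigma_1\mapsto\sigma_1$, $\sigma_2\mapsto\sigma_2$, $\sigma_3\mapsto\sigma_1$. Then the kernel of $\bar\psi$ is isomorphic to the primitive Burnside group $PF_2(d)$, i.e. there is a short exact sequence $$1\to PF_2(d)\to \mathrm{Br}_4(d)\xrightarrow{\ \bar\psi\ }\mathrm{Br}_3(d)\to 1.$$ Moreover, this sequence is split (there is a homomorphism $s:\mathrm{Br}_3(d)\to\mathrm{Br}_4(d)$ with $\bar\psi\circ s=\mathrm{id}$), so that there is a semidirect product decomposition $\mathrm{Br}_4(d)\cong PF_2(d)\rtimes \mathrm{Br}_3(d)$.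
   Context: The $n$-strand braid group is $$\mathrm{Br}_n=\langle \sigma_1,\dots,\sigma_{n-1}\mid \sigma_i\sigma_{i+1}\sigma_i=\sigma_{i+1}\sigma_i\sigma_{i+1},\ \sigma_i\sigma_j=\sigma_j\sigma_i \text{ if } |i-j|>1\rangle.$$ For positive integers $n,d$, the truncated braid group is $\mathrm{Br}_n(d)=\mathrm{Br}_n/\langle\langle \sigma_1^d\rangle\rangle$, where $\langle\langle - \rangle\rangle$ denotes normal closure; images of the generators are still denoted $\sigma_i$. The homomorphism $\psi:\mathrm{Br}_4\to\mathrm{Br}_3$, $\sigma_1\mapsto\sigma_1,\ \sigma_2\mapsto\sigma_2,\ \sigma_3\mapsto\sigma_1$ (equivalently, the quotient by the relation $\sigma_1\sigma_3^{-1}=1$), descends to $\bar\psi$. An element (word) of a free group is primitive if it is a member of some basis (free generating set) of the free group. The primitive Burnside group of rank $n$ and exponent $d$ is $$PF_n(d)=\langle x_1,\dots,x_n\mid w(x_1,\dots,x_n)^d=1 \text{ for all primitive words } w \text{ in the free group on } x_1,\dots,x_n\rangle.$$ *)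

theory Defs
  imports "HOL-Algebra.Algebra"
begin

section \<open>Free groups\<close>

text \<open>
  The free group on a set \<open>S\<close> is realised by the freely reduced words over \<open>S\<close>.
  The letter \<open>(x, True)\<close> stands for \<open>x\<close> and \<open>(x, False)\<close> for its formal inverse.
\<close>

type_synonym 'a word = "('a \<times> bool) list"

definition cancelling :: "'a \<times> bool \<Rightarrow> 'a \<times> bool \<Rightarrow> bool" where
  "cancelling p q \<longleftrightarrow> fst p = fst q \<and> snd p \<noteq> snd q"

definition reduced :: "'a word \<Rightarrow> bool" where
  "reduced w \<longleftrightarrow> successively (\<lambda>p q. \<not> cancelling p q) w"

text \<open>Left multiplication of a reduced word by a single letter.\<close>

fun push :: "'a \<times> bool \<Rightarrow> 'a word \<Rightarrow> 'a word" where
  "push p [] = [p]"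
| "push p (q # w) = (if cancelling p q then w else p # q # w)"

definition free_group :: "'a set \<Rightarrow> 'a word monoid" where
  "free_group S =
    \<lparr>carrier = {w. reduced w \<and> fst ` set w \<subseteq> S}, monoid.mult = foldr push, one = []\<rparr>"

definition free_gen :: "'a \<Rightarrow> 'a word" where
  "free_gen x = [(x, True)]"

text \<open>The homomorphism from a free group to \<open>G\<close> that extends the map \<open>f\<close> on the free generators.\<close>

definition free_lift :: "('g, 'm) monoid_scheme \<Rightarrow> ('a \<Rightarrow> 'g) \<Rightarrow> 'a word \<Rightarrow> 'g" where
  "free_lift G f w =
    foldr (\<lambda>(x, b) g. (if b then f x else inv\<^bsub>G\<^esub> f x) \<otimes>\<^bsub>G\<^esub> g) w \<one>\<^bsub>G\<^esub>"

definition free_basis :: "('g, 'm) monoid_scheme \<Rightarrow> 'g set \<Rightarrow> bool" where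
  "free_basis G B \<longleftrightarrow> B \<subseteq> carrier G \<and> free_lift G (\<lambda>x. x) \<in> iso (free_group B) G"

definition primitive :: "('g, 'm) monoid_scheme \<Rightarrow> 'g \<Rightarrow> bool" where
  "primitive G w \<longleftrightarrow> (\<exists>B. free_basis G B \<and> w \<in> B)"

section \<open>Presentations\<close>

definition normal_closure :: "('g, 'm) monoid_scheme \<Rightarrow> 'g set \<Rightarrow> 'g set" where
  "normal_closure G A = \<Inter>{N. N \<lhd> G \<and> A \<subseteq> N}"

text \<open>A relation \<open>u = v\<close> is represented by the pair \<open>(u, v)\<close>.\<close>

definition relators :: "'a set \<Rightarrow> ('a word \<times> 'a word) set \<Rightarrow> 'a word set" where
  "relators S R = {u \<otimes>\<^bsub>free_group S\<^esub> inv\<^bsub>free_group S\<^esub> v | u v. (u, v) \<in> R}"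

definition presented_group :: "'a set \<Rightarrow> ('a word \<times> 'a word) set \<Rightarrow> 'a word set monoid" where
  "presented_group S R = free_group S Mod normal_closure (free_group S) (relators S R)"

definition presented_gen :: "'a set \<Rightarrow> ('a word \<times> 'a word) set \<Rightarrow> 'a \<Rightarrow> 'a word set" where
  "presented_gen S R x = normal_closure (free_group S) (relators S R) #>\<^bsub>free_group S\<^esub> free_gen x"

section \<open>Braid groups and truncated braid groups\<close>

definition braid_relations :: "nat \<Rightarrow> (nat word \<times> nat word) set" where
  "braid_relations n = (let F = free_group {1..<n}; \<sigma> = free_gen in
     {(\<sigma> i \<otimes>\<^bsub>F\<^esub> \<sigma> (i + 1) \<otimes>\<^bsub>F\<^esub> \<sigma> i, \<sigma> (i + 1) \<otimes>\<^bsub>F\<^esub> \<sigma> i \<otimes>\<^bsub>F\<^esub> \<sigma> (i + 1)) | i.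
        i \<in> {1..<n} \<and> i + 1 \<in> {1..<n}} \<union>
     {(\<sigma> i \<otimes>\<^bsub>F\<^esub> \<sigma> j, \<sigma> j \<otimes>\<^bsub>F\<^esub> \<sigma> i) | i j.
        i \<in> {1..<n} \<and> j \<in> {1..<n} \<and> \<bar>int i - int j\<bar> > 1})"

definition braid_group :: "nat \<Rightarrow> nat word set monoid" where
  "braid_group n = presented_group {1..<n} (braid_relations n)"

definition braid_gen :: "nat \<Rightarrow> nat \<Rightarrow> nat word set" where
  "braid_gen n i = presented_gen {1..<n} (braid_relations n) i"

text \<open>
  The braid group on fewer than two strands has no generator \<open>\<sigma>\<^sub>1\<close>, hence the case distinction.
\<close>

definition truncation_subgroup :: "nat \<Rightarrow> nat \<Rightarrow> nat word set set" where
  "truncation_subgroup n d = normal_closure (braid_group n)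
     (if 2 \<le> n then {braid_gen n 1 [^]\<^bsub>braid_group n\<^esub> d} else {})"

definition truncated_braid_group :: "nat \<Rightarrow> nat \<Rightarrow> nat word set set monoid" where
  "truncated_braid_group n d = braid_group n Mod truncation_subgroup n d"

definition truncated_braid_gen :: "nat \<Rightarrow> nat \<Rightarrow> nat \<Rightarrow> nat word set set" where
  "truncated_braid_gen n d i = truncation_subgroup n d #>\<^bsub>braid_group n\<^esub> braid_gen n i"

section \<open>Primitive Burnside groups\<close>

definition primitive_Burnside_group :: "nat \<Rightarrow> nat \<Rightarrow> nat word set monoid" where
  "primitive_Burnside_group n d = (let F = free_group {1..n} in
     presented_group {1..n} {(w [^]\<^bsub>F\<^esub> d, \<one>\<^bsub>F\<^esub>) | w. primitive F w})"

section \<open>Semidirect products\<close>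

text \<open>For an action \<open>\<theta>\<close> of \<open>H\<close> on \<open>N\<close>, that is, \<open>\<theta> \<in> hom H (AutoGroup N)\<close>.\<close>

definition semidirect_product ::
    "('n, 'a) monoid_scheme \<Rightarrow> ('h, 'b) monoid_scheme \<Rightarrow> ('h \<Rightarrow> 'n \<Rightarrow> 'n) \<Rightarrow> ('n \<times> 'h) monoid" where
  "semidirect_product N H \<theta> =
    \<lparr>carrier = carrier N \<times> carrier H,
     monoid.mult = (\<lambda>(n, h) (n', h'). (n \<otimes>\<^bsub>N\<^esub> \<theta> h n', h \<otimes>\<^bsub>H\<^esub> h')),
     one = (\<one>\<^bsub>N\<^esub>, \<one>\<^bsub>H\<^esub>)\<rparr>"

section \<open>The structures above are groups\<close>

lemma reduced_push: "reduced w \<Longrightarrow> reduced (push p w)"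
  by (cases w; cases "tl w") (auto simp: reduced_def)

lemma reduced_foldr_push: "reduced w \<Longrightarrow> reduced (foldr push u w)"
  by (induction u) (auto simp: reduced_push)

lemma set_push: "set (push p w) \<subseteq> insert p (set w)"
  by (cases w) auto

lemma set_foldr_push: "set (foldr push u w) \<subseteq> set u \<union> set w"
  by (induction u) (use set_push in fastforce)+

lemma push_push_cancelling:
  assumes "reduced w" "cancelling p q"
  shows "push p (push q w) = w"
proof (cases w)
  case Nil
  then show ?thesis using assms by simp
next
  case (Cons r v)
  show ?thesis
  proof (cases "cancelling q r")
    case True
    then have "p = r"
      using assms(2) by (auto simp: cancelling_def prod_eq_iff)
    then show ?thesis
      using Cons True assms(1) by (cases v) (auto simp: reduced_def)
  next
    case False
    then show ?thesis using Cons assms(2) by simp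
  qed
qed

lemma foldr_push_push:
  assumes "reduced w"
  shows "foldr push (push p u) w = push p (foldr push u w)"
  using assms by (cases u) (auto simp: push_push_cancelling reduced_foldr_push)

lemma foldr_push_assoc:
  assumes "reduced w"
  shows "foldr push (foldr push u v) w = foldr push u (foldr push v w)"
  using assms by (induction u) (auto simp: foldr_push_push)

lemma foldr_push_Nil: "reduced w \<Longrightarrow> foldr push w [] = w"
proof (induction w)
  case (Cons p w)
  then show ?case by (cases w) (auto simp: reduced_def)
qed simp

lemma reduced_inverse:
  "reduced w \<Longrightarrow> reduced (rev (map (\<lambda>p. (fst p, \<not> snd p)) w))"
  unfolding reduced_def successively_rev successively_map
  by (erule successively_mono) (auto simp: cancelling_def)

lemma foldr_push_inverse:
  "foldr push (rev (map (\<lambda>p. (fst p, \<not> snd p)) w)) w = []"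
  by (induction w) (auto simp: cancelling_def)

lemma group_free_group: "group (free_group S)"
proof (rule groupI)
  fix w assume w: "w \<in> carrier (free_group S)"
  show "\<exists>v\<in>carrier (free_group S). v \<otimes>\<^bsub>free_group S\<^esub> w = \<one>\<^bsub>free_group S\<^esub>"
    using w by (intro bexI[of _ "rev (map (\<lambda>p. (fst p, \<not> snd p)) w)"])
      (auto simp: free_group_def foldr_push_inverse reduced_inverse image_image)
next
  fix u v assume "u \<in> carrier (free_group S)" "v \<in> carrier (free_group S)"
  then show "u \<otimes>\<^bsub>free_group S\<^esub> v \<in> carrier (free_group S)"
    using set_foldr_push[of u v] by (fastforce simp: free_group_def reduced_foldr_push)
qed (auto simp: free_group_def foldr_push_assoc, simp add: reduced_def)

lemma free_gen_in_carrier: "x \<in> S \<Longrightarrow> free_gen x \<in> carrier (free_group S)"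
  by (simp add: free_gen_def free_group_def reduced_def)

lemma normal_normal_closure:
  assumes "group G" "A \<subseteq> carrier G"
  shows "normal_closure G A \<lhd> G"
proof -
  interpret group G by fact
  have "carrier G \<lhd> G"
    by (simp add: normal_inv_iff subgroup_self)
  then have ne: "{N. N \<lhd> G \<and> A \<subseteq> N} \<noteq> {}"
    using assms(2) by blast
  have "subgroup (\<Inter>{N. N \<lhd> G \<and> A \<subseteq> N}) G"
    by (rule subgroups_Inter) (use ne in \<open>auto simp: normal_inv_iff\<close>)
  then show ?thesis
    unfolding normal_closure_def by (auto simp: normal_inv_iff)
qed

lemma relators_in_carrier:
  assumes "R \<subseteq> carrier (free_group S) \<times> carrier (free_group S)"
  shows "relators S R \<subseteq> carrier (free_group S)"
proof -
  interpret group "free_group S" by (rule group_free_group)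
  show ?thesis using assms by (auto simp: relators_def)
qed

lemma group_presented_group:
  assumes "R \<subseteq> carrier (free_group S) \<times> carrier (free_group S)"
  shows "group (presented_group S R)"
  unfolding presented_group_def
  by (intro normal.factorgroup_is_group normal_normal_closure group_free_group
      relators_in_carrier assms)

lemma presented_gen_in_carrier:
  assumes "x \<in> S"
  shows "presented_gen S R x \<in> carrier (presented_group S R)"
  using free_gen_in_carrier[OF assms]
  by (auto simp: presented_gen_def presented_group_def FactGroup_def RCOSETS_def)

lemma braid_relations_in_carrier:
  "braid_relations n \<subseteq> carrier (free_group {1..<n}) \<times> carrier (free_group {1..<n})"
proof -
  interpret group "free_group {1..<n}" by (rule group_free_group)
  show ?thesis
    by (auto simp: braid_relations_def Let_def simp del: One_nat_def
        intro!: m_closed free_gen_in_carrier)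
qed

lemma group_braid_group: "group (braid_group n)"
  unfolding braid_group_def by (intro group_presented_group braid_relations_in_carrier)

lemma normal_truncation_subgroup: "truncation_subgroup n d \<lhd> braid_group n"
proof -
  interpret group "braid_group n" by (rule group_braid_group)
  have "braid_gen n 1 \<in> carrier (braid_group n)" if "2 \<le> n"
    unfolding braid_gen_def braid_group_def
    by (rule presented_gen_in_carrier) (use that in auto)
  then show ?thesis
    unfolding truncation_subgroup_def
    by (intro normal_normal_closure group_braid_group) auto
qed

lemma group_truncated_braid_group: "group (truncated_braid_group n d)"
  unfolding truncated_braid_group_def
  by (rule normal.factorgroup_is_group[OF normal_truncation_subgroup])

lemma group_primitive_Burnside_group: "group (primitive_Burnside_group n d)"
proof -
  interpret group "free_group {1..n}" by (rule group_free_group)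
  show ?thesis
    unfolding primitive_Burnside_group_def Let_def
    by (rule group_presented_group) (auto simp: primitive_def free_basis_def simp del: One_nat_def)
qed

lemma group_semidirect_product:
  assumes "group N" "group H" "\<theta> \<in> hom H (AutoGroup N)"
  shows "group (semidirect_product N H \<theta>)"
proof -
  interpret N: group N by fact
  interpret H: group H by fact
  interpret A: group "AutoGroup N" by (rule N.AutoGroup)
  interpret \<theta>: group_hom H "AutoGroup N" \<theta>
    by unfold_locales (fact assms(3))
  have \<theta>_auto: "\<theta> h \<in> auto N" if "h \<in> carrier H" for h
    using \<theta>.hom_closed[OF that] by (simp add: AutoGroup_def)
  have \<theta>_closed [simp]: "\<theta> h n \<in> carrier N" if "h \<in> carrier H" "n \<in> carrier N" for h n
    using \<theta>_auto[OF that(1)] that(2) by (auto simp: auto_def hom_def)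
  have \<theta>_mult [simp]: "\<theta> h (n \<otimes>\<^bsub>N\<^esub> n') = \<theta> h n \<otimes>\<^bsub>N\<^esub> \<theta> h n'"
    if "h \<in> carrier H" "n \<in> carrier N" "n' \<in> carrier N" for h n n'
    using \<theta>_auto[OF that(1)] that(2,3) by (auto simp: auto_def hom_def)
  have \<theta>_comp [simp]: "\<theta> (h \<otimes>\<^bsub>H\<^esub> h') n = \<theta> h (\<theta> h' n)"
    if "h \<in> carrier H" "h' \<in> carrier H" "n \<in> carrier N" for h h' n
    using \<theta>.hom_mult[OF that(1,2)] \<theta>_auto[OF that(1)] \<theta>_auto[OF that(2)] that(3)
    by (simp add: AutoGroup_def BijGroup_def auto_def compose_def)
  have \<theta>_one [simp]: "\<theta> \<one>\<^bsub>H\<^esub> n = n" if "n \<in> carrier N" for n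
    using \<theta>.hom_one that by (simp add: AutoGroup_def BijGroup_def)
  show ?thesis
  proof (rule groupI)
    fix x assume "x \<in> carrier (semidirect_product N H \<theta>)"
    then obtain n h where x: "x = (n, h)" "n \<in> carrier N" "h \<in> carrier H"
      by (auto simp: semidirect_product_def)
    have "\<theta> (inv\<^bsub>H\<^esub> h) (inv\<^bsub>N\<^esub> n) \<otimes>\<^bsub>N\<^esub> \<theta> (inv\<^bsub>H\<^esub> h) n = \<theta> (inv\<^bsub>H\<^esub> h) \<one>\<^bsub>N\<^esub>"
      using x by (simp del: \<theta>_mult \<theta>.hom_inv flip: \<theta>_mult)
    moreover have "\<theta> (inv\<^bsub>H\<^esub> h) \<one>\<^bsub>N\<^esub> = \<one>\<^bsub>N\<^esub>"
      using \<theta>_mult[of "inv\<^bsub>H\<^esub> h" "\<one>\<^bsub>N\<^esub>" "\<one>\<^bsub>N\<^esub>"] x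
      by (metis H.inv_closed N.l_cancel_one N.one_closed N.r_one \<theta>_closed)
    ultimately show "\<exists>y\<in>carrier (semidirect_product N H \<theta>).
        y \<otimes>\<^bsub>semidirect_product N H \<theta>\<^esub> x = \<one>\<^bsub>semidirect_product N H \<theta>\<^esub>"
      using x by (intro bexI[of _ "(\<theta> (inv\<^bsub>H\<^esub> h) (inv\<^bsub>N\<^esub> n), inv\<^bsub>H\<^esub> h)"])
        (auto simp: semidirect_product_def simp del: \<theta>.hom_inv)
  qed (auto simp: semidirect_product_def N.m_assoc H.m_assoc
      simp del: \<theta>.hom_mult \<theta>.hom_one)
qed

end

theory Submission
  imports Defs
begin

text \<open>
  In a group with elements \<open>s\<^sub>1, s\<^sub>2, s\<^sub>3\<close> satisfying the braid relations, put \<open>a = s\<^sub>1 s\<^sub>3\<inverse>\<close> and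
  \<open>b = s\<^sub>2 a s\<^sub>2\<inverse>\<close>. Conjugation by \<open>s\<^sub>1\<close> maps \<open>(a, b)\<close> to \<open>(a, b a\<inverse>)\<close>, and conjugation by \<open>s\<^sub>2\<close> maps it
  to \<open>(b, b a\<inverse> b)\<close>. These are automorphisms of the free group of rank two, so they act on its primitive
  Burnside quotient; there the first one has \<open>d\<close>-th power \<open>b \<mapsto> b a\<^sup>-\<^sup>d = b\<close>, hence the three strand group
  acts, and \<open>s\<^sub>3 \<mapsto> a\<inverse> s\<^sub>1\<close> defines a map from the four strand group to the semidirect product.

  The inverse map needs \<open>w(a, b)\<^sup>d = 1\<close> for all primitive \<open>w\<close>. By Nielsen reduction every basis of the
  free group of rank two is obtained from the standard one by elementary moves and conjugations. All
  elementary moves except inversions are realised on \<open>(a, b)\<close> by conjugation in the four strand group,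
  so \<open>w(a, b)\<close> is conjugate to \<open>a\<close> or \<open>a\<inverse>\<close>, and \<open>a\<^sup>d = s\<^sub>1\<^sup>d s\<^sub>3\<^sup>-\<^sup>d = 1\<close>.
\<close>

section \<open>Homomorphisms and generating sets\<close>

text \<open>Length alone does not settle Nielsen reduction: both neighbours of a factor may cancel
  exactly half of it, and then multiplying leaves the total length unchanged. The usual remedy is an
  auxiliary well-order on words. In rank two such a tie has a rigid shape: after one elementary
  move, a conjugation in the free group shortens the pair. Hence conjugation is among the permitted
  moves; it is harmless, because it becomes a conjugation in the four strand group and the claim on
  \<open>d\<close>-th powers is invariant under that. The formulas for conjugation by
  \<open>s1\<close> and \<open>s2\<close> have determinant one on exponent vectors, so as
  automorphisms of the free group they yield neither the plain swap of \<open>a\<close> and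
  \<open>b\<close> nor the inversion of one of them. The invariant carried through the reduction
  therefore allows \<open>a\<close> and \<open>b\<close> up to sign. Imposing the power relation on
  all primitive words is what lets these automorphisms descend, since automorphisms permute the
  primitive elements.\<close>

lemma hom_eqI:
  assumes "group G" "group H" "\<phi> \<in> hom G H" "\<psi> \<in> hom G H" "A \<subseteq> carrier G"
    and gen: "generate G A = carrier G" and eq: "\<And>x. x \<in> A \<Longrightarrow> \<phi> x = \<psi> x"
    and g: "g \<in> carrier G"
  shows "\<phi> g = \<psi> g"
proof -
  interpret group G by fact
  interpret H: group H by fact
  interpret \<phi>: group_hom G H \<phi> by unfold_locales fact
  interpret \<psi>: group_hom G H \<psi> by unfold_locales fact
  have "subgroup {x \<in> carrier G. \<phi> x = \<psi> x} G"
    by (auto intro: subgroup.intro)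
  then have "generate G A \<subseteq> {x \<in> carrier G. \<phi> x = \<psi> x}"
    using assms(5) eq by (intro generate_subgroup_incl) auto
  then show ?thesis using g gen by auto
qed

lemma (in group) cancel_left:
  assumes "x \<in> carrier G" "y \<in> carrier G"
  shows "x \<otimes> (inv x \<otimes> y) = y" "inv x \<otimes> (x \<otimes> y) = y"
  using assms by (simp_all flip: m_assoc)

lemma (in group) generate_pair_eqI:
  assumes "generate G {u, v} = carrier G" "subgroup K G" "u \<in> K" "v \<in> K"
  shows "K = carrier G"
  using generate_subgroup_incl[of "{u, v}" K] assms subgroup.subset by blast

section \<open>Conjugation in a group\<close>

definition (in group) conjugate :: "'a \<Rightarrow> 'a \<Rightarrow> 'a" where
  "conjugate g x = g \<otimes> x \<otimes> inv g"

context group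
begin

lemma conjugate_closed [simp]:
  "g \<in> carrier G \<Longrightarrow> x \<in> carrier G \<Longrightarrow> conjugate g x \<in> carrier G"
  by (simp add: conjugate_def)

lemma conjugate_mult:
  "g \<in> carrier G \<Longrightarrow> x \<in> carrier G \<Longrightarrow> y \<in> carrier G \<Longrightarrow>
    conjugate g (x \<otimes> y) = conjugate g x \<otimes> conjugate g y"
  by (simp add: conjugate_def m_assoc cancel_left)

lemma conjugate_inv:
  "g \<in> carrier G \<Longrightarrow> x \<in> carrier G \<Longrightarrow> conjugate g (inv x) = inv (conjugate g x)"
  by (simp add: conjugate_def m_assoc inv_mult_group)

lemma conjugate_comp:
  "g \<in> carrier G \<Longrightarrow> h \<in> carrier G \<Longrightarrow> x \<in> carrier G \<Longrightarrow>
    conjugate (g \<otimes> h) x = conjugate g (conjugate h x)"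
  by (simp add: conjugate_def m_assoc inv_mult_group)

lemma conjugate_inv_cancel:
  "g \<in> carrier G \<Longrightarrow> x \<in> carrier G \<Longrightarrow> conjugate (inv g) (conjugate g x) = x"
  by (simp add: conjugate_def m_assoc cancel_left)

lemma conjugate_pow:
  assumes "g \<in> carrier G" "x \<in> carrier G"
  shows "conjugate g x [^] (n :: nat) = conjugate g (x [^] n)"
  by (induction n) (use assms in \<open>simp_all add: conjugate_mult\<close>, simp add: conjugate_def)

lemma conjugate_hom: "g \<in> carrier G \<Longrightarrow> conjugate g \<in> hom G G"
  by (rule homI) (simp_all add: conjugate_mult)

end

lemma pow_eq_one_conjugateD:
  assumes "group G" "g \<in> carrier G" "x \<in> carrier G"
    and "group.conjugate G g x [^]\<^bsub>G\<^esub> (n :: nat) = \<one>\<^bsub>G\<^esub>"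
  shows "x [^]\<^bsub>G\<^esub> n = \<one>\<^bsub>G\<^esub>"
proof -
  interpret group G by fact
  have "conjugate (inv\<^bsub>G\<^esub> g) (conjugate g (x [^]\<^bsub>G\<^esub> n)) = \<one>\<^bsub>G\<^esub>"
    using assms by (simp flip: conjugate_pow) (simp add: conjugate_def)
  then show ?thesis using assms(2,3) by (simp add: conjugate_inv_cancel)
qed

section \<open>Free groups\<close>

lemma free_lift_Nil [simp]: "free_lift G f [] = \<one>\<^bsub>G\<^esub>"
  by (simp add: free_lift_def)

lemma free_lift_Cons [simp]:
  "free_lift G f (p # w) =
    (if snd p then f (fst p) else inv\<^bsub>G\<^esub> f (fst p)) \<otimes>\<^bsub>G\<^esub> free_lift G f w"
  by (cases p) (simp add: free_lift_def)

lemma free_lift_closed: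
  assumes "group G" "\<And>x. x \<in> fst ` set w \<Longrightarrow> f x \<in> carrier G"
  shows "free_lift G f w \<in> carrier G"
proof -
  interpret group G by fact
  show ?thesis using assms(2) by (induction w) auto
qed

lemma carrier_free_group: "w \<in> carrier (free_group S) \<longleftrightarrow> reduced w \<and> fst ` set w \<subseteq> S"
  by (simp add: free_group_def)

lemma mult_free_group: "u \<otimes>\<^bsub>free_group S\<^esub> v = foldr push u v"
  by (simp add: free_group_def)

lemma one_free_group: "\<one>\<^bsub>free_group S\<^esub> = []"
  by (simp add: free_group_def)

text \<open>\<open>push\<close> prepends a letter or cancels it against its inverse, and a group
  cannot tell the two apart.\<close>

lemma free_lift_push:
  assumes "group G" "\<And>x. x \<in> fst ` set (p # w) \<Longrightarrow> f x \<in> carrier G"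
  shows "free_lift G f (push p w) = free_lift G f (p # w)"
proof (cases w)
  case (Cons q v)
  interpret group G by fact
  have c: "f (fst p) \<in> carrier G" "f (fst q) \<in> carrier G" "free_lift G f v \<in> carrier G"
    using assms Cons by (auto intro!: free_lift_closed[OF assms(1)])
  then show ?thesis
    using Cons by (auto simp: cancelling_def cancel_left)
qed simp

lemma free_lift_hom:
  assumes "group G" "f \<in> S \<rightarrow> carrier G"
  shows "free_lift G f \<in> hom (free_group S) G"
proof (rule homI)
  fix u assume "u \<in> carrier (free_group S)"
  then show "free_lift G f u \<in> carrier G"
    using assms by (intro free_lift_closed) (auto simp: carrier_free_group Pi_iff subset_iff)
next
  interpret group G by fact
  fix u v assume "u \<in> carrier (free_group S)" "v \<in> carrier (free_group S)"
  then have "fst ` set u \<subseteq> S" "fst ` set v \<subseteq> S" by (auto simp: carrier_free_group)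
  then have "free_lift G f (foldr push u v) = free_lift G f u \<otimes>\<^bsub>G\<^esub> free_lift G f v"
  proof (induction u)
    case Nil
    then have "free_lift G f v \<in> carrier G"
      using assms by (intro free_lift_closed) (auto simp: Pi_iff subset_iff)
    then show ?case by simp
  next
    case (Cons p u)
    have S: "fst ` set (foldr push u v) \<subseteq> S"
      using set_foldr_push[of u v] Cons.prems by fastforce
    have c: "free_lift G f v \<in> carrier G" "free_lift G f u \<in> carrier G" "f (fst p) \<in> carrier G"
      using assms Cons.prems by (auto intro!: free_lift_closed simp: Pi_iff subset_iff)
    have "free_lift G f (push p (foldr push u v)) = free_lift G f (p # foldr push u v)"
      using S Cons.prems assms by (intro free_lift_push) (auto simp: Pi_iff subset_iff)
    then show ?case using Cons c by (simp add: m_assoc)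
  qed
  then show "free_lift G f (u \<otimes>\<^bsub>free_group S\<^esub> v) = free_lift G f u \<otimes>\<^bsub>G\<^esub> free_lift G f v"
    by (simp add: mult_free_group)
qed

lemma free_lift_gen:
  assumes "group G" "f x \<in> carrier G"
  shows "free_lift G f (free_gen x) = f x"
proof -
  interpret group G by fact
  show ?thesis using assms by (simp add: free_gen_def)
qed

lemma inv_free_gen: "x \<in> S \<Longrightarrow> inv\<^bsub>free_group S\<^esub> free_gen x = [(x, False)]"
  by (rule group.inv_equality[OF group_free_group])
    (auto simp: mult_free_group one_free_group free_gen_def carrier_free_group cancelling_def
      reduced_def)

lemma generate_free_group: "generate (free_group S) (free_gen ` S) = carrier (free_group S)"
proof (rule subset_antisym)
  interpret group "free_group S" by (rule group_free_group)
  show "generate (free_group S) (free_gen ` S) \<subseteq> carrier (free_group S)"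
    by (rule generate_incl) (auto intro: free_gen_in_carrier)
  show "carrier (free_group S) \<subseteq> generate (free_group S) (free_gen ` S)"
  proof
    fix w assume "w \<in> carrier (free_group S)"
    then show "w \<in> generate (free_group S) (free_gen ` S)"
    proof (induction w)
      case Nil
      then show ?case by (metis generate.one one_free_group)
    next
      case (Cons p w)
      then have p: "fst p \<in> S" and red: "reduced (p # w)" and w: "w \<in> carrier (free_group S)"
        by (auto simp: carrier_free_group reduced_def successively_Cons)
      have "[p] \<in> generate (free_group S) (free_gen ` S)"
      proof (cases "snd p")
        case True
        then have "[p] = free_gen (fst p)" by (metis free_gen_def prod.collapse)
        then show ?thesis using p by (auto intro: generate.incl)
      next
        case False
        then have "[p] = inv\<^bsub>free_group S\<^esub> free_gen (fst p)"
          using p by (simp add: inv_free_gen) (metis prod.collapse)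
        then show ?thesis using p by (auto intro: generate.inv)
      qed
      moreover have "p # w = [p] \<otimes>\<^bsub>free_group S\<^esub> w"
        using red by (cases w) (auto simp: mult_free_group reduced_def)
      ultimately show ?case using Cons.IH[OF w] by (auto intro: generate.eng)
    qed
  qed
qed

section \<open>Presentations\<close>

lemma normal_closure_incl: "A \<subseteq> normal_closure G A"
  by (auto simp: normal_closure_def)

lemma normal_closure_minimal: "N \<lhd> G \<Longrightarrow> A \<subseteq> N \<Longrightarrow> normal_closure G A \<subseteq> N"
  by (auto simp: normal_closure_def)

text \<open>The kernel is a normal subgroup containing \<open>A\<close>, so it contains the normal
  closure, and the homomorphism factors.\<close>

lemma hom_Mod_normal_closure:
  assumes "group G" "group H" "A \<subseteq> carrier G" "\<phi> \<in> hom G H" "\<And>x. x \<in> A \<Longrightarrow> \<phi> x = \<one>\<^bsub>H\<^esub>"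
  shows "\<exists>\<psi> \<in> hom (G Mod normal_closure G A) H.
    \<forall>g \<in> carrier G. \<psi> (normal_closure G A #>\<^bsub>G\<^esub> g) = \<phi> g"
proof -
  interpret group_hom G H \<phi>
    by (intro group_hom.intro assms group_hom_axioms.intro)
  have "normal_closure G A \<subseteq> kernel G H \<phi>"
    using assms by (intro normal_closure_minimal normal_kernel) (auto simp: kernel_def)
  then show ?thesis
    using FactGroup_universal_kernel[OF normal_normal_closure[OF assms(1,3)]] by metis
qed

lemma generate_Mod:
  assumes "N \<lhd> G" "A \<subseteq> carrier G" "generate G A = carrier G"
  shows "generate (G Mod N) ((\<lambda>x. N #>\<^bsub>G\<^esub> x) ` A) = carrier (G Mod N)"
proof -
  interpret normal N G by fact
  interpret q: group_hom G "G Mod N" "\<lambda>x. N #>\<^bsub>G\<^esub> x"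
    by (intro group_hom.intro group_hom_axioms.intro r_coset_hom_Mod factorgroup_is_group
        group_axioms)
  show ?thesis
    using q.generate_img[OF assms(2)] assms(3) by (simp add: carrier_FactGroup)
qed

lemma Mod_normal_closure_one:
  assumes "group G" "A \<subseteq> carrier G" "x \<in> A"
  shows "normal_closure G A #>\<^bsub>G\<^esub> x = \<one>\<^bsub>G Mod normal_closure G A\<^esub>"
proof -
  interpret normal "normal_closure G A" G by (rule normal_normal_closure[OF assms(1,2)])
  show ?thesis
    using normal_closure_incl[of A G] assms(3) by (simp add: subset_iff rcos_const)
qed

lemma coset_hom_presented:
  assumes "R \<subseteq> carrier (free_group S) \<times> carrier (free_group S)"
  shows "(\<lambda>w. normal_closure (free_group S) (relators S R) #>\<^bsub>free_group S\<^esub> w)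
    \<in> hom (free_group S) (presented_group S R)"
  unfolding presented_group_def
  by (intro normal.r_coset_hom_Mod normal_normal_closure group_free_group relators_in_carrier assms)

lemma presented_relation:
  assumes "R \<subseteq> carrier (free_group S) \<times> carrier (free_group S)" "(u, v) \<in> R"
  shows "normal_closure (free_group S) (relators S R) #>\<^bsub>free_group S\<^esub> u =
    normal_closure (free_group S) (relators S R) #>\<^bsub>free_group S\<^esub> v"
proof -
  let ?F = "free_group S" and ?q = "\<lambda>w. normal_closure (free_group S) (relators S R) #>\<^bsub>free_group S\<^esub> w"
  interpret q: group_hom ?F "presented_group S R" ?q
    by (intro group_hom.intro group_hom_axioms.intro coset_hom_presented group_free_group
        group_presented_group assms(1))
  have uv: "u \<in> carrier ?F" "v \<in> carrier ?F" using assms by auto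
  have "u \<otimes>\<^bsub>?F\<^esub> inv\<^bsub>?F\<^esub> v \<in> relators S R"
    using assms(2) by (auto simp: relators_def)
  then have "?q (u \<otimes>\<^bsub>?F\<^esub> inv\<^bsub>?F\<^esub> v) = \<one>\<^bsub>presented_group S R\<^esub>"
    unfolding presented_group_def
    by (intro Mod_normal_closure_one group_free_group relators_in_carrier assms(1))
  then have "?q u \<otimes>\<^bsub>presented_group S R\<^esub> inv\<^bsub>presented_group S R\<^esub> ?q v = \<one>\<^bsub>presented_group S R\<^esub>"
    using uv by simp
  then show ?thesis
    using uv q.H.inv_solve_right[of "\<one>\<^bsub>presented_group S R\<^esub>" "?q u" "?q v"]
    by (simp del: q.hom_inv)
qed

lemma hom_presented_group:
  assumes "group H" "R \<subseteq> carrier (free_group S) \<times> carrier (free_group S)"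
    and "\<phi> \<in> hom (free_group S) H" "\<And>u v. (u, v) \<in> R \<Longrightarrow> \<phi> u = \<phi> v"
  shows "\<exists>\<psi> \<in> hom (presented_group S R) H. \<forall>w \<in> carrier (free_group S).
    \<psi> (normal_closure (free_group S) (relators S R) #>\<^bsub>free_group S\<^esub> w) = \<phi> w"
  unfolding presented_group_def
proof (intro hom_Mod_normal_closure group_free_group relators_in_carrier assms)
  interpret group_hom "free_group S" H \<phi>
    by (intro group_hom.intro assms group_hom_axioms.intro group_free_group)
  fix x assume "x \<in> relators S R"
  then obtain u v where "x = u \<otimes>\<^bsub>free_group S\<^esub> inv\<^bsub>free_group S\<^esub> v" "(u, v) \<in> R"
    by (auto simp: relators_def)
  then show "\<phi> x = \<one>\<^bsub>H\<^esub>" using assms(2,4) by auto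
qed

lemma generate_presented_group:
  assumes "R \<subseteq> carrier (free_group S) \<times> carrier (free_group S)"
  shows "generate (presented_group S R) (presented_gen S R ` S) = carrier (presented_group S R)"
proof -
  have "free_gen ` S \<subseteq> carrier (free_group S)" by (auto intro: free_gen_in_carrier)
  from generate_Mod[OF normal_normal_closure[OF group_free_group relators_in_carrier[OF assms]]
      this generate_free_group]
  show ?thesis by (simp add: presented_group_def presented_gen_def[abs_def] image_image)
qed

section \<open>Truncated braid groups\<close>

text \<open>Packages the data of a homomorphism out of the braid group. The truncation is kept
  apart, because it is one further condition on \<open>s 1\<close> alone.\<close>

locale braid_tuple = group +
  fixes n :: nat and s :: "nat \<Rightarrow> 'a"
  assumes s_closed: "i \<in> {1..<n} \<Longrightarrow> s i \<in> carrier G"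
    and s_braid: "i \<in> {1..<n} \<Longrightarrow> i + 1 \<in> {1..<n} \<Longrightarrow>
      s i \<otimes> s (i + 1) \<otimes> s i = s (i + 1) \<otimes> s i \<otimes> s (i + 1)"
    and s_commute: "i \<in> {1..<n} \<Longrightarrow> j \<in> {1..<n} \<Longrightarrow> \<bar>int i - int j\<bar> > 1 \<Longrightarrow>
      s i \<otimes> s j = s j \<otimes> s i"

lemma braid_tuple_hom:
  assumes "braid_tuple G n s" "group H" "\<phi> \<in> hom G H"
  shows "braid_tuple H n (\<lambda>i. \<phi> (s i))"
proof -
  interpret braid_tuple G n s by fact
  interpret group_hom G H \<phi> by (intro group_hom.intro assms group_hom_axioms.intro group_axioms)
  show ?thesis
  proof
    show "\<phi> (s i) \<in> carrier H" if "i \<in> {1..<n}" for i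
      using that s_closed by simp
    show "\<phi> (s i) \<otimes>\<^bsub>H\<^esub> \<phi> (s (i + 1)) \<otimes>\<^bsub>H\<^esub> \<phi> (s i) =
        \<phi> (s (i + 1)) \<otimes>\<^bsub>H\<^esub> \<phi> (s i) \<otimes>\<^bsub>H\<^esub> \<phi> (s (i + 1))"
      if "i \<in> {1..<n}" "i + 1 \<in> {1..<n}" for i
      using arg_cong[OF s_braid[OF that], of \<phi>] s_closed that by simp
    show "\<phi> (s i) \<otimes>\<^bsub>H\<^esub> \<phi> (s j) = \<phi> (s j) \<otimes>\<^bsub>H\<^esub> \<phi> (s i)"
      if "i \<in> {1..<n}" "j \<in> {1..<n}" "\<bar>int i - int j\<bar> > 1" for i j
      using arg_cong[OF s_commute[OF that], of \<phi>] s_closed that by simp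
  qed
qed

lemma braid_gen_closed: "i \<in> {1..<n} \<Longrightarrow> braid_gen n i \<in> carrier (braid_group n)"
  unfolding braid_gen_def braid_group_def by (rule presented_gen_in_carrier)

lemma braid_tuple_braid_gen: "braid_tuple (braid_group n) n (braid_gen n)"
proof -
  let ?S = "{1..<n}" and ?R = "braid_relations n"
  let ?F = "free_group ?S"
  let ?q = "\<lambda>w. normal_closure ?F (relators ?S ?R) #>\<^bsub>?F\<^esub> w"
  interpret q: group_hom ?F "braid_group n" ?q
    unfolding braid_group_def
    by (intro group_hom.intro group_hom_axioms.intro coset_hom_presented group_free_group
        group_presented_group braid_relations_in_carrier)
  have gen: "braid_gen n i = ?q (free_gen i)" for i
    by (simp add: braid_gen_def presented_gen_def)
  note rel = presented_relation[OF braid_relations_in_carrier]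
  have F: "free_gen i \<in> carrier ?F" if "i \<in> ?S" for i
    using that by (rule free_gen_in_carrier)
  show ?thesis
  proof
    show "braid_gen n i \<in> carrier (braid_group n)" if "i \<in> ?S" for i
      using that by (rule braid_gen_closed)
    show "braid_gen n i \<otimes>\<^bsub>braid_group n\<^esub> braid_gen n (i + 1) \<otimes>\<^bsub>braid_group n\<^esub> braid_gen n i =
        braid_gen n (i + 1) \<otimes>\<^bsub>braid_group n\<^esub> braid_gen n i \<otimes>\<^bsub>braid_group n\<^esub> braid_gen n (i + 1)"
      if i: "i \<in> ?S" "i + 1 \<in> ?S" for i
    proof -
      have "(free_gen i \<otimes>\<^bsub>?F\<^esub> free_gen (i + 1) \<otimes>\<^bsub>?F\<^esub> free_gen i,
          free_gen (i + 1) \<otimes>\<^bsub>?F\<^esub> free_gen i \<otimes>\<^bsub>?F\<^esub> free_gen (i + 1)) \<in> ?R"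
        unfolding braid_relations_def Let_def using i by blast
      from rel[OF this] show ?thesis
        unfolding gen by (simp only: q.hom_mult q.G.m_closed F[OF i(1)] F[OF i(2)])
    qed
    show "braid_gen n i \<otimes>\<^bsub>braid_group n\<^esub> braid_gen n j = braid_gen n j \<otimes>\<^bsub>braid_group n\<^esub> braid_gen n i"
      if ij: "i \<in> ?S" "j \<in> ?S" "\<bar>int i - int j\<bar> > 1" for i j
    proof -
      have "(free_gen i \<otimes>\<^bsub>?F\<^esub> free_gen j, free_gen j \<otimes>\<^bsub>?F\<^esub> free_gen i) \<in> ?R"
        unfolding braid_relations_def Let_def using ij by blast
      from rel[OF this] show ?thesis
        unfolding gen by (simp only: q.hom_mult F[OF ij(1)] F[OF ij(2)])
    qed
  qed
qed

lemma hom_braid_group: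
  assumes "braid_tuple H n s"
  shows "\<exists>\<phi> \<in> hom (braid_group n) H. \<forall>i \<in> {1..<n}. \<phi> (braid_gen n i) = s i"
proof -
  interpret braid_tuple H n s by fact
  let ?S = "{1..<n}"
  have l: "free_lift H s \<in> hom (free_group ?S) H"
    using s_closed by (intro free_lift_hom group_axioms) auto
  interpret l: group_hom "free_group ?S" H "free_lift H s"
    by (intro group_hom.intro group_hom_axioms.intro l group_axioms group_free_group)
  have g: "free_lift H s (free_gen i) = s i" "free_gen i \<in> carrier (free_group ?S)"
    if "i \<in> ?S" for i
    using that s_closed by (auto intro: free_lift_gen group_axioms free_gen_in_carrier)
  have "free_lift H s u = free_lift H s v" if "(u, v) \<in> braid_relations n" for u v
    using that g s_closed s_braid s_commute
    by (auto simp: braid_relations_def Let_def simp del: One_nat_def)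
  from hom_presented_group[OF group_axioms braid_relations_in_carrier l this]
  obtain \<psi> where "\<psi> \<in> hom (braid_group n) H" and
    \<psi>: "\<And>w. w \<in> carrier (free_group ?S) \<Longrightarrow>
      \<psi> (normal_closure (free_group ?S) (relators ?S (braid_relations n)) #>\<^bsub>free_group ?S\<^esub> w) =
      free_lift H s w"
    unfolding braid_group_def by blast
  then show ?thesis
    using g by (intro bexI[of _ \<psi>]) (auto simp: braid_gen_def presented_gen_def)
qed

lemma truncation_coset_hom:
  "(\<lambda>x. truncation_subgroup n d #>\<^bsub>braid_group n\<^esub> x) \<in> hom (braid_group n) (truncated_braid_group n d)"
  unfolding truncated_braid_group_def
  by (rule normal.r_coset_hom_Mod[OF normal_truncation_subgroup])

lemma braid_tuple_truncated_braid_gen: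
  "braid_tuple (truncated_braid_group n d) n (truncated_braid_gen n d)"
  using braid_tuple_hom[OF braid_tuple_braid_gen group_truncated_braid_group truncation_coset_hom]
  by (simp add: truncated_braid_gen_def[abs_def])

lemma truncated_braid_gen_1_pow:
  assumes "2 \<le> n"
  shows "truncated_braid_gen n d 1 [^]\<^bsub>truncated_braid_group n d\<^esub> d = \<one>\<^bsub>truncated_braid_group n d\<^esub>"
proof -
  let ?T = "truncation_subgroup n d" and ?B = "braid_group n"
  interpret q: group_hom ?B "truncated_braid_group n d" "\<lambda>x. ?T #>\<^bsub>?B\<^esub> x"
    by (intro group_hom.intro group_hom_axioms.intro truncation_coset_hom group_braid_group
        group_truncated_braid_group)
  have c: "braid_gen n 1 \<in> carrier ?B" using assms by (intro braid_gen_closed) auto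
  have "?T #>\<^bsub>?B\<^esub> (braid_gen n 1 [^]\<^bsub>?B\<^esub> d) = \<one>\<^bsub>truncated_braid_group n d\<^esub>"
    unfolding truncated_braid_group_def truncation_subgroup_def
    by (intro Mod_normal_closure_one group_braid_group) (use assms c in auto)
  then show ?thesis using c by (simp add: truncated_braid_gen_def q.hom_nat_pow)
qed

lemma hom_truncated_braid_group:
  assumes "braid_tuple H n s" "2 \<le> n" "s 1 [^]\<^bsub>H\<^esub> d = \<one>\<^bsub>H\<^esub>"
  shows "\<exists>\<phi> \<in> hom (truncated_braid_group n d) H.
    \<forall>i \<in> {1..<n}. \<phi> (truncated_braid_gen n d i) = s i"
proof -
  let ?B = "braid_group n"
  interpret braid_tuple H n s by fact
  obtain \<phi> where \<phi>: "\<phi> \<in> hom ?B H" "\<And>i. i \<in> {1..<n} \<Longrightarrow> \<phi> (braid_gen n i) = s i"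
    using hom_braid_group[OF assms(1)] by blast
  interpret \<phi>: group_hom ?B H \<phi>
    by (intro group_hom.intro group_hom_axioms.intro \<phi> group_braid_group group_axioms)
  have c: "braid_gen n 1 \<in> carrier ?B" using assms by (intro braid_gen_closed) auto
  have "\<exists>\<psi> \<in> hom (truncated_braid_group n d) H. \<forall>g \<in> carrier ?B.
      \<psi> (truncation_subgroup n d #>\<^bsub>?B\<^esub> g) = \<phi> g"
    unfolding truncated_braid_group_def truncation_subgroup_def
    by (intro hom_Mod_normal_closure group_braid_group group_axioms \<phi>(1))
      (use c assms \<phi> in \<open>auto simp: \<phi>.hom_nat_pow\<close>)
  then show ?thesis
    using \<phi>(2) braid_gen_closed by (metis truncated_braid_gen_def)
qed

lemma generate_truncated_braid_group:
  "generate (truncated_braid_group n d) (truncated_braid_gen n d ` {1..<n}) =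
    carrier (truncated_braid_group n d)"
proof -
  have "generate (braid_group n) (braid_gen n ` {1..<n}) = carrier (braid_group n)"
    using generate_presented_group[OF braid_relations_in_carrier, of n]
    by (simp add: braid_group_def braid_gen_def[abs_def])
  moreover have "braid_gen n ` {1..<n} \<subseteq> carrier (braid_group n)"
    using braid_gen_closed by blast
  ultimately show ?thesis
    using generate_Mod[OF normal_truncation_subgroup, of "braid_gen n ` {1..<n}" n d]
    by (simp add: truncated_braid_group_def truncated_braid_gen_def[abs_def] image_image)
qed

lemma truncated_braid_gen_closed:
  "i \<in> {1..<n} \<Longrightarrow> truncated_braid_gen n d i \<in> carrier (truncated_braid_group n d)"
  using braid_tuple.s_closed[OF braid_tuple_truncated_braid_gen] .

section \<open>Primitive elements and primitive Burnside groups\<close>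

lemma primitive_closed: "primitive G w \<Longrightarrow> w \<in> carrier G"
  by (auto simp: primitive_def free_basis_def)

text \<open>\<open>free_basis\<close> takes the group elements themselves as letters, so carrying a
  basis along a homomorphism means relabelling words; evaluation commutes with the
  relabelling.\<close>

lemma free_lift_map_iso:
  assumes "group G" "group H" "\<alpha> \<in> hom G H" "fst ` set w \<subseteq> carrier G"
  shows "free_lift H (\<lambda>x. x) (map (map_prod \<alpha> id) w) = \<alpha> (free_lift G (\<lambda>x. x) w)"
proof -
  interpret group_hom G H \<alpha>
    by (intro group_hom.intro group_hom_axioms.intro assms)
  show ?thesis using assms(4)
  proof (induction w)
    case (Cons p w)
    then have "free_lift G (\<lambda>x. x) w \<in> carrier G"
      by (intro free_lift_closed G.group_axioms) auto
    then show ?case using Cons by (cases p) (auto simp: subset_iff)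
  qed simp
qed

text \<open>Injectivity prevents distinct letters from being identified, which could create new
  cancellations.\<close>

lemma reduced_map:
  assumes "inj_on \<alpha> (fst ` set w)"
  shows "reduced (map (map_prod \<alpha> id) w) \<longleftrightarrow> reduced w"
proof -
  have "cancelling (map_prod \<alpha> id p) (map_prod \<alpha> id q) \<longleftrightarrow> cancelling p q"
    if "p \<in> set w" "q \<in> set w" for p q
    using inj_on_eq_iff[OF assms, of "fst p" "fst q"] that by (simp add: cancelling_def)
  then show ?thesis
    unfolding reduced_def successively_map by (intro successively_cong) auto
qed

lemma bij_betw_map_free_group:
  assumes "inj_on \<alpha> B"
  shows "bij_betw (map (map_prod \<alpha> id)) (carrier (free_group B)) (carrier (free_group (\<alpha> ` B)))"
    (is "bij_betw ?M _ _")
proof -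
  let ?inv = "map (map_prod (inv_into B \<alpha>) id)"
  have M: "?M w \<in> carrier (free_group (\<alpha> ` B)) \<longleftrightarrow> w \<in> carrier (free_group B)"
    if "fst ` set w \<subseteq> B" for w
    using that reduced_map[OF inj_on_subset[OF assms that]]
    by (auto simp: carrier_free_group)
  have inv_M: "?inv (?M w) = w" if "fst ` set w \<subseteq> B" for w
    using that by (intro nth_equalityI) (auto simp: prod_eq_iff inv_into_f_f[OF assms] image_subset_iff)
  have M_inv: "?M (?inv v) = v" if "fst ` set v \<subseteq> \<alpha> ` B" for v
    using that by (intro nth_equalityI) (auto simp: prod_eq_iff f_inv_into_f image_subset_iff)
  have inv_sub: "fst ` set (?inv v) \<subseteq> B" if "fst ` set v \<subseteq> \<alpha> ` B" for v
    using that by (auto simp: image_subset_iff intro!: inv_into_into)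
  have sub: "fst ` set w \<subseteq> A" if "w \<in> carrier (free_group A)" for w :: "'x word" and A
    using that by (simp add: carrier_free_group)
  show ?thesis
  proof (rule bij_betw_byWitness[where f' = ?inv])
    show "\<forall>w \<in> carrier (free_group B). ?inv (?M w) = w"
      using inv_M sub by blast
    show "\<forall>v \<in> carrier (free_group (\<alpha> ` B)). ?M (?inv v) = v"
      using M_inv sub by blast
    show "?M ` carrier (free_group B) \<subseteq> carrier (free_group (\<alpha> ` B))"
      using M sub by blast
    show "?inv ` carrier (free_group (\<alpha> ` B)) \<subseteq> carrier (free_group B)"
      using M M_inv inv_sub sub by (metis image_subsetI)
  qed
qed

lemma free_basis_iso_image:
  assumes "group G" "group H" "\<alpha> \<in> iso G H" "free_basis G B"
  shows "free_basis H (\<alpha> ` B)"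
proof -
  interpret group_hom G H \<alpha>
    using assms by (intro group_hom.intro group_hom_axioms.intro) (auto simp: iso_def)
  have bij: "bij_betw \<alpha> (carrier G) (carrier H)" using assms(3) by (simp add: iso_def)
  have BG: "B \<subseteq> carrier G" and iso: "free_lift G (\<lambda>x. x) \<in> iso (free_group B) G"
    using assms(4) by (auto simp: free_basis_def)
  then have bijB: "bij_betw (free_lift G (\<lambda>x. x)) (carrier (free_group B)) (carrier G)"
    by (simp add: iso_def)
  have BH: "\<alpha> ` B \<subseteq> carrier H" using BG by auto
  have inj: "inj_on \<alpha> B" using bij BG by (auto simp: bij_betw_def intro: inj_on_subset)
  have "bij_betw (free_lift H (\<lambda>x. x) \<circ> map (map_prod \<alpha> id)) (carrier (free_group B)) (carrier H)"
    using bij_betw_trans[OF bijB bij]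
  proof (rule iffD1[OF bij_betw_cong, rotated])
    fix w assume "w \<in> carrier (free_group B)"
    then have "fst ` set w \<subseteq> carrier G" using BG by (auto simp: carrier_free_group)
    then show "(\<alpha> \<circ> free_lift G (\<lambda>x. x)) w = (free_lift H (\<lambda>x. x) \<circ> map (map_prod \<alpha> id)) w"
      using free_lift_map_iso[OF assms(1,2) homh] by simp
  qed
  then have "bij_betw (free_lift H (\<lambda>x. x)) (carrier (free_group (\<alpha> ` B))) (carrier H)"
    using bij_betw_comp_iff[OF bij_betw_map_free_group[OF inj]] by blast
  then show ?thesis
    using free_lift_hom[OF assms(2), of "\<lambda>x. x" "\<alpha> ` B"] BH
    by (auto simp: free_basis_def iso_def)
qed

lemma primitive_iso_image:
  assumes "group G" "group H" "\<alpha> \<in> iso G H" "primitive G w"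
  shows "primitive H (\<alpha> w)"
  using free_basis_iso_image[OF assms(1-3)] assms(4) by (auto simp: primitive_def)

text \<open>Words over this basis are words whose letters are one-letter words. Evaluation undoes
  the relabelling by \<open>free_gen\<close>, which is a bijection, so evaluation is one
  too.\<close>

lemma free_basis_free_gen: "free_basis (free_group S) (free_gen ` S)"
proof -
  let ?F = "free_group S"
  have inj: "inj_on free_gen S" by (auto simp: free_gen_def inj_on_def)
  have lift: "free_lift ?F (\<lambda>x. x) (map (map_prod free_gen id) w) = w" if "w \<in> carrier ?F" for w
    using that
  proof (induction w)
    case (Cons p w)
    then have "w \<in> carrier ?F" "fst p \<in> S" "reduced (p # w)"
      by (auto simp: carrier_free_group reduced_def successively_Cons)
    moreover from this have "push p w = p # w" by (cases w) (auto simp: reduced_def)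
    ultimately show ?case
      using Cons.IH
      by (cases p) (auto simp: inv_free_gen[unfolded free_gen_def] mult_free_group free_gen_def)
  qed (simp add: one_free_group)
  have "bij_betw (free_lift ?F (\<lambda>x. x) \<circ> map (map_prod free_gen id)) (carrier ?F) (carrier ?F)"
    using bij_betw_id by (rule iffD1[OF bij_betw_cong, rotated]) (simp add: lift)
  then have "bij_betw (free_lift ?F (\<lambda>x. x)) (carrier (free_group (free_gen ` S))) (carrier ?F)"
    using bij_betw_comp_iff[OF bij_betw_map_free_group[OF inj]] by blast
  moreover have "free_gen ` S \<subseteq> carrier ?F" by (auto intro: free_gen_in_carrier)
  moreover from this have "free_lift ?F (\<lambda>x. x) \<in> hom (free_group (free_gen ` S)) ?F"
    by (intro free_lift_hom group_free_group) auto
  ultimately show ?thesis by (simp add: free_basis_def iso_def)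
qed

lemma primitive_free_gen: "x \<in> S \<Longrightarrow> primitive (free_group S) (free_gen x)"
  using free_basis_free_gen by (auto simp: primitive_def)

section \<open>The quotient map onto the primitive Burnside group and its universal property\<close>

definition Burnside_coset :: "nat \<Rightarrow> nat \<Rightarrow> nat word \<Rightarrow> nat word set" where
  "Burnside_coset n d w = (let F = free_group {1..n} in
     normal_closure F (relators {1..n} {(w [^]\<^bsub>F\<^esub> d, \<one>\<^bsub>F\<^esub>) | w. primitive F w}) #>\<^bsub>F\<^esub> w)"

lemma Burnside_relations_in_carrier:
  "{(w [^]\<^bsub>free_group S\<^esub> (d :: nat), \<one>\<^bsub>free_group S\<^esub>) | w. primitive (free_group S) w}
    \<subseteq> carrier (free_group S) \<times> carrier (free_group S)"
proof -
  interpret group "free_group S" by (rule group_free_group)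
  show ?thesis by (auto dest: primitive_closed)
qed

lemma Burnside_coset_hom:
  "Burnside_coset n d \<in> hom (free_group {1..n}) (primitive_Burnside_group n d)"
  using coset_hom_presented[OF Burnside_relations_in_carrier, of "{1..n}" d]
  by (simp add: Burnside_coset_def[abs_def] primitive_Burnside_group_def Let_def)

lemma Burnside_coset_pow:
  assumes "primitive (free_group {1..n}) w"
  shows "Burnside_coset n d w [^]\<^bsub>primitive_Burnside_group n d\<^esub> d = \<one>\<^bsub>primitive_Burnside_group n d\<^esub>"
proof -
  let ?F = "free_group {1..n}"
  interpret q: group_hom ?F "primitive_Burnside_group n d" "Burnside_coset n d"
    by (intro group_hom.intro group_hom_axioms.intro Burnside_coset_hom group_free_group
        group_primitive_Burnside_group)
  have "Burnside_coset n d (w [^]\<^bsub>?F\<^esub> d) = Burnside_coset n d \<one>\<^bsub>?F\<^esub>"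
    unfolding Burnside_coset_def Let_def
    by (rule presented_relation[OF Burnside_relations_in_carrier]) (use assms in blast)
  then show ?thesis
    using primitive_closed[OF assms] by (simp add: q.hom_nat_pow del: One_nat_def)
qed

lemma hom_primitive_Burnside_group:
  assumes "group H" "\<phi> \<in> hom (free_group {1..n}) H"
    and "\<And>w. primitive (free_group {1..n}) w \<Longrightarrow> \<phi> w [^]\<^bsub>H\<^esub> d = \<one>\<^bsub>H\<^esub>"
  shows "\<exists>\<psi> \<in> hom (primitive_Burnside_group n d) H.
    \<forall>w \<in> carrier (free_group {1..n}). \<psi> (Burnside_coset n d w) = \<phi> w"
proof -
  interpret \<phi>: group_hom "free_group {1..n}" H \<phi>
    by (intro group_hom.intro group_hom_axioms.intro group_free_group assms)
  have "\<phi> u = \<phi> v" if "(u, v) \<in> {(w [^]\<^bsub>free_group {1..n}\<^esub> d, \<one>\<^bsub>free_group {1..n}\<^esub>) | w.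
      primitive (free_group {1..n}) w}" for u v
    using that assms(3) by (auto simp: \<phi>.hom_nat_pow primitive_closed simp del: One_nat_def)
  from hom_presented_group[OF assms(1) Burnside_relations_in_carrier assms(2) this]
  show ?thesis
    by (simp add: primitive_Burnside_group_def Burnside_coset_def Let_def)
qed

lemma generate_primitive_Burnside_group:
  "generate (primitive_Burnside_group n d) (Burnside_coset n d ` free_gen ` {1..n}) =
    carrier (primitive_Burnside_group n d)"
  using generate_presented_group[OF Burnside_relations_in_carrier, of "{1..n}" d]
  by (simp add: primitive_Burnside_group_def Burnside_coset_def Let_def presented_gen_def[abs_def]
      image_image)

lemma generate_free_basis:
  assumes "group G" "free_basis G B"
  shows "generate G B = carrier G"
proof -
  have B: "B \<subseteq> carrier G" and iso: "free_lift G (\<lambda>x. x) \<in> iso (free_group B) G"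
    using assms by (auto simp: free_basis_def)
  interpret l: group_hom "free_group B" G "free_lift G (\<lambda>x. x)"
    using iso assms(1) by (intro group_hom.intro group_hom_axioms.intro group_free_group)
      (auto simp: iso_def)
  have "free_lift G (\<lambda>x. x) (free_gen b) = b" if "b \<in> B" for b
    using that B by (intro free_lift_gen assms(1)) auto
  then have "free_lift G (\<lambda>x. x) ` free_gen ` B = B" by (force simp: image_image)
  moreover have "free_gen ` B \<subseteq> carrier (free_group B)" by (auto intro: free_gen_in_carrier)
  moreover have "free_lift G (\<lambda>x. x) ` carrier (free_group B) = carrier G"
    using iso by (simp add: iso_def bij_betw_def)
  ultimately show ?thesis
    using l.generate_img[of "free_gen ` B"] generate_free_group[of B] by simp
qed

subsection \<open>The rank of a free group\<close>

text \<open>The number of homomorphisms to the group of order two determines the rank.\<close>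

definition xor_group :: "bool monoid" where
  "xor_group = \<lparr>carrier = UNIV, monoid.mult = (\<noteq>), one = False\<rparr>"

lemma group_xor_group: "group xor_group"
  by (rule groupI) (auto simp: xor_group_def)

text \<open>A homomorphism to the group of order two is given by the set of generators on which it
  is nontrivial. Reading the same homomorphism off on \<open>S\<close> and on \<open>B\<close>
  matches the subsets of the two.\<close>

lemma bij_betw_Pow_free_basis:
  assumes "free_basis (free_group S) B"
  shows "bij_betw (\<lambda>T. {b \<in> B. free_lift xor_group (\<lambda>x. x \<in> T) b}) (Pow S) (Pow B)"
proof -
  let ?F = "free_group S" and ?FB = "free_group B"
  let ?\<chi> = "\<lambda>T. free_lift xor_group (\<lambda>x. x \<in> T)"
  have B: "B \<subseteq> carrier ?F" and iso: "free_lift ?F (\<lambda>x. x) \<in> iso ?FB ?F"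
    using assms by (auto simp: free_basis_def)
  have \<chi>: "?\<chi> T \<in> hom (free_group A) xor_group" for T :: "'c set" and A
    by (rule free_lift_hom[OF group_xor_group]) (simp add: xor_group_def)
  have \<chi>_gen: "?\<chi> T (free_gen x) \<longleftrightarrow> x \<in> T" for T and x :: 'c
    by (rule free_lift_gen[OF group_xor_group]) (simp add: xor_group_def)
  have lift_gen: "free_lift ?F (\<lambda>x. x) (free_gen b) = b" if "b \<in> B" for b
    using that B by (intro free_lift_gen group_free_group) auto
  interpret FB: group ?FB by (rule group_free_group)
  have genB: "generate ?F B = carrier ?F"
    by (rule generate_free_basis[OF group_free_group assms])
  show ?thesis
    unfolding bij_betw_def
  proof
    show "inj_on (\<lambda>T. {b \<in> B. ?\<chi> T b}) (Pow S)"
    proof (rule inj_onI)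
      fix T T' assume T: "T \<in> Pow S" "T' \<in> Pow S" "{b \<in> B. ?\<chi> T b} = {b \<in> B. ?\<chi> T' b}"
      have eq: "?\<chi> T w = ?\<chi> T' w" if "w \<in> carrier ?F" for w
        by (rule hom_eqI[OF group_free_group group_xor_group \<chi> \<chi> B genB]) (use T that in auto)
      have "x \<in> T \<longleftrightarrow> x \<in> T'" if "x \<in> S" for x
        using eq[OF free_gen_in_carrier[OF that]] by (simp add: \<chi>_gen)
      then show "T = T'" using T by blast
    qed
    show "(\<lambda>T. {b \<in> B. ?\<chi> T b}) ` Pow S = Pow B"
    proof (intro subset_antisym subsetI)
      fix C assume "C \<in> Pow B"
      \<comment> \<open>\<open>g\<close> writes an element as a word in the basis, so that
        \<open>\<xi>\<close> below is the homomorphism with prescribed support \<open>C\<close> on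
        \<open>B\<close>; its support on \<open>S\<close> is the required preimage.\<close>
      define g where "g = inv_into (carrier ?FB) (free_lift ?F (\<lambda>x. x))"
      have g: "g \<in> hom ?F ?FB" using FB.iso_set_sym[OF iso] by (simp add: iso_def g_def)
      have "inj_on (free_lift ?F (\<lambda>x. x)) (carrier ?FB)"
        using iso by (simp add: iso_def bij_betw_def)
      then have g_lift: "g (free_lift ?F (\<lambda>x. x) w) = w" if "w \<in> carrier ?FB" for w
        using that by (simp add: g_def inv_into_f_f)
      define \<xi> where "\<xi> = ?\<chi> C \<circ> g"
      have \<xi>: "\<xi> \<in> hom ?F xor_group"
        unfolding \<xi>_def by (rule Group.hom_compose[OF g \<chi>])
      have \<xi>B: "\<xi> b \<longleftrightarrow> b \<in> C" if "b \<in> B" for b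
        using g_lift[OF free_gen_in_carrier[OF that]] lift_gen[OF that] \<chi>_gen by (simp add: \<xi>_def)
      let ?T = "{x \<in> S. \<xi> (free_gen x)}"
      have "?\<chi> ?T w = \<xi> w" if "w \<in> carrier ?F" for w
        by (rule hom_eqI[OF group_free_group group_xor_group \<chi> \<xi> _ generate_free_group])
          (use that \<chi>_gen[of ?T] in \<open>auto intro: free_gen_in_carrier\<close>)
      then have "{b \<in> B. ?\<chi> ?T b} = C" using \<xi>B B \<open>C \<in> Pow B\<close> by blast
      then show "C \<in> (\<lambda>T. {b \<in> B. ?\<chi> T b}) ` Pow S" by blast
    qed auto
  qed
qed

lemma card_free_basis:
  assumes "free_basis (free_group S) B" "finite S"
  shows "finite B" "card B = card S"
proof -
  show "finite B"
    using bij_betw_finite[OF bij_betw_Pow_free_basis[OF assms(1)]] assms(2) by simp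
  then show "card B = card S"
    using bij_betw_same_card[OF bij_betw_Pow_free_basis[OF assms(1)]] assms(2) by (simp add: card_Pow)
qed

text \<open>All that the reduction keeps of a basis: it has two elements and generates.\<close>

lemma primitive_complement:
  assumes "primitive (free_group S) w" "card S = 2"
  obtains v where "v \<in> carrier (free_group S)" "generate (free_group S) {w, v} = carrier (free_group S)"
proof -
  obtain B where B: "free_basis (free_group S) B" "w \<in> B"
    using assms(1) by (auto simp: primitive_def)
  have "finite S" using assms(2) by (intro card_ge_0_finite) simp
  then have "card B = 2" using card_free_basis[OF B(1)] assms(2) by simp
  then obtain x y where "B = {x, y}" by (auto simp: card_2_iff)
  then obtain v where v: "B = {w, v}" using B(2) by (cases "w = x") (auto intro: insert_commute)
  then show ?thesis
    using that[of v] generate_free_basis[OF group_free_group B(1)] B(1)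
    by (auto simp: free_basis_def)
qed

section \<open>Lengths of products in a free group\<close>

definition formal_inverse :: "'a word \<Rightarrow> 'a word" where
  "formal_inverse w = rev (map (\<lambda>p. (fst p, \<not> snd p)) w)"

lemma formal_inverse_simps [simp]:
  "formal_inverse [] = []"
  "formal_inverse (u @ v) = formal_inverse v @ formal_inverse u"
  "formal_inverse (p # v) = formal_inverse v @ [(fst p, \<not> snd p)]"
  "formal_inverse (formal_inverse w) = w"
  "length (formal_inverse w) = length w"
  by (simp_all add: formal_inverse_def rev_map o_def)

lemma inv_free_group:
  assumes "w \<in> carrier (free_group S)"
  shows "inv\<^bsub>free_group S\<^esub> w = formal_inverse w"
  using assms
  by (intro group.inv_equality[OF group_free_group])
    (auto simp: formal_inverse_def mult_free_group one_free_group carrier_free_group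
      foldr_push_inverse reduced_inverse image_image)

lemma length_inv_free_group:
  "w \<in> carrier (free_group S) \<Longrightarrow> length (inv\<^bsub>free_group S\<^esub> w) = length w"
  by (simp add: inv_free_group)

lemma foldr_push_append: "reduced (u @ v) \<Longrightarrow> foldr push u v = u @ v"
proof (induction u)
  case (Cons p u)
  then have "reduced (u @ v)" by (auto simp: reduced_def successively_Cons)
  then show ?case
    using Cons by (cases "u @ v") (auto simp: reduced_def)
qed simp

lemma foldr_push_formal_inverse: "foldr push z (formal_inverse z @ b) = b"
  by (induction z rule: rev_induct) (auto simp: cancelling_def)

text \<open>\<open>z\<close> collects the letters stripped at the junction for as long as they
  cancel. Since \<open>a @ b\<close> is reduced, \<open>z\<close> is the whole cancellation.\<close>

lemma reduced_append_cancel: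
  assumes "reduced u" "reduced v"
  obtains a z b where "u = a @ z" "v = formal_inverse z @ b" "reduced (a @ b)"
  using assms
proof (induction u arbitrary: v thesis rule: rev_induct)
  case Nil
  from Nil(1)[of "[]" "[]" v] Nil(3) show ?case by simp
next
  case (snoc p u)
  show ?case
  proof (cases "reduced ((u @ [p]) @ v)")
    case True
    then show ?thesis using snoc.prems(1)[of "u @ [p]" "[]" v] by simp
  next
    case False
    then obtain q v' where v: "v = q # v'" "cancelling p q"
      using snoc.prems(2,3) by (cases v) (auto simp: reduced_def successively_append_iff)
    then have q: "q = (fst p, \<not> snd p)" by (auto simp: cancelling_def prod_eq_iff)
    have "reduced u" "reduced v'"
      using snoc.prems(2,3) v by (auto simp: reduced_def successively_append_iff successively_Cons)
    from snoc.IH[OF _ this] obtain a z b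
      where "u = a @ z" "v' = formal_inverse z @ b" "reduced (a @ b)" by blast
    then show ?thesis using snoc.prems(1)[of a "z @ [p]" b] v q by simp
  qed
qed

text \<open>The number of letters of \<open>u\<close> that cancel when the product of \<open>u\<close> and \<open>v\<close> is reduced.\<close>

definition overlap :: "'a word \<Rightarrow> 'a word \<Rightarrow> nat" where
  "overlap u v = (length u + length v - length (foldr push u v)) div 2"

lemma overlap_split:
  assumes "reduced (a @ b)"
  shows "foldr push (a @ z) (formal_inverse z @ b) = a @ b"
    and "overlap (a @ z) (formal_inverse z @ b) = length z"
proof -
  show 1: "foldr push (a @ z) (formal_inverse z @ b) = a @ b"
    using assms by (simp add: foldr_push_formal_inverse foldr_push_append)
  show "overlap (a @ z) (formal_inverse z @ b) = length z"
    unfolding overlap_def 1 by simp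
qed

lemma overlapE:
  assumes "u \<in> carrier (free_group S)" "v \<in> carrier (free_group S)"
  obtains a z b where "u = a @ z" "v = formal_inverse z @ b" "reduced (a @ b)"
    "length z = overlap u v" "u \<otimes>\<^bsub>free_group S\<^esub> v = a @ b"
proof -
  have "reduced u" "reduced v" using assms by (simp_all add: carrier_free_group)
  then obtain a z b where 1: "u = a @ z" "v = formal_inverse z @ b" "reduced (a @ b)"
    by (rule reduced_append_cancel)
  then show ?thesis
    using that[OF 1] overlap_split[OF 1(3), of z] by (simp add: mult_free_group)
qed

lemma length_mult_free_group:
  assumes "u \<in> carrier (free_group S)" "v \<in> carrier (free_group S)"
  shows "length (u \<otimes>\<^bsub>free_group S\<^esub> v) + 2 * overlap u v = length u + length v"
proof -
  obtain a z b where "u = a @ z" "v = formal_inverse z @ b" "length z = overlap u v"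
    "u \<otimes>\<^bsub>free_group S\<^esub> v = a @ b"
    using overlapE[OF assms] .
  then show ?thesis by simp
qed

text \<open>If the cancellations on the two sides of \<open>g\<close> leave a letter of
  \<open>g\<close> standing, they do not interact: \<open>p\<close> meets the same letters in the
  product as in \<open>g\<close>.\<close>

lemma overlap_mult_right:
  assumes "p \<in> carrier (free_group S)" "g \<in> carrier (free_group S)" "h \<in> carrier (free_group S)"
    and less: "overlap p g + overlap g h < length g"
  shows "overlap p (g \<otimes>\<^bsub>free_group S\<^esub> h) = overlap p g"
proof -
  obtain c y h' where 1: "g = c @ y" "h = formal_inverse y @ h'" "reduced (c @ h')"
      "length y = overlap g h" "g \<otimes>\<^bsub>free_group S\<^esub> h = c @ h'"
    using overlapE[OF assms(2,3)] .
  obtain p' z g' where 2: "p = p' @ z" "g = formal_inverse z @ g'" "reduced (p' @ g')"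
      "length z = overlap p g"
    using overlapE[OF assms(1,2)] .
  have len: "length z < length c"
    using less 1(1,4) 2(4) by simp
  \<comment> \<open>The middle of \<open>g\<close> that neither neighbour touches. Being nonempty,
    it separates the junction with \<open>p'\<close> from the junction with \<open>h'\<close>, and
    both are already known to be reduced.\<close>
  define m where "m = drop (length z) c"
  have "take (length z) g = take (length z) c" using len 1(1) by simp
  moreover have "take (length z) g = formal_inverse z" using 2(2) by simp
  ultimately have c: "c = formal_inverse z @ m"
    using append_take_drop_id[of "length z" c] by (simp add: m_def)
  have m: "m \<noteq> []" using len by (simp add: m_def)
  have "g' = m @ y" using 1(1) 2(2) c by simp
  then have "reduced (p' @ m @ h')"
    using 1(3) 2(3) c m by (auto simp: reduced_def successively_append_iff)
  then show ?thesis
    using overlap_split(2)[of p' "m @ h'" z] 1(5) 2(1,4) c by simp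
qed

section \<open>Self-cancellation and the length bound for locally controlled words\<close>

lemma overlap_Nil: "overlap [] w = 0" "reduced w \<Longrightarrow> overlap w [] = 0"
  by (simp_all add: overlap_def foldr_push_Nil)

text \<open>\<open>reduced (m @ m)\<close> says that \<open>m\<close> is cyclically reduced. Peel
  off the first and last letters as long as they are inverse to each other.\<close>

lemma cyclic_decomposition:
  assumes "reduced w" "w \<noteq> []"
  obtains c m where "w = c @ m @ formal_inverse c" "m \<noteq> []" "reduced (m @ m)"
  using assms
proof (induction "length w" arbitrary: w thesis rule: less_induct)
  case less
  show ?case
  proof (cases "reduced (w @ w)")
    case True
    then show ?thesis using less.prems(1)[of "[]" w] less.prems(3) by simp
  next
    case False
    then have can: "cancelling (last w) (hd w)"
      using less.prems(2,3) by (auto simp: reduced_def successively_append_iff)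
    \<comment> \<open>A letter is not its own inverse, so the first and the last letter sit at
      different positions.\<close>
    then have "length w \<noteq> 1" by (cases w) (auto simp: cancelling_def)
    then obtain p v' where "w = p # v'" "v' \<noteq> []"
      using less.prems(3) by (cases w) auto
    then obtain v r where w: "w = p # v @ [r]" by (cases v' rule: rev_cases) auto
    have r: "r = (fst p, \<not> snd p)" using can w by (auto simp: cancelling_def prod_eq_iff)
    have "reduced v" "v \<noteq> []"
      using less.prems(2) w r
      by (auto simp: reduced_def successively_append_iff successively_Cons cancelling_def)
    then obtain c m where "v = c @ m @ formal_inverse c" "m \<noteq> []" "reduced (m @ m)"
      using less.hyps[of v] w by auto
    then show ?thesis using less.prems(1)[of "p # c" m] w r by simp
  qed
qed

text \<open>In the square of \<open>c m c^-1\<close> with \<open>m\<close> cyclically reduced only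
  the inner \<open>c^-1 c\<close> cancels, and \<open>m\<close> is nonempty.\<close>

lemma overlap_self:
  assumes "w \<in> carrier (free_group S)" "w \<noteq> []"
  shows "2 * overlap w w < length w"
proof -
  have red: "reduced w" using assms(1) by (simp add: carrier_free_group)
  obtain c m where w: "w = c @ m @ formal_inverse c" and m: "m \<noteq> []" "reduced (m @ m)"
    using cyclic_decomposition[OF red assms(2)] .
  have "reduced ((c @ m) @ (m @ formal_inverse c))"
    using red w m by (auto simp: reduced_def successively_append_iff)
  from overlap_split(2)[OF this, of "formal_inverse c"] have "overlap w w = length c"
    using w by simp
  then show ?thesis using w m(1) by simp
qed

text \<open>The Nielsen property: every inner factor keeps at least one letter after cancelling with
  both neighbours. It is tested on triples of consecutive letters and bounds the length of every
  reduced product.\<close>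

lemma length_free_lift:
  assumes f: "f \<in> I \<rightarrow> carrier (free_group S)"
    and local: "\<And>p q r. fst p \<in> I \<Longrightarrow> fst q \<in> I \<Longrightarrow> fst r \<in> I \<Longrightarrow> \<not> cancelling p q \<Longrightarrow>
      \<not> cancelling q r \<Longrightarrow>
      overlap (free_lift (free_group S) f [p]) (free_lift (free_group S) f [q]) +
      overlap (free_lift (free_group S) f [q]) (free_lift (free_group S) f [r]) <
      length (free_lift (free_group S) f [q])"
    and w: "w \<in> carrier (free_group I)"
  shows "length w \<le> length (free_lift (free_group S) f w)"
proof -
  let ?F = "free_group S"
  let ?E = "free_lift ?F f"
  interpret group ?F by (rule group_free_group)
  have E: "?E w \<in> carrier ?F" if "fst ` set w \<subseteq> I" for w
    using that f by (intro free_lift_closed group_free_group) auto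
  have E_Cons: "?E (p # w) = ?E [p] \<otimes>\<^bsub>?F\<^esub> ?E w" if "fst ` set (p # w) \<subseteq> I" for p w
    using E[of "[p]"] that f by (auto simp: Pi_iff)
  \<comment> \<open>The overlap with a longer product sees its first factor only, by induction from
    the right.\<close>
  have overlap_Cons: "overlap (?E [p]) (?E (q # w)) = overlap (?E [p]) (?E [q])"
    if "reduced (p # q # w)" "fst ` set (p # q # w) \<subseteq> I" for p q w
    using that
  proof (induction w arbitrary: p q)
    case (Cons r w)
    then have "overlap (?E [q]) (?E (r # w)) = overlap (?E [q]) (?E [r])"
      by (auto simp: reduced_def)
    moreover have "overlap (?E [p]) (?E [q]) + overlap (?E [q]) (?E [r]) < length (?E [q])"
      using Cons.prems by (intro local) (auto simp: reduced_def)
    ultimately show ?case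
      using Cons.prems E_Cons[of q "r # w"]
      by (subst E_Cons, force, intro overlap_mult_right E) auto
  qed simp
  have overlap_less: "overlap (?E [p]) (?E [q]) + overlap (?E [q]) (?E w) < length (?E [q])"
    if "reduced (p # q # w)" "fst ` set (p # q # w) \<subseteq> I" for p q w
  proof (cases w)
    case Nil
    \<comment> \<open>With nothing after \<open>q\<close>, the triple \<open>p q q\<close> already
      shows that \<open>p\<close> does not swallow \<open>q\<close>.\<close>
    then show ?thesis
      using that local[of p q q] E[of "[q]"]
      by (auto simp: reduced_def one_free_group overlap_Nil carrier_free_group cancelling_def)
  next
    case (Cons r v)
    then show ?thesis
      using that local[of p q r] overlap_Cons[of q r v] by (auto simp: reduced_def)
  qed
  \<comment> \<open>The plain bound does not pass through the induction, because prepending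
    \<open>p\<close> costs the overlap twice. Adding the overlap on the right charges to the tail
    only the letters that it loses itself.\<close>
  have *: "length (?E [p]) + length w \<le> length (?E (p # w)) + overlap (?E [p]) (?E w)"
    if "reduced (p # w)" "fst ` set (p # w) \<subseteq> I" for p w
    using that
  proof (induction w arbitrary: p)
    case (Cons q w)
    have "length (?E [q]) + length w \<le> length (?E (q # w)) + overlap (?E [q]) (?E w)"
      using Cons by (auto simp: reduced_def)
    moreover have "overlap (?E [p]) (?E (q # w)) = overlap (?E [p]) (?E [q])"
      using Cons.prems by (rule overlap_Cons)
    moreover have "overlap (?E [p]) (?E [q]) + overlap (?E [q]) (?E w) < length (?E [q])"
      using Cons.prems by (rule overlap_less)
    moreover have "length (?E (p # q # w)) + 2 * overlap (?E [p]) (?E (q # w)) =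
        length (?E [p]) + length (?E (q # w))"
      using Cons.prems by (subst E_Cons, force, intro length_mult_free_group E) auto
    ultimately show ?case by simp
  qed simp
  show ?thesis
  proof (cases w)
    case (Cons p v)
    then have w': "reduced (p # v)" "fst ` set (p # v) \<subseteq> I"
      using w by (auto simp: carrier_free_group)
    \<comment> \<open>Doubling the first letter keeps the word reduced, and
      \<open>overlap_less\<close> then says that the tail does not swallow \<open>?E [p]\<close>,
      which provides the missing unit.\<close>
    then have "reduced (p # p # v)" "fst ` set (p # p # v) \<subseteq> I"
      by (auto simp: reduced_def cancelling_def)
    from overlap_less[OF this] *[OF w'] Cons show ?thesis by simp
  qed simp
qed

section \<open>Nielsen reduction in rank two\<close>

text \<open>The tie between \<open>p q\<close> and \<open>q p\<close>. With \<open>q = s y\<close>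
  split into halves, the cancellations force \<open>p = y^-1 m s^-1\<close>, so
  \<open>q p = s m s^-1\<close>. Conjugating by \<open>s^-1\<close> turns \<open>q\<close> into
  \<open>y s\<close> and \<open>q p\<close> into \<open>m\<close>, and the total length drops to at
  most that of \<open>p\<close>.\<close>

lemma half_overlap_conj:
  assumes "p \<in> carrier (free_group S)" "q \<in> carrier (free_group S)"
    and half: "2 * overlap p q = length q" "2 * overlap q p = length q" "length q \<le> length p"
  obtains s where "s \<in> carrier (free_group S)"
    "length (inv\<^bsub>free_group S\<^esub> s \<otimes>\<^bsub>free_group S\<^esub> q \<otimes>\<^bsub>free_group S\<^esub> s) \<le> length q"
    "length (inv\<^bsub>free_group S\<^esub> s \<otimes>\<^bsub>free_group S\<^esub> (q \<otimes>\<^bsub>free_group S\<^esub> p) \<otimes>\<^bsub>free_group S\<^esub> s)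
      + length q \<le> length p"
proof -
  let ?F = "free_group S"
  interpret group ?F by (rule group_free_group)
  obtain p' z t where 1: "p = p' @ z" "q = formal_inverse z @ t" "length z = overlap p q"
    using overlapE[OF assms(1,2)] .
  obtain s y p'' where 2: "q = s @ y" "p = formal_inverse y @ p''" "length y = overlap q p"
    using overlapE[OF assms(2,1)] .
  have len: "length z = length y" "length z + length y = length q"
    using half 1(3) 2(3) by simp_all
  have st: "s = formal_inverse z" "t = y"
    using 1(2) 2(1) len by (auto simp: append_eq_append_conv)
  \<comment> \<open>The prefix \<open>y^-1\<close> and the suffix \<open>z\<close> of
    \<open>p\<close> are disjoint because together they are as long as \<open>q\<close>, hence no
    longer than \<open>p\<close>.\<close>
  have "length (formal_inverse y) \<le> length p'"
    using arg_cong[OF 1(1), of length] len half(3) by simp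
  moreover have "take (length (formal_inverse y)) p = formal_inverse y"
    using 2(2) by simp
  ultimately have "take (length (formal_inverse y)) p' = formal_inverse y"
    using 1(1) by simp
  then obtain m where m: "p' = formal_inverse y @ m"
    using append_take_drop_id by metis
  have p: "p = formal_inverse y @ m @ formal_inverse s"
    using 1(1) m st by simp
  have car: "s \<in> carrier ?F" "y \<in> carrier ?F" "m \<in> carrier ?F"
    "m @ formal_inverse s \<in> carrier ?F"
    using assms(1,2) 2(1) p by (auto simp: carrier_free_group reduced_def successively_append_iff)
  have q: "q = s \<otimes>\<^bsub>?F\<^esub> y"
    using assms(2) 2(1) by (simp add: mult_free_group carrier_free_group foldr_push_append)
  have "p = inv\<^bsub>?F\<^esub> y \<otimes>\<^bsub>?F\<^esub> (m \<otimes>\<^bsub>?F\<^esub> inv\<^bsub>?F\<^esub> s)"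
    using assms(1) p car
    by (simp add: inv_free_group mult_free_group carrier_free_group foldr_push_append)
  then have "inv\<^bsub>?F\<^esub> s \<otimes>\<^bsub>?F\<^esub> (q \<otimes>\<^bsub>?F\<^esub> p) \<otimes>\<^bsub>?F\<^esub> s = m"
    using car by (simp add: q m_assoc cancel_left)
  moreover have "inv\<^bsub>?F\<^esub> s \<otimes>\<^bsub>?F\<^esub> q \<otimes>\<^bsub>?F\<^esub> s = y \<otimes>\<^bsub>?F\<^esub> s"
    using car by (simp add: q m_assoc cancel_left)
  moreover have "length (y \<otimes>\<^bsub>?F\<^esub> s) \<le> length q"
    using length_mult_free_group[OF car(2,1)] 2(1) by simp
  ultimately show ?thesis
    using that[OF car(1)] p len st by simp
qed

text \<open>The tie between \<open>p q\<close> and \<open>q p^-1\<close>. Both halves of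
  \<open>q\<close> are now dictated by the same end of \<open>p\<close>, so
  \<open>q = z^-1 z\<close>, which is reduced only if it is empty.\<close>

lemma half_overlap_inv:
  assumes "p \<in> carrier (free_group S)" "q \<in> carrier (free_group S)"
    and half: "2 * overlap p q = length q" "2 * overlap q (inv\<^bsub>free_group S\<^esub> p) = length q"
  shows "q = []"
proof -
  let ?F = "free_group S"
  interpret group ?F by (rule group_free_group)
  obtain p' z t where 1: "p = p' @ z" "q = formal_inverse z @ t" "length z = overlap p q"
    using overlapE[OF assms(1,2)] .
  obtain s y p'' where 2: "q = s @ y" "inv\<^bsub>?F\<^esub> p = formal_inverse y @ p''"
      "length y = overlap q (inv\<^bsub>?F\<^esub> p)"
    using overlapE[OF assms(2) inv_closed[OF assms(1)]] .
  have len: "length z = length y" "length z + length y = length q"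
    using half 1(3) 2(3) by simp_all
  have "formal_inverse z @ formal_inverse p' = formal_inverse y @ p''"
    using 1(1) 2(2) inv_free_group[OF assms(1)] by simp
  then have "formal_inverse z = formal_inverse y" using len by simp
  then have "z = y" by (metis formal_inverse_simps(4))
  moreover have "s = formal_inverse z" "t = y"
    using 1(2) 2(1) len by (auto simp: append_eq_append_conv)
  ultimately have q: "q = formal_inverse y @ y" using 2(1) by simp
  have "foldr push (formal_inverse y) y = q"
    using assms(2) q by (simp add: carrier_free_group foldr_push_append)
  moreover have "foldr push (formal_inverse y) y = []"
    using foldr_push_formal_inverse[of "formal_inverse y" "[]"] by simp
  ultimately show ?thesis by simp
qed

section \<open>Generating pairs\<close>

lemma (in group) subgroup_centralizer:
  assumes "B \<subseteq> carrier G"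
  shows "subgroup {a \<in> carrier G. \<forall>b \<in> B. a \<otimes> b = b \<otimes> a} G"
proof (rule subgroup.intro)
  fix a assume "a \<in> {a \<in> carrier G. \<forall>b \<in> B. a \<otimes> b = b \<otimes> a}"
  then have a: "a \<in> carrier G" "\<And>b. b \<in> B \<Longrightarrow> a \<otimes> b = b \<otimes> a" by auto
  have "inv a \<otimes> b = b \<otimes> inv a" if "b \<in> B" for b
  proof -
    have b: "b \<in> carrier G" using that assms by auto
    have "inv a \<otimes> b = inv a \<otimes> (b \<otimes> a) \<otimes> inv a" using a(1) b by (simp add: m_assoc)
    also have "\<dots> = inv a \<otimes> (a \<otimes> b) \<otimes> inv a" using a(2)[OF that] by simp
    also have "\<dots> = b \<otimes> inv a" using a(1) b by (simp add: m_assoc cancel_left)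
    finally show ?thesis .
  qed
  then show "inv a \<in> {a \<in> carrier G. \<forall>b \<in> B. a \<otimes> b = b \<otimes> a}" using a(1) by simp
next
  fix a a' assume a: "a \<in> {a \<in> carrier G. \<forall>b \<in> B. a \<otimes> b = b \<otimes> a}"
    "a' \<in> {a \<in> carrier G. \<forall>b \<in> B. a \<otimes> b = b \<otimes> a}"
  have "(a \<otimes> a') \<otimes> b = b \<otimes> (a \<otimes> a')" if "b \<in> B" for b
  proof -
    have c: "b \<in> carrier G" "a \<in> carrier G" "a' \<in> carrier G" using a that assms by auto
    have "(a \<otimes> a') \<otimes> b = a \<otimes> (b \<otimes> a')" using a that c by (simp add: m_assoc)
    also have "\<dots> = (b \<otimes> a) \<otimes> a'" using a that c by (simp flip: m_assoc)
    finally show ?thesis using c by (simp add: m_assoc)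
  qed
  then show "a \<otimes> a' \<in> {a \<in> carrier G. \<forall>b \<in> B. a \<otimes> b = b \<otimes> a}" using a by simp
qed (use assms in auto)

text \<open>If \<open>u\<close> were trivial, a single element would generate. Then everything
  commutes with \<open>v\<close>, so \<open>v\<close> is central, so the group is abelian; but two
  distinct generators do not commute.\<close>

lemma generating_pair_nontrivial:
  assumes "u \<in> carrier (free_group S)" "v \<in> carrier (free_group S)" "x \<in> S" "y \<in> S" "x \<noteq> y"
    and gen: "generate (free_group S) {u, v} = carrier (free_group S)"
  shows "u \<noteq> []"
proof
  let ?F = "free_group S"
  interpret group ?F by (rule group_free_group)
  assume "u = []"
  then have u: "u = \<one>\<^bsub>?F\<^esub>" by (simp add: one_free_group)
  note sub = subgroup_centralizer
  have "{a \<in> carrier ?F. \<forall>b \<in> {v}. a \<otimes>\<^bsub>?F\<^esub> b = b \<otimes>\<^bsub>?F\<^esub> a} = carrier ?F"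
    by (rule generate_pair_eqI[OF gen sub]) (use assms u in auto)
  then have central: "\<forall>a \<in> carrier ?F. a \<otimes>\<^bsub>?F\<^esub> v = v \<otimes>\<^bsub>?F\<^esub> a" by blast
  have v_central: "v \<otimes>\<^bsub>?F\<^esub> a = a \<otimes>\<^bsub>?F\<^esub> v" if "a \<in> carrier ?F" for a
    by (rule sym[OF bspec[OF central that]])
  have "{a \<in> carrier ?F. \<forall>b \<in> carrier ?F. a \<otimes>\<^bsub>?F\<^esub> b = b \<otimes>\<^bsub>?F\<^esub> a} = carrier ?F"
  proof (rule generate_pair_eqI[OF gen sub])
    show "v \<in> {a \<in> carrier ?F. \<forall>b \<in> carrier ?F. a \<otimes>\<^bsub>?F\<^esub> b = b \<otimes>\<^bsub>?F\<^esub> a}"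
      using v_central assms(2) by blast
  qed (use u in auto)
  then have "free_gen x \<otimes>\<^bsub>?F\<^esub> free_gen y = free_gen y \<otimes>\<^bsub>?F\<^esub> free_gen x"
    using free_gen_in_carrier[OF assms(3)] free_gen_in_carrier[OF assms(4)] by fast
  then show False
    using assms(5) by (auto simp: mult_free_group free_gen_def cancelling_def)
qed

lemma (in group) generate_pair_mult:
  assumes "p \<in> carrier G" "q \<in> carrier G" "generate G {p, q} = carrier G"
  shows "generate G {p, p \<otimes> q} = carrier G"
proof (rule generate_pair_eqI[OF assms(3)])
  have sub: "{p, p \<otimes> q} \<subseteq> carrier G" using assms by simp
  then show "subgroup (generate G {p, p \<otimes> q}) G" by (rule generate_is_subgroup)
  show "p \<in> generate G {p, p \<otimes> q}" by (simp add: generate.incl)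
  have "inv p \<otimes> (p \<otimes> q) \<in> generate G {p, p \<otimes> q}"
    by (intro generate.eng generate.inv generate.incl) auto
  then show "q \<in> generate G {p, p \<otimes> q}" using assms by (simp add: cancel_left)
qed

lemma (in group) generate_pair_inv:
  assumes "p \<in> carrier G" "q \<in> carrier G" "generate G {p, q} = carrier G"
  shows "generate G {inv p, q} = carrier G"
proof (rule generate_pair_eqI[OF assms(3)])
  have sub: "{inv p, q} \<subseteq> carrier G" using assms by simp
  then show "subgroup (generate G {inv p, q}) G" by (rule generate_is_subgroup)
  have "inv (inv p) \<in> generate G {inv p, q}" by (intro generate.inv) auto
  then show "p \<in> generate G {inv p, q}" using assms by simp
  show "q \<in> generate G {inv p, q}" by (intro generate.incl) auto
qed

lemma (in group) generate_pair_conj: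
  assumes "p \<in> carrier G" "q \<in> carrier G" "g \<in> carrier G" "generate G {p, q} = carrier G"
  shows "generate G {g \<otimes> p \<otimes> inv g, g \<otimes> q \<otimes> inv g} = carrier G"
proof -
  interpret c: group_hom G G "\<lambda>x. g \<otimes> x \<otimes> inv g"
    by (intro group_hom.intro group_hom_axioms.intro group_axioms conjugate_hom[unfolded conjugate_def[abs_def]] assms)
  have "g \<otimes> (inv g \<otimes> x \<otimes> g) \<otimes> inv g = x" if "x \<in> carrier G" for x
    using that assms by (simp add: m_assoc cancel_left)
  moreover have "inv g \<otimes> x \<otimes> g \<in> carrier G" if "x \<in> carrier G" for x
    using that assms(3) by simp
  ultimately have "carrier G \<subseteq> (\<lambda>x. g \<otimes> x \<otimes> inv g) ` carrier G"
    by (metis (no_types, lifting) image_eqI subsetI)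
  then have "(\<lambda>x. g \<otimes> x \<otimes> inv g) ` carrier G = carrier G"
    using c.hom_closed by blast
  then show ?thesis
    using c.generate_img[of "{p, q}"] assms by simp
qed

text \<open>Induction on the total length. If no permitted move shortens the pair, evaluation of
  words at \<open>(u, v)\<close> does not decrease length; as it is onto, each standard generator,
  having length one, is the value of a single letter. So the pair is standard up to order and
  signs.\<close>

lemma Nielsen_induct:
  assumes S: "S = {x, y}" "x \<noteq> y"
    and uv: "u \<in> carrier (free_group S)" "v \<in> carrier (free_group S)"
    and gen: "generate (free_group S) {u, v} = carrier (free_group S)"
    and base: "T (free_gen x) (free_gen y)"
    and swap: "\<And>u v. u \<in> carrier (free_group S) \<Longrightarrow> v \<in> carrier (free_group S) \<Longrightarrow> T u v \<Longrightarrow> T v u"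
    and inv: "\<And>u v. u \<in> carrier (free_group S) \<Longrightarrow> v \<in> carrier (free_group S) \<Longrightarrow> T u v \<Longrightarrow>
      T (inv\<^bsub>free_group S\<^esub> u) v"
    and mult: "\<And>u v. u \<in> carrier (free_group S) \<Longrightarrow> v \<in> carrier (free_group S) \<Longrightarrow> T u v \<Longrightarrow>
      T u (u \<otimes>\<^bsub>free_group S\<^esub> v)"
    and conj: "\<And>g u v. g \<in> carrier (free_group S) \<Longrightarrow> u \<in> carrier (free_group S) \<Longrightarrow>
      v \<in> carrier (free_group S) \<Longrightarrow> T u v \<Longrightarrow>
      T (g \<otimes>\<^bsub>free_group S\<^esub> u \<otimes>\<^bsub>free_group S\<^esub> inv\<^bsub>free_group S\<^esub> g)
        (g \<otimes>\<^bsub>free_group S\<^esub> v \<otimes>\<^bsub>free_group S\<^esub> inv\<^bsub>free_group S\<^esub> g)"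
  shows "T u v"
  using uv gen
proof (induction "length u + length v" arbitrary: u v rule: less_induct)
  case less
  let ?F = "free_group S"
  interpret group ?F by (rule group_free_group)
  note uv = less.prems(1,2)
  \<comment> \<open>The pairs obtained from \<open>(u, v)\<close> by exchanging and inverting
    entries. Generation and the truth of \<open>T\<close> are the same for all of them, so every
    estimate below can be made for an arbitrary member.\<close>
  define Q where "Q = {u, inv\<^bsub>?F\<^esub> u} \<times> {v, inv\<^bsub>?F\<^esub> v} \<union> {v, inv\<^bsub>?F\<^esub> v} \<times> {u, inv\<^bsub>?F\<^esub> u}"
  have Q_closed: "p \<in> carrier ?F" "q \<in> carrier ?F" if "(p, q) \<in> Q" for p q
    using that uv by (auto simp: Q_def)
  have Q_swap: "(q, p) \<in> Q" if "(p, q) \<in> Q" for p q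
    using that by (auto simp: Q_def)
  have Q_inv: "(inv\<^bsub>?F\<^esub> p, q) \<in> Q" if "(p, q) \<in> Q" for p q
    using that uv by (auto simp: Q_def)
  have Q_length: "length p + length q = length u + length v" if "(p, q) \<in> Q" for p q
    using that uv by (auto simp: Q_def length_inv_free_group)
  have T_invD: "T p q" if "T (inv\<^bsub>?F\<^esub> p) q" "p \<in> carrier ?F" "q \<in> carrier ?F" for p q
    using inv[of "inv\<^bsub>?F\<^esub> p" q] that by simp
  have T_inv_cases: "T p z" if "T q z" "q \<in> {p, inv\<^bsub>?F\<^esub> p}" "p \<in> carrier ?F" "z \<in> carrier ?F" for p q z
    using that(1,2) T_invD[OF _ that(3,4)] by auto
  have T_uv: "T u v" if "T p q" "p \<in> {u, inv\<^bsub>?F\<^esub> u}" "q \<in> {v, inv\<^bsub>?F\<^esub> v}" for p q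
  proof -
    have q: "q \<in> carrier ?F" using that(3) uv by auto
    have "T u q" by (rule T_inv_cases[OF that(1,2) uv(1) q])
    then have "T q u" by (rule swap[OF uv(1) q])
    then have "T v u" by (rule T_inv_cases[OF _ that(3) uv(2,1)])
    then show ?thesis by (rule swap[OF uv(2,1)])
  qed
  have Q_T: "T u v" if "T p q" and pq: "(p, q) \<in> Q" for p q
  proof (cases "p \<in> {u, inv\<^bsub>?F\<^esub> u} \<and> q \<in> {v, inv\<^bsub>?F\<^esub> v}")
    case True
    then show ?thesis using T_uv[OF that(1)] by simp
  next
    case False
    then have "p \<in> {v, inv\<^bsub>?F\<^esub> v}" "q \<in> {u, inv\<^bsub>?F\<^esub> u}"
      using pq unfolding Q_def by blast+
    then show ?thesis using T_uv[OF swap[OF Q_closed[OF pq] that(1)]] by simp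
  qed
  have gen_inv: "generate ?F {q, z} = carrier ?F"
    if "generate ?F {p, z} = carrier ?F" "q \<in> {p, inv\<^bsub>?F\<^esub> p}" "p \<in> carrier ?F" "z \<in> carrier ?F" for p q z
    using that(1,2) generate_pair_inv[OF that(3,4,1)] by auto
  have gen_uv: "generate ?F {p, q} = carrier ?F"
    if p: "p \<in> {u, inv\<^bsub>?F\<^esub> u}" and q: "q \<in> {v, inv\<^bsub>?F\<^esub> v}" for p q
  proof -
    have "p \<in> carrier ?F" using p uv by auto
    moreover have "generate ?F {v, p} = carrier ?F"
      using gen_inv[OF less.prems(3) p uv] by (subst insert_commute)
    ultimately show ?thesis
      using gen_inv[OF _ q uv(2)] by (subst insert_commute)
  qed
  have Q_gen: "generate ?F {p, q} = carrier ?F" if pq: "(p, q) \<in> Q" for p q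
  proof (cases "p \<in> {u, inv\<^bsub>?F\<^esub> u} \<and> q \<in> {v, inv\<^bsub>?F\<^esub> v}")
    case True
    then show ?thesis using gen_uv by simp
  next
    case False
    then have "p \<in> {v, inv\<^bsub>?F\<^esub> v}" "q \<in> {u, inv\<^bsub>?F\<^esub> u}"
      using pq unfolding Q_def by blast+
    then show ?thesis using gen_uv by (subst insert_commute)
  qed
  \<comment> \<open>The converse of \<open>mult\<close>: multiply by \<open>p^-1\<close> from the
    left, after inverting the first entry.\<close>
  have T_multD: "T p q" if T: "T p (p \<otimes>\<^bsub>?F\<^esub> q)" and pq: "p \<in> carrier ?F" "q \<in> carrier ?F" for p q
  proof -
    have "T (inv\<^bsub>?F\<^esub> p) (inv\<^bsub>?F\<^esub> p \<otimes>\<^bsub>?F\<^esub> (p \<otimes>\<^bsub>?F\<^esub> q))"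
      by (rule mult[OF _ _ inv[OF _ _ T]]) (use pq in simp_all)
    then have "T (inv\<^bsub>?F\<^esub> p) q" using pq by (simp add: cancel_left)
    then show ?thesis by (rule T_invD[OF _ pq])
  qed
  show ?case
  proof (rule ccontr)
    assume not_T: "\<not> T u v"
    \<comment> \<open>Otherwise \<open>(p, p q)\<close> is a shorter generating pair;
      \<open>T\<close> holds for it by induction and travels back to \<open>(u, v)\<close>.\<close>
    have le_right: "length q \<le> length (p \<otimes>\<^bsub>?F\<^esub> q)" if pq: "(p, q) \<in> Q" for p q
    proof (rule ccontr)
      assume *: "\<not> length q \<le> length (p \<otimes>\<^bsub>?F\<^esub> q)"
      have "T p (p \<otimes>\<^bsub>?F\<^esub> q)"
        using * Q_length[OF pq] Q_closed[OF pq] Q_gen[OF pq]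
        by (intro less.hyps generate_pair_mult) auto
      then show False using Q_T[OF T_multD[OF _ Q_closed[OF pq]] pq] not_T by simp
    qed
    \<comment> \<open>The mirror image, obtained by passing to
      \<open>(p q)^-1 = q^-1 p^-1\<close>.\<close>
    have le_left: "length p \<le> length (p \<otimes>\<^bsub>?F\<^esub> q)" if pq: "(p, q) \<in> Q" for p q
    proof -
      have "length (inv\<^bsub>?F\<^esub> p) \<le> length (inv\<^bsub>?F\<^esub> q \<otimes>\<^bsub>?F\<^esub> inv\<^bsub>?F\<^esub> p)"
        by (rule le_right[OF Q_inv[OF Q_swap[OF Q_inv[OF pq]]]])
      also have "inv\<^bsub>?F\<^esub> q \<otimes>\<^bsub>?F\<^esub> inv\<^bsub>?F\<^esub> p = inv\<^bsub>?F\<^esub> (p \<otimes>\<^bsub>?F\<^esub> q)"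
        using Q_closed[OF pq] by (simp add: inv_mult_group)
      finally show ?thesis using Q_closed[OF pq] by (simp add: length_inv_free_group)
    qed
    have overlap_le: "2 * overlap p q \<le> length p" "2 * overlap p q \<le> length q" if "(p, q) \<in> Q" for p q
      using le_right[OF that] le_left[OF that] length_mult_free_group[OF Q_closed[OF that]] by auto
    have nontrivial: "q \<noteq> []" if "(p, q) \<in> Q" for p q
      using generating_pair_nontrivial[of q S p x y] Q_closed[OF that] Q_gen[OF Q_swap[OF that]] S
      by auto
    \<comment> \<open>Each overlap is at most half of \<open>q\<close>, so failure means that both
      are exactly half: the tie that conjugation resolves.\<close>
    have not_half: "overlap p q + overlap q p < length q" if pq: "(p, q) \<in> Q" for p q
    proof (rule ccontr)
      assume "\<not> overlap p q + overlap q p < length q"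
      then have half: "2 * overlap p q = length q" "2 * overlap q p = length q"
        using overlap_le(2)[OF pq] overlap_le(1)[OF Q_swap[OF pq]] by linarith+
      then have "length q \<le> length p" using overlap_le(1)[OF pq] by linarith
      from half_overlap_conj[OF Q_closed[OF pq] half this]
      obtain s where s: "s \<in> carrier ?F"
        "length (inv\<^bsub>?F\<^esub> s \<otimes>\<^bsub>?F\<^esub> q \<otimes>\<^bsub>?F\<^esub> s) \<le> length q"
        "length (inv\<^bsub>?F\<^esub> s \<otimes>\<^bsub>?F\<^esub> (q \<otimes>\<^bsub>?F\<^esub> p) \<otimes>\<^bsub>?F\<^esub> s) + length q \<le> length p" .
      let ?c = "\<lambda>g. inv\<^bsub>?F\<^esub> s \<otimes>\<^bsub>?F\<^esub> g \<otimes>\<^bsub>?F\<^esub> s"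
      have qp: "q \<in> carrier ?F" "q \<otimes>\<^bsub>?F\<^esub> p \<in> carrier ?F" "p \<in> carrier ?F"
        using Q_closed[OF pq] by auto
      have "generate ?F {q, q \<otimes>\<^bsub>?F\<^esub> p} = carrier ?F"
        using qp Q_gen[OF Q_swap[OF pq]] by (intro generate_pair_mult)
      from generate_pair_conj[OF qp(1,2) inv_closed[OF s(1)] this]
      have "generate ?F {?c q, ?c (q \<otimes>\<^bsub>?F\<^esub> p)} = carrier ?F" using s(1) by simp
      moreover have "0 < length q" using nontrivial[OF pq] by simp
      moreover have "length (?c q) + length (?c (q \<otimes>\<^bsub>?F\<^esub> p)) < length u + length v"
        using s(2,3) Q_length[OF pq] calculation(2) by linarith
      moreover have "?c q \<in> carrier ?F" "?c (q \<otimes>\<^bsub>?F\<^esub> p) \<in> carrier ?F"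
        using s(1) qp by simp_all
      ultimately have T_conj: "T (?c q) (?c (q \<otimes>\<^bsub>?F\<^esub> p))" by (intro less.hyps)
      have "T (s \<otimes>\<^bsub>?F\<^esub> ?c q \<otimes>\<^bsub>?F\<^esub> inv\<^bsub>?F\<^esub> s) (s \<otimes>\<^bsub>?F\<^esub> ?c (q \<otimes>\<^bsub>?F\<^esub> p) \<otimes>\<^bsub>?F\<^esub> inv\<^bsub>?F\<^esub> s)"
        by (rule conj[OF s(1) _ _ T_conj]) (use s(1) qp in simp_all)
      then have "T q (q \<otimes>\<^bsub>?F\<^esub> p)" using s(1) qp by (simp add: m_assoc cancel_left)
      then show False using Q_T[OF T_multD[OF _ qp(1,3)] Q_swap[OF pq]] not_T by simp
    qed
    have not_half_inv: "overlap p q + overlap q (inv\<^bsub>?F\<^esub> p) < length q" if pq: "(p, q) \<in> Q" for p q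
    proof (rule ccontr)
      assume "\<not> overlap p q + overlap q (inv\<^bsub>?F\<^esub> p) < length q"
      then have "2 * overlap p q = length q" "2 * overlap q (inv\<^bsub>?F\<^esub> p) = length q"
        using overlap_le(2)[OF pq] overlap_le(1)[OF Q_swap[OF Q_inv[OF pq]]] by linarith+
      from half_overlap_inv[OF Q_closed[OF pq] this] nontrivial[OF pq] show False by simp
    qed
    \<comment> \<open>The letters of the evaluated words are the two booleans: \<open>True\<close>
      stands for \<open>u\<close> and \<open>False\<close> for \<open>v\<close>.\<close>
    define f where "f = (\<lambda>b. if b then u else v)"
    let ?E = "free_lift ?F f"
    have f: "f \<in> UNIV \<rightarrow> carrier ?F" using uv by (simp add: f_def)
    define e where "e p = ?E [p]" for p
    have e_eq: "e p = (if snd p then f (fst p) else inv\<^bsub>?F\<^esub> f (fst p))" for p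
      using uv by (simp add: f_def e_def)
    have e_Q: "(e p, e q) \<in> Q" if "fst p \<noteq> fst q" for p q
      using that by (auto simp: e_eq Q_def f_def)
    have e_closed: "e p \<in> carrier ?F" for p
      using uv by (simp add: e_eq f_def)
    have e_nontrivial: "e p \<noteq> []" for p
      by (rule nontrivial[OF e_Q[of "(\<not> fst p, True)"]]) simp
    have e_overlap_self: "2 * overlap (e p) (e p) < length (e p)" for p
      using e_closed e_nontrivial by (rule overlap_self)
    have e_overlap: "2 * overlap (e p) (e q) \<le> length (e p)"
      "2 * overlap (e p) (e q) \<le> length (e q)" if can: "\<not> cancelling p q" for p q
    proof -
      have "2 * overlap (e p) (e q) \<le> length (e p) \<and> 2 * overlap (e p) (e q) \<le> length (e q)"
      proof (cases "fst p = fst q")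
        case True
        then have "p = q" using can by (simp add: cancelling_def prod_eq_iff)
        then show ?thesis using e_overlap_self[of q] by simp
      next
        case False
        then show ?thesis using overlap_le[OF e_Q[OF False]] by simp
      qed
      then show "2 * overlap (e p) (e q) \<le> length (e p)" "2 * overlap (e p) (e q) \<le> length (e q)"
        by simp_all
    qed
    have local: "overlap (e p) (e q) + overlap (e q) (e r) < length (e q)"
      if can: "\<not> cancelling p q" "\<not> cancelling q r" for p q r
    proof -
      \<comment> \<open>A neighbour that carries the same generator as \<open>q\<close> must equal
        \<open>q\<close>, and self-overlap is strictly below half. If both neighbours carry the
        other generator, they are equal or inverse, which are the two tie cases.\<close>
      consider "p = q" | "r = q" | "fst p \<noteq> fst q" "r = p" | "fst p \<noteq> fst q" "r = (fst p, \<not> snd p)"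
        using can by (cases p; cases q; cases r) (auto simp: cancelling_def)
      then show ?thesis
      proof cases
        case 1
        then show ?thesis using e_overlap_self[of q] e_overlap(1)[OF can(2)] by simp
      next
        case 2
        then show ?thesis using e_overlap_self[of q] e_overlap(2)[OF can(1)] by simp
      next
        case 3
        then show ?thesis using not_half[OF e_Q] by simp
      next
        case 4
        then have "e r = inv\<^bsub>?F\<^esub> (e p)"
          using uv by (simp add: e_eq f_def)
        then show ?thesis using not_half_inv[OF e_Q[OF 4(1)]] by simp
      qed
    qed
    interpret E: group_hom "free_group UNIV" ?F ?E
      by (intro group_hom.intro group_hom_axioms.intro group_free_group free_lift_hom f)
    have "?E ` carrier (free_group UNIV) = carrier ?F"
    proof (rule generate_pair_eqI[OF less.prems(3) E.img_is_subgroup])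
      have "?E (free_gen b) = f b" for b
        using f by (intro free_lift_gen group_free_group) auto
      moreover have "free_gen b \<in> carrier (free_group UNIV)" for b :: bool
        by (intro free_gen_in_carrier) auto
      ultimately have "f b \<in> ?E ` carrier (free_group UNIV)" for b by (metis imageI)
      from this[of True] this[of False]
      show "u \<in> ?E ` carrier (free_group UNIV)" "v \<in> ?E ` carrier (free_group UNIV)"
        by (simp_all add: f_def)
    qed
    \<comment> \<open>The length bound leaves only words of at most one letter, and the empty word
      has trivial value.\<close>
    moreover have "\<exists>p. z = e p" if z: "z \<in> ?E ` carrier (free_group UNIV)" "length z = 1" for z
    proof -
      obtain w where w: "w \<in> carrier (free_group UNIV)" "z = ?E w" using z(1) by blast
      then have "length w \<le> 1"
        using length_free_lift[OF f _ w(1)] local z(2) by (simp only: e_def) blast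
      moreover have "w \<noteq> []" using w(2) z(2) by (auto simp: one_free_group)
      ultimately obtain p where "w = [p]" by (cases w) auto
      then show ?thesis using w(2) by (auto simp only: e_def)
    qed
    ultimately have E_gen: "\<exists>p. free_gen z = e p" if "z \<in> S" for z
      using free_gen_in_carrier[OF that] by (auto simp: free_gen_def)
    obtain p q where pq: "free_gen x = e p" "free_gen y = e q"
      using E_gen[of x] E_gen[of y] S by blast
    \<comment> \<open>Otherwise the two standard generators would be equal or inverse to each
      other.\<close>
    have "fst p \<noteq> fst q"
    proof
      assume "fst p = fst q"
      then have "e q = e p \<or> e q = inv\<^bsub>?F\<^esub> (e p)"
        using uv by (simp add: e_eq f_def)
      then show False
        using pq[symmetric] S inv_free_gen[of x S] by (auto simp: free_gen_def)
    qed
    then have "(free_gen x, free_gen y) \<in> Q" using e_Q[of p q] pq by simp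
    then show False using Q_T base not_T by blast
  qed
qed

section \<open>The free group of rank two\<close>

definition pair_lift :: "('g, 'm) monoid_scheme \<Rightarrow> 'g \<Rightarrow> 'g \<Rightarrow> nat word \<Rightarrow> 'g" where
  "pair_lift G a b = free_lift G (\<lambda>i. if i = 1 then a else b)"

lemma pair_lift_hom:
  assumes "group G" "a \<in> carrier G" "b \<in> carrier G"
  shows "pair_lift G a b \<in> hom (free_group {1..2}) G"
  unfolding pair_lift_def by (rule free_lift_hom) (use assms in auto)

lemma pair_lift_gen:
  assumes "group G" "a \<in> carrier G" "b \<in> carrier G"
  shows "pair_lift G a b (free_gen 1) = a" "pair_lift G a b (free_gen 2) = b"
  using assms by (simp_all add: pair_lift_def free_lift_gen)

lemma atLeastAtMost_1_2: "{1..2 :: nat} = {1, 2}"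
  by auto

lemma generate_free_pair:
  "generate (free_group {1..2 :: nat}) {free_gen 1, free_gen 2} = carrier (free_group {1..2})"
  using generate_free_group[of "{1..2 :: nat}"] by (simp add: atLeastAtMost_1_2 del: One_nat_def)

lemma free_gen_1_2_closed:
  "free_gen 1 \<in> carrier (free_group {1..2 :: nat})" "free_gen 2 \<in> carrier (free_group {1..2 :: nat})"
  by (auto intro: free_gen_in_carrier)

lemma hom_free_pair_eqI:
  assumes "group G" "\<phi> \<in> hom (free_group {1..2 :: nat}) G" "\<psi> \<in> hom (free_group {1..2}) G"
    and "\<phi> (free_gen 1) = \<psi> (free_gen 1)" "\<phi> (free_gen 2) = \<psi> (free_gen 2)"
    and "w \<in> carrier (free_group {1..2})"
  shows "\<phi> w = \<psi> w"
  by (rule hom_eqI[OF group_free_group assms(1-3) _ generate_free_pair])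
    (use assms free_gen_1_2_closed in auto)

lemma pair_lift_inverse:
  assumes uv: "u \<in> carrier (free_group {1..2})" "v \<in> carrier (free_group {1..2})"
    "u' \<in> carrier (free_group {1..2})" "v' \<in> carrier (free_group {1..2})"
    and eq: "pair_lift (free_group {1..2}) u v u' = free_gen 1"
    "pair_lift (free_group {1..2}) u v v' = free_gen 2"
    and w: "w \<in> carrier (free_group {1..2})"
  shows "pair_lift (free_group {1..2}) u v (pair_lift (free_group {1..2}) u' v' w) = w"
proof -
  let ?F = "free_group {1..2 :: nat}"
  have "(pair_lift ?F u v \<circ> pair_lift ?F u' v') w = id w"
  proof (rule hom_free_pair_eqI[OF group_free_group _ _ _ _ w])
    show "pair_lift ?F u v \<circ> pair_lift ?F u' v' \<in> hom ?F ?F"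
      by (rule Group.hom_compose[OF pair_lift_hom[OF group_free_group uv(3,4)]
            pair_lift_hom[OF group_free_group uv(1,2)]])
    show "id \<in> hom ?F ?F" by (simp add: hom_def)
  qed (use uv eq in \<open>simp_all add: pair_lift_gen[OF group_free_group] del: One_nat_def\<close>)
  then show ?thesis by simp
qed

lemma pair_lift_iso:
  assumes uv: "u \<in> carrier (free_group {1..2})" "v \<in> carrier (free_group {1..2})"
    "u' \<in> carrier (free_group {1..2})" "v' \<in> carrier (free_group {1..2})"
    and eq: "pair_lift (free_group {1..2}) u v u' = free_gen 1"
    "pair_lift (free_group {1..2}) u v v' = free_gen 2"
    "pair_lift (free_group {1..2}) u' v' u = free_gen 1"
    "pair_lift (free_group {1..2}) u' v' v = free_gen 2"
  shows "pair_lift (free_group {1..2}) u v \<in> iso (free_group {1..2}) (free_group {1..2})"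
proof -
  let ?F = "free_group {1..2 :: nat}"
  have hom: "pair_lift ?F u v \<in> hom ?F ?F" "pair_lift ?F u' v' \<in> hom ?F ?F"
    using uv by (intro pair_lift_hom group_free_group; simp)+
  have "bij_betw (pair_lift ?F u v) (carrier ?F) (carrier ?F)"
  proof (rule bij_betw_byWitness[where f' = "pair_lift ?F u' v'"])
    show "\<forall>w \<in> carrier ?F. pair_lift ?F u' v' (pair_lift ?F u v w) = w"
      using pair_lift_inverse[OF uv(3,4,1,2) eq(3,4)] by blast
    show "\<forall>w \<in> carrier ?F. pair_lift ?F u v (pair_lift ?F u' v' w) = w"
      using pair_lift_inverse[OF uv eq(1,2)] by blast
  qed (use hom in \<open>auto simp: hom_def\<close>)
  then show ?thesis using hom by (simp add: iso_def)
qed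

section \<open>Automorphisms of the primitive Burnside group of rank two\<close>

lemma AutoGroup_carrierD:
  assumes "f \<in> carrier (AutoGroup G)"
  shows "f \<in> hom G G" "f \<in> extensional (carrier G)" "bij_betw f (carrier G) (carrier G)"
  using assms by (auto simp: AutoGroup_def auto_def Bij_def)

lemma AutoGroup_mult:
  assumes "f \<in> carrier (AutoGroup G)" "g \<in> carrier (AutoGroup G)" "n \<in> carrier G"
  shows "(f \<otimes>\<^bsub>AutoGroup G\<^esub> g) n = f (g n)"
  using assms by (simp add: AutoGroup_def BijGroup_def auto_def compose_def)

lemma AutoGroup_one: "n \<in> carrier G \<Longrightarrow> \<one>\<^bsub>AutoGroup G\<^esub> n = n"
  by (simp add: AutoGroup_def BijGroup_def)

text \<open>Elements of \<open>AutoGroup\<close> are extensional, hence the restriction to the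
  carrier.\<close>

lemma restrict_AutoGroup:
  assumes "group G" "f \<in> hom G G" "g \<in> hom G G"
    and "\<And>n. n \<in> carrier G \<Longrightarrow> f (g n) = n" "\<And>n. n \<in> carrier G \<Longrightarrow> g (f n) = n"
  shows "restrict f (carrier G) \<in> carrier (AutoGroup G)"
proof -
  interpret group G by fact
  have "bij_betw f (carrier G) (carrier G)"
    by (rule bij_betw_byWitness[where f' = g]) (use assms in \<open>auto simp: hom_def\<close>)
  then have "bij_betw (restrict f (carrier G)) (carrier G) (carrier G)"
    by (simp add: bij_betw_restrict_eq)
  moreover have "restrict f (carrier G) \<in> hom G G"
    using assms(2) by (auto simp: hom_def)
  ultimately show ?thesis by (simp add: AutoGroup_def auto_def Bij_def)
qed

abbreviation (input) PB :: "nat \<Rightarrow> nat word set monoid" where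
  "PB d \<equiv> primitive_Burnside_group 2 d"

definition PB_a :: "nat \<Rightarrow> nat word set" where "PB_a d = Burnside_coset 2 d (free_gen 1)"

definition PB_b :: "nat \<Rightarrow> nat word set" where "PB_b d = Burnside_coset 2 d (free_gen 2)"

lemma PB_gen_closed: "PB_a d \<in> carrier (PB d)" "PB_b d \<in> carrier (PB d)"
  using Burnside_coset_hom[of 2 d] free_gen_1_2_closed by (auto simp: PB_a_def PB_b_def hom_def)

lemma generate_PB: "generate (PB d) {PB_a d, PB_b d} = carrier (PB d)"
  using generate_primitive_Burnside_group[of 2 d]
  by (simp add: atLeastAtMost_1_2 PB_a_def PB_b_def del: One_nat_def)

lemma PB_a_pow: "PB_a d [^]\<^bsub>PB d\<^esub> d = \<one>\<^bsub>PB d\<^esub>"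
  unfolding PB_a_def by (intro Burnside_coset_pow primitive_free_gen) simp

lemma hom_PB_eqI:
  assumes "group G" "\<phi> \<in> hom (PB d) G" "\<psi> \<in> hom (PB d) G"
    and "\<phi> (PB_a d) = \<psi> (PB_a d)" "\<phi> (PB_b d) = \<psi> (PB_b d)" "n \<in> carrier (PB d)"
  shows "\<phi> n = \<psi> n"
  by (rule hom_eqI[OF group_primitive_Burnside_group assms(1-3) _ generate_PB])
    (use assms PB_gen_closed in auto)

lemma AutoGroup_PB_eqI:
  assumes "f \<in> carrier (AutoGroup (PB d))" "g \<in> carrier (AutoGroup (PB d))"
    and "f (PB_a d) = g (PB_a d)" "f (PB_b d) = g (PB_b d)"
  shows "f = g"
proof (rule extensionalityI)
  show "f \<in> extensional (carrier (PB d))" "g \<in> extensional (carrier (PB d))"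
    using assms(1,2) by (auto dest: AutoGroup_carrierD)
  show "f n = g n" if "n \<in> carrier (PB d)" for n
    by (rule hom_PB_eqI[OF group_primitive_Burnside_group AutoGroup_carrierD(1)[OF assms(1)]
          AutoGroup_carrierD(1)[OF assms(2)] assms(3,4) that])
qed

text \<open>An automorphism of the free group maps primitive elements to primitive elements, so it
  respects the defining relations.\<close>

lemma hom_PB_of_free_iso:
  assumes "\<alpha> \<in> iso (free_group {1..2}) (free_group {1..2})"
  shows "\<exists>f \<in> hom (PB d) (PB d). \<forall>w \<in> carrier (free_group {1..2}).
    f (Burnside_coset 2 d w) = Burnside_coset 2 d (\<alpha> w)"
proof -
  have \<alpha>: "\<alpha> \<in> hom (free_group {1..2}) (free_group {1..2})" using assms by (simp add: iso_def)
  have "\<exists>f \<in> hom (PB d) (PB d). \<forall>w \<in> carrier (free_group {1..2}).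
      f (Burnside_coset 2 d w) = (Burnside_coset 2 d \<circ> \<alpha>) w"
  proof (rule hom_primitive_Burnside_group[OF group_primitive_Burnside_group])
    show "Burnside_coset 2 d \<circ> \<alpha> \<in> hom (free_group {1..2}) (PB d)"
      by (rule Group.hom_compose[OF \<alpha> Burnside_coset_hom])
    fix w :: "nat word" assume "primitive (free_group {1..2}) w"
    then have "primitive (free_group {1..2}) (\<alpha> w)"
      by (rule primitive_iso_image[OF group_free_group group_free_group assms])
    then show "(Burnside_coset 2 d \<circ> \<alpha>) w [^]\<^bsub>PB d\<^esub> d = \<one>\<^bsub>PB d\<^esub>"
      by (simp only: o_apply Burnside_coset_pow)
  qed
  then show ?thesis by simp
qed

text \<open>The substitution by \<open>u'\<close> and \<open>v'\<close> is the inverse of the one by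
  \<open>u\<close> and \<open>v\<close>; the four equations verify this on generators.\<close>

lemma PB_automorphism:
  assumes uv: "u \<in> carrier (free_group {1..2})" "v \<in> carrier (free_group {1..2})"
    "u' \<in> carrier (free_group {1..2})" "v' \<in> carrier (free_group {1..2})"
    and eq: "pair_lift (free_group {1..2}) u v u' = free_gen 1"
    "pair_lift (free_group {1..2}) u v v' = free_gen 2"
    "pair_lift (free_group {1..2}) u' v' u = free_gen 1"
    "pair_lift (free_group {1..2}) u' v' v = free_gen 2"
  shows "\<exists>f \<in> carrier (AutoGroup (PB d)).
    f (PB_a d) = Burnside_coset 2 d u \<and> f (PB_b d) = Burnside_coset 2 d v"
proof -
  let ?F = "free_group {1..2 :: nat}" and ?q = "Burnside_coset 2 d"
  let ?\<alpha> = "pair_lift ?F u v" and ?\<beta> = "pair_lift ?F u' v'"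
  obtain f where f: "f \<in> hom (PB d) (PB d)" "\<And>w. w \<in> carrier ?F \<Longrightarrow> f (?q w) = ?q (?\<alpha> w)"
    using hom_PB_of_free_iso[OF pair_lift_iso[OF uv eq], of d] by blast
  obtain g where g: "g \<in> hom (PB d) (PB d)" "\<And>w. w \<in> carrier ?F \<Longrightarrow> g (?q w) = ?q (?\<beta> w)"
    using hom_PB_of_free_iso[OF pair_lift_iso[OF uv(3,4,1,2) eq(3,4,1,2)], of d] by blast
  have f_gen: "f (PB_a d) = ?q u" "f (PB_b d) = ?q v"
    unfolding PB_a_def PB_b_def
    by (simp_all only: f(2)[OF free_gen_1_2_closed(1)] f(2)[OF free_gen_1_2_closed(2)]
        pair_lift_gen[OF group_free_group uv(1,2)])
  have g_gen: "g (PB_a d) = ?q u'" "g (PB_b d) = ?q v'"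
    unfolding PB_a_def PB_b_def
    by (simp_all only: g(2)[OF free_gen_1_2_closed(1)] g(2)[OF free_gen_1_2_closed(2)]
        pair_lift_gen[OF group_free_group uv(3,4)])
  have id: "id \<in> hom (PB d) (PB d)" by (simp add: hom_def)
  have fg_gen: "f (g (PB_a d)) = PB_a d" "f (g (PB_b d)) = PB_b d"
    unfolding g_gen f(2)[OF uv(3)] f(2)[OF uv(4)] eq by (simp_all only: PB_a_def PB_b_def)
  have gf_gen: "g (f (PB_a d)) = PB_a d" "g (f (PB_b d)) = PB_b d"
    unfolding f_gen g(2)[OF uv(1)] g(2)[OF uv(2)] eq by (simp_all only: PB_a_def PB_b_def)
  have fg: "f (g n) = n" if "n \<in> carrier (PB d)" for n
    using hom_PB_eqI[OF group_primitive_Burnside_group Group.hom_compose[OF g(1) f(1)] id _ _ that]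
    by (simp add: fg_gen)
  have gf: "g (f n) = n" if "n \<in> carrier (PB d)" for n
    using hom_PB_eqI[OF group_primitive_Burnside_group Group.hom_compose[OF f(1) g(1)] id _ _ that]
    by (simp add: gf_gen)
  have "restrict f (carrier (PB d)) \<in> carrier (AutoGroup (PB d))"
    by (rule restrict_AutoGroup[OF group_primitive_Burnside_group f(1) g(1) fg gf])
  then show ?thesis
    using f_gen PB_gen_closed by (intro bexI[of _ "restrict f (carrier (PB d))"]) auto
qed

lemma PB_automorphism_1:
  "\<exists>f \<in> carrier (AutoGroup (PB d)).
    f (PB_a d) = PB_a d \<and> f (PB_b d) = PB_b d \<otimes>\<^bsub>PB d\<^esub> inv\<^bsub>PB d\<^esub> PB_a d"
proof -
  let ?F = "free_group {1..2 :: nat}" and ?q = "Burnside_coset 2 d"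
  let ?x = "free_gen 1 :: nat word" and ?y = "free_gen 2 :: nat word"
  interpret F: group ?F by (rule group_free_group)
  interpret q: group_hom ?F "PB d" ?q
    by (intro group_hom.intro group_hom_axioms.intro Burnside_coset_hom group_free_group
        group_primitive_Burnside_group)
  note xy = free_gen_1_2_closed
  have uv: "?y \<otimes>\<^bsub>?F\<^esub> inv\<^bsub>?F\<^esub> ?x \<in> carrier ?F" "?y \<otimes>\<^bsub>?F\<^esub> ?x \<in> carrier ?F"
    using xy by (simp_all del: One_nat_def)
  interpret \<alpha>: group_hom ?F ?F "pair_lift ?F ?x (?y \<otimes>\<^bsub>?F\<^esub> inv\<^bsub>?F\<^esub> ?x)"
    by (intro group_hom.intro group_hom_axioms.intro group_free_group pair_lift_hom xy uv)
  interpret \<beta>: group_hom ?F ?F "pair_lift ?F ?x (?y \<otimes>\<^bsub>?F\<^esub> ?x)"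
    by (intro group_hom.intro group_hom_axioms.intro group_free_group pair_lift_hom xy uv)
  have "\<exists>f \<in> carrier (AutoGroup (PB d)). f (PB_a d) = ?q ?x \<and>
      f (PB_b d) = ?q (?y \<otimes>\<^bsub>?F\<^esub> inv\<^bsub>?F\<^esub> ?x)"
    by (rule PB_automorphism[OF xy(1) uv(1) xy(1) uv(2)])
      (use xy uv in \<open>simp_all add: pair_lift_gen[OF group_free_group] F.m_assoc F.cancel_left
        del: One_nat_def\<close>)
  then show ?thesis using xy by (simp add: PB_a_def PB_b_def del: One_nat_def)
qed

lemma PB_automorphism_2:
  "\<exists>f \<in> carrier (AutoGroup (PB d)).
    f (PB_a d) = PB_b d \<and> f (PB_b d) = PB_b d \<otimes>\<^bsub>PB d\<^esub> inv\<^bsub>PB d\<^esub> PB_a d \<otimes>\<^bsub>PB d\<^esub> PB_b d"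
proof -
  let ?F = "free_group {1..2 :: nat}" and ?q = "Burnside_coset 2 d"
  let ?x = "free_gen 1 :: nat word" and ?y = "free_gen 2 :: nat word"
  interpret F: group ?F by (rule group_free_group)
  interpret q: group_hom ?F "PB d" ?q
    by (intro group_hom.intro group_hom_axioms.intro Burnside_coset_hom group_free_group
        group_primitive_Burnside_group)
  note xy = free_gen_1_2_closed
  \<comment> \<open>From \<open>v = y x^-1 y\<close> one gets \<open>x = y v^-1 y\<close>. Hence the
    inverse substitution sends \<open>x\<close> to \<open>x y^-1 x\<close> and \<open>y\<close> to
    \<open>x\<close>.\<close>
  let ?v = "?y \<otimes>\<^bsub>?F\<^esub> (inv\<^bsub>?F\<^esub> ?x \<otimes>\<^bsub>?F\<^esub> ?y)" and ?u' = "?x \<otimes>\<^bsub>?F\<^esub> (inv\<^bsub>?F\<^esub> ?y \<otimes>\<^bsub>?F\<^esub> ?x)"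
  have uv: "?v \<in> carrier ?F" "?u' \<in> carrier ?F"
    using xy by (simp_all del: One_nat_def)
  interpret \<alpha>: group_hom ?F ?F "pair_lift ?F ?y ?v"
    by (intro group_hom.intro group_hom_axioms.intro group_free_group pair_lift_hom xy uv)
  interpret \<beta>: group_hom ?F ?F "pair_lift ?F ?u' ?x"
    by (intro group_hom.intro group_hom_axioms.intro group_free_group pair_lift_hom xy uv)
  have "\<exists>f \<in> carrier (AutoGroup (PB d)). f (PB_a d) = ?q ?y \<and> f (PB_b d) = ?q ?v"
    by (rule PB_automorphism[OF xy(2) uv(1) uv(2) xy(1)])
      (use xy uv in \<open>simp_all add: pair_lift_gen[OF group_free_group] F.m_assoc F.cancel_left
        F.inv_mult_group del: One_nat_def\<close>)
  then show ?thesis using xy by (simp add: PB_a_def PB_b_def q.H.m_assoc del: One_nat_def)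
qed

lemma three_strand_action:
  "\<exists>\<theta> \<in> hom (truncated_braid_group 3 d) (AutoGroup (PB d)).
    \<theta> (truncated_braid_gen 3 d 1) (PB_a d) = PB_a d \<and>
    \<theta> (truncated_braid_gen 3 d 1) (PB_b d) = PB_b d \<otimes>\<^bsub>PB d\<^esub> inv\<^bsub>PB d\<^esub> PB_a d \<and>
    \<theta> (truncated_braid_gen 3 d 2) (PB_a d) = PB_b d \<and>
    \<theta> (truncated_braid_gen 3 d 2) (PB_b d) =
      PB_b d \<otimes>\<^bsub>PB d\<^esub> inv\<^bsub>PB d\<^esub> PB_a d \<otimes>\<^bsub>PB d\<^esub> PB_b d"
proof -
  interpret P: group "PB d" by (rule group_primitive_Burnside_group)
  interpret A: group "AutoGroup (PB d)" by (rule P.AutoGroup)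
  let ?a = "PB_a d" and ?b = "PB_b d"
  note ab = PB_gen_closed[of d]
  obtain f where f: "f \<in> carrier (AutoGroup (PB d))" "f ?a = ?a"
      "f ?b = ?b \<otimes>\<^bsub>PB d\<^esub> inv\<^bsub>PB d\<^esub> ?a"
    using PB_automorphism_1[of d] by blast
  obtain g where g: "g \<in> carrier (AutoGroup (PB d))" "g ?a = ?b"
      "g ?b = ?b \<otimes>\<^bsub>PB d\<^esub> inv\<^bsub>PB d\<^esub> ?a \<otimes>\<^bsub>PB d\<^esub> ?b"
    using PB_automorphism_2[of d] by blast
  interpret f: group_hom "PB d" "PB d" f
    by (intro group_hom.intro group_hom_axioms.intro P.group_axioms AutoGroup_carrierD(1) f(1))
  interpret g: group_hom "PB d" "PB d" g
    by (intro group_hom.intro group_hom_axioms.intro P.group_axioms AutoGroup_carrierD(1) g(1))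
  have braid: "f \<otimes>\<^bsub>AutoGroup (PB d)\<^esub> g \<otimes>\<^bsub>AutoGroup (PB d)\<^esub> f =
      g \<otimes>\<^bsub>AutoGroup (PB d)\<^esub> f \<otimes>\<^bsub>AutoGroup (PB d)\<^esub> g"
    by (rule AutoGroup_PB_eqI[of _ d])
      (use f g ab in \<open>simp_all add: AutoGroup_mult P.m_assoc P.cancel_left P.inv_mult_group\<close>)
  have f_pow: "(f [^]\<^bsub>AutoGroup (PB d)\<^esub> n) ?a = ?a \<and>
      (f [^]\<^bsub>AutoGroup (PB d)\<^esub> n) ?b = ?b \<otimes>\<^bsub>PB d\<^esub> inv\<^bsub>PB d\<^esub> ?a [^]\<^bsub>PB d\<^esub> n" for n :: nat
  proof (induction n)
    case 0
    then show ?case using ab by (simp add: AutoGroup_one)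
  next
    case (Suc n)
    interpret h: group_hom "PB d" "PB d" "f [^]\<^bsub>AutoGroup (PB d)\<^esub> n"
      by (intro group_hom.intro group_hom_axioms.intro P.group_axioms AutoGroup_carrierD(1)
          A.nat_pow_closed f(1))
    have "inv\<^bsub>PB d\<^esub> ?a [^]\<^bsub>PB d\<^esub> n \<otimes>\<^bsub>PB d\<^esub> inv\<^bsub>PB d\<^esub> ?a \<in> carrier (PB d)"
      using ab by simp
    then show ?case
      using Suc f ab by (simp add: AutoGroup_mult P.m_assoc)
  qed
  have "f [^]\<^bsub>AutoGroup (PB d)\<^esub> d = \<one>\<^bsub>AutoGroup (PB d)\<^esub>"
    by (rule AutoGroup_PB_eqI[of _ d])
      (use f ab f_pow[of d] in \<open>simp_all add: AutoGroup_one PB_a_pow P.nat_pow_inv\<close>)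
  moreover define s where "s i = (if i = 1 then f else g)" for i :: nat
  \<comment> \<open>On three strands there is one braid relation, at index 1, and no two indices are
    far enough apart to commute.\<close>
  moreover have "braid_tuple (AutoGroup (PB d)) 3 s"
  proof
    show "s i \<in> carrier (AutoGroup (PB d))" for i using f g by (simp add: s_def)
    show "s i \<otimes>\<^bsub>AutoGroup (PB d)\<^esub> s (i + 1) \<otimes>\<^bsub>AutoGroup (PB d)\<^esub> s i =
        s (i + 1) \<otimes>\<^bsub>AutoGroup (PB d)\<^esub> s i \<otimes>\<^bsub>AutoGroup (PB d)\<^esub> s (i + 1)"
      if "i \<in> {1..<3}" "i + 1 \<in> {1..<3}" for i
    proof -
      have "i = 1" using that by auto
      then show ?thesis using braid by (simp add: s_def)
    qed
  qed auto
  ultimately obtain \<theta> where "\<theta> \<in> hom (truncated_braid_group 3 d) (AutoGroup (PB d))"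
    "\<And>i. i \<in> {1..<3} \<Longrightarrow> \<theta> (truncated_braid_gen 3 d i) = s i"
    using hom_truncated_braid_group[of "AutoGroup (PB d)" 3 s d] by auto
  then show ?thesis
    using f g by (intro bexI[of _ \<theta>]) (simp_all add: s_def)
qed

section \<open>The kernel of the four strand group\<close>

text \<open>Stated for an arbitrary group, so that all computations with \<open>a\<close> and
  \<open>b\<close> are independent of cosets. The power relation for \<open>s3\<close> is derived
  from the one for \<open>s1\<close>.\<close>

locale four_braid = group +
  fixes s1 s2 s3 :: 'a and d :: nat
  assumes closed [simp]: "s1 \<in> carrier G" "s2 \<in> carrier G" "s3 \<in> carrier G"
    and braid12: "s1 \<otimes> s2 \<otimes> s1 = s2 \<otimes> s1 \<otimes> s2"
    and braid23: "s2 \<otimes> s3 \<otimes> s2 = s3 \<otimes> s2 \<otimes> s3"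
    and commute13: "s1 \<otimes> s3 = s3 \<otimes> s1"
    and s1_pow: "s1 [^] d = \<one>"
begin

definition a where "a = s1 \<otimes> inv s3"

definition b where "b = conjugate s2 a"

lemma ab_closed [simp]: "a \<in> carrier G" "b \<in> carrier G"
  by (simp_all add: a_def b_def)

lemma commute_inv: "s1 \<otimes> inv s3 = inv s3 \<otimes> s1"
proof -
  have "s1 \<otimes> inv s3 = inv s3 \<otimes> (s3 \<otimes> s1) \<otimes> inv s3" by (simp add: m_assoc cancel_left)
  also have "\<dots> = inv s3 \<otimes> s1" unfolding commute13[symmetric] by (simp add: m_assoc)
  finally show ?thesis .
qed

lemma conjugate_s1_a: "conjugate s1 a = a"
proof -
  have "conjugate s1 a = s1 \<otimes> (s1 \<otimes> inv s3) \<otimes> inv s1" by (simp add: conjugate_def a_def)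
  also have "\<dots> = s1 \<otimes> inv s3" by (subst commute_inv) (simp add: m_assoc)
  finally show ?thesis by (simp add: a_def)
qed

text \<open>By the braid relation both sides become \<open>s3\<close> after multiplication by
  \<open>s2 s3\<close> from the left.\<close>

lemma conjugate_s2_inv_s3: "s2 \<otimes> inv s3 \<otimes> inv s2 = inv s3 \<otimes> inv s2 \<otimes> s3"
proof -
  have "s2 \<otimes> s3 \<otimes> (s2 \<otimes> inv s3 \<otimes> inv s2) = s2 \<otimes> s3 \<otimes> s2 \<otimes> (inv s3 \<otimes> inv s2)"
    by (simp add: m_assoc)
  also have "\<dots> = s3" unfolding braid23 by (simp add: m_assoc cancel_left)
  also have "\<dots> = s2 \<otimes> s3 \<otimes> (inv s3 \<otimes> inv s2 \<otimes> s3)" by (simp add: m_assoc cancel_left)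
  finally show ?thesis by (simp del: m_assoc)
qed

lemma conjugate_s1_b: "conjugate s1 b = b \<otimes> inv a"
proof -
  have "conjugate s1 b = (s1 \<otimes> s2 \<otimes> s1) \<otimes> inv s3 \<otimes> inv s2 \<otimes> inv s1"
    by (simp add: b_def a_def conjugate_def m_assoc)
  also have "\<dots> = s2 \<otimes> s1 \<otimes> (s2 \<otimes> inv s3 \<otimes> inv s2) \<otimes> inv s1"
    unfolding braid12 by (simp add: m_assoc)
  also have "\<dots> = b \<otimes> inv a"
    unfolding conjugate_s2_inv_s3 by (simp add: b_def a_def conjugate_def m_assoc inv_mult_group)
  finally show ?thesis .
qed

text \<open>Conjugate \<open>a\<close> by both sides of \<open>s1 s2 s1 = s2 s1 s2\<close>. The left
  side gives \<open>b a^-1\<close>, the right side the conjugate of \<open>b a^-1\<close> by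
  \<open>s2\<close>, whose second factor is \<open>b^-1\<close>; solve for the first.\<close>

lemma conjugate_s2_b: "conjugate s2 b = b \<otimes> inv a \<otimes> b"
proof -
  have "b \<otimes> inv a = conjugate (s1 \<otimes> s2 \<otimes> s1) a"
    by (simp add: conjugate_comp conjugate_s1_a conjugate_s1_b flip: b_def)
  also have "\<dots> = conjugate s2 b \<otimes> inv b"
    unfolding braid12
    by (simp add: conjugate_comp conjugate_s1_b conjugate_mult conjugate_inv flip: b_def)
  finally have "b \<otimes> inv a \<otimes> b = conjugate s2 b \<otimes> inv b \<otimes> b" by simp
  then show ?thesis by (simp add: m_assoc)
qed

text \<open>The braid relation makes neighbouring generators conjugate, which carries
  \<open>s1^d = 1\<close> on to \<open>s2\<close> and then to \<open>s3\<close>.\<close>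

lemma s2_conj: "s2 = conjugate (s1 \<otimes> s2) s1"
proof -
  have "conjugate (s1 \<otimes> s2) s1 = (s1 \<otimes> s2 \<otimes> s1) \<otimes> inv (s1 \<otimes> s2)" by (simp add: conjugate_def)
  also have "\<dots> = s2" unfolding braid12 by (simp add: inv_mult_group m_assoc cancel_left)
  finally show ?thesis ..
qed

lemma s3_conj: "s3 = conjugate (s2 \<otimes> s3) s2"
proof -
  have "conjugate (s2 \<otimes> s3) s2 = (s2 \<otimes> s3 \<otimes> s2) \<otimes> inv (s2 \<otimes> s3)" by (simp add: conjugate_def)
  also have "\<dots> = s3" unfolding braid23 by (simp add: inv_mult_group m_assoc cancel_left)
  finally show ?thesis ..
qed

lemma conjugate_one: "g \<in> carrier G \<Longrightarrow> conjugate g \<one> = \<one>"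
  by (simp add: conjugate_def)

lemma s3_pow: "s3 [^] d = \<one>"
proof -
  have "s2 [^] d = \<one>"
    by (subst s2_conj) (simp add: conjugate_pow s1_pow conjugate_one)
  then show ?thesis
    by (subst s3_conj) (simp add: conjugate_pow conjugate_one)
qed

lemma a_pow: "a [^] d = \<one>"
proof -
  have "a [^] d = s1 [^] d \<otimes> inv s3 [^] d"
    unfolding a_def by (rule pow_mult_distrib[OF commute_inv]) simp_all
  then show ?thesis by (simp add: s1_pow s3_pow nat_pow_inv)
qed

text \<open>The conjugation formulas in the shape \<open>g z = z' g\<close>, which is the form of
  the equivariance condition on a semidirect product.\<close>

lemma action:
  "s1 \<otimes> a = a \<otimes> s1" "s1 \<otimes> b = b \<otimes> inv a \<otimes> s1"
  "s2 \<otimes> a = b \<otimes> s2" "s2 \<otimes> b = b \<otimes> inv a \<otimes> b \<otimes> s2"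
proof -
  have comm: "g \<otimes> z = conjugate g z \<otimes> g" if "g \<in> carrier G" "z \<in> carrier G" for g z
    using that by (simp add: conjugate_def m_assoc)
  show "s1 \<otimes> a = a \<otimes> s1" "s1 \<otimes> b = b \<otimes> inv a \<otimes> s1"
    "s2 \<otimes> a = b \<otimes> s2" "s2 \<otimes> b = b \<otimes> inv a \<otimes> b \<otimes> s2"
    using comm[of s1 a] comm[of s1 b] comm[of s2 a] comm[of s2 b]
    by (simp_all add: conjugate_s1_a conjugate_s1_b conjugate_s2_b flip: b_def)
qed

text \<open>The two Nielsen moves on \<open>{a, b}\<close> that are not inversions are realised by conjugation.\<close>

lemma conjugate_swap:
  "\<exists>r \<in> carrier G. conjugate r a = b \<and> conjugate r b = inv a"
proof (intro bexI conjI)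
  \<comment> \<open>Read from the right: \<open>s1 s1\<close> gives \<open>(a, b a^-2)\<close>, then
    \<open>s2\<close> gives \<open>(b, b a^-1 b^-1)\<close>, and \<open>b^-1\<close> gives
    \<open>(b, a^-1)\<close>.\<close>
  let ?r = "inv b \<otimes> (s2 \<otimes> (s1 \<otimes> s1))"
  have inv_b: "conjugate (inv b) (conjugate s2 b \<otimes> inv b \<otimes> inv b) = inv a" "conjugate (inv b) b = b"
    unfolding conjugate_s2_b by (simp_all add: conjugate_def m_assoc cancel_left)
  show "conjugate ?r a = b"
    by (simp add: conjugate_comp conjugate_s1_a inv_b flip: b_def)
  show "conjugate ?r b = inv a"
    using inv_b(1)
    by (simp add: conjugate_comp conjugate_s1_a conjugate_s1_b conjugate_mult conjugate_inv
        flip: b_def)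
qed simp

lemma conjugate_mult_move:
  assumes "x \<in> {a, inv a}" "y \<in> {b, inv b}"
  shows "\<exists>h \<in> carrier G. conjugate h x \<in> {a, inv a} \<and> conjugate h (x \<otimes> y) \<in> {b, inv b}"
proof -
  have a1: "conjugate s1 a = a" "conjugate (inv s1) a = a"
    using conjugate_s1_a conjugate_inv_cancel[of s1 a] by simp_all
  have b1: "conjugate s1 (b \<otimes> a) = b" "conjugate (inv s1) (b \<otimes> inv a) = b"
    using conjugate_inv_cancel[of s1 b]
    by (simp_all add: conjugate_mult conjugate_s1_a conjugate_s1_b m_assoc)
  have aa: "conjugate (inv a) a = a" "conjugate a a = a"
    "conjugate (inv a) (a \<otimes> b) = b \<otimes> a" "conjugate a (inv a \<otimes> b) = b \<otimes> inv a"
    by (simp_all add: conjugate_def m_assoc cancel_left)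
  have ab: "conjugate (inv s1) (a \<otimes> inv b) = inv b" "conjugate s1 (inv a \<otimes> inv b) = inv b"
    using arg_cong[OF b1(2), of "m_inv G"] arg_cong[OF b1(1), of "m_inv G"]
    by (simp_all add: inv_mult_group flip: conjugate_inv)
  \<comment> \<open>Every conjugator used fixes \<open>a\<close>. Conjugation by \<open>s1\<close>
    takes \<open>b a\<close> to \<open>b\<close>, its inverse takes \<open>b a^-1\<close> to
    \<open>b\<close>, and conjugation by a power of \<open>a\<close> first moves a left factor to
    the right where necessary. With \<open>y = inv b\<close> the product is the inverse of such an
    element.\<close>
  consider "x = a" "y = b" | "x = a" "y = inv b" | "x = inv a" "y = b" | "x = inv a" "y = inv b"
    using assms by blast
  then show ?thesis
  proof cases
    case 1
    then show ?thesis
      by (intro bexI[of _ "s1 \<otimes> inv a"]) (simp_all add: conjugate_comp aa a1 b1)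
  next
    case 2
    then show ?thesis by (intro bexI[of _ "inv s1"]) (simp_all add: a1 ab)
  next
    case 3
    then show ?thesis
      by (intro bexI[of _ "inv s1 \<otimes> a"]) (simp_all add: conjugate_comp conjugate_inv aa a1 b1)
  next
    case 4
    then show ?thesis by (intro bexI[of _ s1]) (simp_all add: conjugate_inv a1 ab)
  qed
qed

lemma primitive_pow:
  assumes w: "primitive (free_group {1..2}) w"
  shows "pair_lift G a b w [^] d = \<one>"
proof -
  let ?F = "free_group {1..2 :: nat}"
  let ?\<Phi> = "pair_lift G a b"
  \<comment> \<open>One conjugator has to serve both entries, since the multiplication move involves
    their product. The signs absorb inversions and the sign produced by the swap.\<close>
  define T where "T u v \<longleftrightarrow> (\<exists>g \<in> carrier G. conjugate g (?\<Phi> u) \<in> {a, inv a} \<and>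
    conjugate g (?\<Phi> v) \<in> {b, inv b})" for u v
  interpret F: group ?F by (rule group_free_group)
  interpret \<Phi>: group_hom ?F G ?\<Phi>
    by (intro group_hom.intro group_hom_axioms.intro group_free_group group_axioms pair_lift_hom
        ab_closed)
  obtain v where v: "v \<in> carrier ?F" "generate ?F {w, v} = carrier ?F"
    using primitive_complement[OF w] by auto
  have "T w v"
  proof (rule Nielsen_induct[OF atLeastAtMost_1_2 _ primitive_closed[OF w] v, where T = T])
    have "conjugate \<one> a = a" "conjugate \<one> b = b" by (simp_all add: conjugate_def)
    then show "T (free_gen 1) (free_gen 2)"
      unfolding T_def pair_lift_gen[OF group_axioms ab_closed] by (intro bexI[of _ \<one>]) simp_all
  next
    fix u v assume uv: "u \<in> carrier ?F" "v \<in> carrier ?F" and "T u v"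
    then obtain g where g: "g \<in> carrier G" "conjugate g (?\<Phi> u) \<in> {a, inv a}"
        "conjugate g (?\<Phi> v) \<in> {b, inv b}"
      by (auto simp: T_def)
    have \<Phi>uv: "?\<Phi> u \<in> carrier G" "?\<Phi> v \<in> carrier G" using uv by simp_all
    show "T v u"
    proof -
      obtain r where r: "r \<in> carrier G" "conjugate r a = b" "conjugate r b = inv a"
        using conjugate_swap by blast
      then have "conjugate r (conjugate g (?\<Phi> u)) \<in> {b, inv b}"
        "conjugate r (conjugate g (?\<Phi> v)) \<in> {a, inv a}"
        using g(2,3) by (auto simp: conjugate_inv)
      then show ?thesis
        using r(1) g(1) \<Phi>uv unfolding T_def
        by (intro bexI[of _ "r \<otimes> g"] conjI) (simp_all add: conjugate_comp)
    qed
    show "T (inv\<^bsub>?F\<^esub> u) v"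
      unfolding T_def
      by (intro bexI[of _ g] conjI)
        (use g uv \<Phi>uv in \<open>auto simp: conjugate_inv simp del: One_nat_def\<close>)
    show "T u (u \<otimes>\<^bsub>?F\<^esub> v)"
    proof -
      obtain h where h: "h \<in> carrier G" "conjugate h (conjugate g (?\<Phi> u)) \<in> {a, inv a}"
        "conjugate h (conjugate g (?\<Phi> u) \<otimes> conjugate g (?\<Phi> v)) \<in> {b, inv b}"
        using conjugate_mult_move[OF g(2,3)] by blast
      then show ?thesis
        unfolding T_def
        by (intro bexI[of _ "h \<otimes> g"] conjI)
          (use g(1) uv \<Phi>uv in \<open>simp_all add: conjugate_comp conjugate_mult del: One_nat_def\<close>)
    qed
  next
    fix h u v assume h: "h \<in> carrier ?F" and uv: "u \<in> carrier ?F" "v \<in> carrier ?F" and "T u v"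
    then obtain g where g: "g \<in> carrier G" "conjugate g (?\<Phi> u) \<in> {a, inv a}"
        "conjugate g (?\<Phi> v) \<in> {b, inv b}"
      by (auto simp: T_def)
    \<comment> \<open>A conjugation in the free group becomes conjugation by
      \<open>?\<Phi> h\<close>, which the new conjugator undoes.\<close>
    have "conjugate (g \<otimes> inv (?\<Phi> h)) (?\<Phi> (h \<otimes>\<^bsub>?F\<^esub> z \<otimes>\<^bsub>?F\<^esub> inv\<^bsub>?F\<^esub> h)) = conjugate g (?\<Phi> z)"
      if "z \<in> carrier ?F" for z
      using that h g(1) by (simp add: conjugate_def m_assoc inv_mult_group cancel_left del: One_nat_def)
    then show "T (h \<otimes>\<^bsub>?F\<^esub> u \<otimes>\<^bsub>?F\<^esub> inv\<^bsub>?F\<^esub> h) (h \<otimes>\<^bsub>?F\<^esub> v \<otimes>\<^bsub>?F\<^esub> inv\<^bsub>?F\<^esub> h)"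
      unfolding T_def using g h uv by (intro bexI[of _ "g \<otimes> inv (?\<Phi> h)"]) (simp_all del: One_nat_def)
  qed simp
  then obtain g where g: "g \<in> carrier G" "conjugate g (?\<Phi> w) \<in> {a, inv a}"
    by (auto simp: T_def)
  then have "conjugate g (?\<Phi> w) [^] d = \<one>"
    by (auto simp: a_pow nat_pow_inv)
  then show ?thesis
    using pow_eq_one_conjugateD[OF group_axioms g(1)] primitive_closed[OF w] by simp
qed

lemma hom_PB:
  "\<exists>\<iota> \<in> hom (PB d) G. \<iota> (PB_a d) = a \<and> \<iota> (PB_b d) = b"
proof -
  obtain \<iota> where \<iota>: "\<iota> \<in> hom (PB d) G"
    "\<And>w. w \<in> carrier (free_group {1..2}) \<Longrightarrow> \<iota> (Burnside_coset 2 d w) = pair_lift G a b w"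
    using hom_primitive_Burnside_group[OF group_axioms
        pair_lift_hom[OF group_axioms ab_closed] primitive_pow] by blast
  then show ?thesis
    unfolding PB_a_def PB_b_def
    using \<iota>(2)[OF free_gen_1_2_closed(1)] \<iota>(2)[OF free_gen_1_2_closed(2)]
      pair_lift_gen[OF group_axioms ab_closed] by (intro bexI[of _ \<iota>]) simp_all
qed

end

text \<open>The relations for the candidate \<open>a^-1 e1\<close> of the third generator. They
  follow from commutation rules alone, so they apply in the semidirect product without computing
  with pairs.\<close>

lemma (in group) four_strand_relations:
  assumes c: "e1 \<in> carrier G" "e2 \<in> carrier G" "a \<in> carrier G" "b \<in> carrier G"
    and braid: "e1 \<otimes> e2 \<otimes> e1 = e2 \<otimes> e1 \<otimes> e2"
    and act: "e1 \<otimes> a = a \<otimes> e1" "e1 \<otimes> b = b \<otimes> inv a \<otimes> e1" "e2 \<otimes> a = b \<otimes> e2"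
  shows "e1 \<otimes> (inv a \<otimes> e1) = inv a \<otimes> e1 \<otimes> e1"
    and "e2 \<otimes> (inv a \<otimes> e1) \<otimes> e2 = inv a \<otimes> e1 \<otimes> e2 \<otimes> (inv a \<otimes> e1)"
proof -
  have inv_act: "g \<otimes> inv x = inv y \<otimes> g"
    if "g \<otimes> x = y \<otimes> g" "g \<in> carrier G" "x \<in> carrier G" "y \<in> carrier G" for g x y
  proof -
    have "conjugate g x = y \<otimes> g \<otimes> inv g" unfolding conjugate_def that(1) ..
    then have "y = conjugate g x" using that(2-) by (simp add: m_assoc)
    then have "inv y \<otimes> g = conjugate g (inv x) \<otimes> g" using that(2,3) by (simp only: conjugate_inv)
    then show ?thesis using that(2-) by (simp add: conjugate_def m_assoc)
  qed
  have e1a: "e1 \<otimes> inv a = inv a \<otimes> e1" using inv_act[OF act(1)] c by simp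
  have e1b: "e1 \<otimes> inv b = a \<otimes> inv b \<otimes> e1" using inv_act[OF act(2)] c by (simp add: inv_mult_group)
  have e2a: "e2 \<otimes> inv a = inv b \<otimes> e2" using inv_act[OF act(3)] c by simp
  show "e1 \<otimes> (inv a \<otimes> e1) = inv a \<otimes> e1 \<otimes> e1"
    using c by (simp add: e1a flip: m_assoc)
  have "e2 \<otimes> (inv a \<otimes> e1) \<otimes> e2 = (e2 \<otimes> inv a) \<otimes> (e1 \<otimes> e2)" using c by (simp add: m_assoc)
  also have "\<dots> = inv b \<otimes> (e2 \<otimes> e1 \<otimes> e2)" using c by (simp add: e2a m_assoc)
  \<comment> \<open>The inserted \<open>a^-1 a\<close> produces \<open>a b^-1 e1\<close>, which is
    \<open>e1 b^-1\<close>; then \<open>b^-1 e2\<close> turns back into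
    \<open>e2 a^-1\<close>.\<close>
  also have "\<dots> = inv a \<otimes> (a \<otimes> inv b \<otimes> e1) \<otimes> (e2 \<otimes> e1)"
    using c by (simp add: m_assoc cancel_left flip: braid)
  also have "\<dots> = inv a \<otimes> e1 \<otimes> (e2 \<otimes> inv a) \<otimes> e1"
    using c by (simp add: m_assoc e2a flip: e1b)
  also have "\<dots> = inv a \<otimes> e1 \<otimes> e2 \<otimes> (inv a \<otimes> e1)" using c by (simp add: m_assoc)
  finally show "e2 \<otimes> (inv a \<otimes> e1) \<otimes> e2 = inv a \<otimes> e1 \<otimes> e2 \<otimes> (inv a \<otimes> e1)" .
qed

section \<open>Semidirect products\<close>

locale semidirect = N: group N + H: group H
  for N :: "('n, 'x) monoid_scheme" and H :: "('h, 'y) monoid_scheme" +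
  fixes \<theta> :: "'h \<Rightarrow> 'n \<Rightarrow> 'n"
  assumes \<theta>_hom: "\<theta> \<in> hom H (AutoGroup N)"
begin

abbreviation (input) "SD \<equiv> semidirect_product N H \<theta>"

lemma \<theta>_AutoGroup: "h \<in> carrier H \<Longrightarrow> \<theta> h \<in> carrier (AutoGroup N)"
  using \<theta>_hom by (auto simp: hom_def)

lemma group_hom_\<theta>: "h \<in> carrier H \<Longrightarrow> group_hom N N (\<theta> h)"
  by (intro group_hom.intro group_hom_axioms.intro N.group_axioms AutoGroup_carrierD(1) \<theta>_AutoGroup)

lemma \<theta>_closed [simp]: "h \<in> carrier H \<Longrightarrow> n \<in> carrier N \<Longrightarrow> \<theta> h n \<in> carrier N"
  using group_hom.hom_closed[OF group_hom_\<theta>] .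

lemma \<theta>_one [simp]: "h \<in> carrier H \<Longrightarrow> \<theta> h \<one>\<^bsub>N\<^esub> = \<one>\<^bsub>N\<^esub>"
  using group_hom.hom_one[OF group_hom_\<theta>] .

lemma \<theta>_mult: "h \<in> carrier H \<Longrightarrow> h' \<in> carrier H \<Longrightarrow> n \<in> carrier N \<Longrightarrow>
    \<theta> (h \<otimes>\<^bsub>H\<^esub> h') n = \<theta> h (\<theta> h' n)"
  using \<theta>_hom by (simp add: hom_mult AutoGroup_mult \<theta>_AutoGroup)

lemma \<theta>_id [simp]: "n \<in> carrier N \<Longrightarrow> \<theta> \<one>\<^bsub>H\<^esub> n = n"
  using hom_one[OF \<theta>_hom H.group_axioms N.AutoGroup] by (simp add: AutoGroup_one)

lemma group_SD: "group SD"
  by (intro group_semidirect_product N.group_axioms H.group_axioms \<theta>_hom)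

lemma SD_simps [simp]:
  "carrier SD = carrier N \<times> carrier H"
  "(n, h) \<otimes>\<^bsub>SD\<^esub> (n', h') = (n \<otimes>\<^bsub>N\<^esub> \<theta> h n', h \<otimes>\<^bsub>H\<^esub> h')"
  by (simp_all add: semidirect_product_def)

lemma inl_hom: "(\<lambda>n. (n, \<one>\<^bsub>H\<^esub>)) \<in> hom N SD"
  by (rule homI) simp_all

lemma inr_hom: "(\<lambda>h. (\<one>\<^bsub>N\<^esub>, h)) \<in> hom H SD"
  by (rule homI) simp_all

lemma hom_SD:
  assumes "group G" "\<iota> \<in> hom N G" "s \<in> hom H G"
    and eq: "\<And>h n. h \<in> carrier H \<Longrightarrow> n \<in> carrier N \<Longrightarrow>
      s h \<otimes>\<^bsub>G\<^esub> \<iota> n = \<iota> (\<theta> h n) \<otimes>\<^bsub>G\<^esub> s h"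
  shows "(\<lambda>(n, h). \<iota> n \<otimes>\<^bsub>G\<^esub> s h) \<in> hom SD G"
proof -
  interpret G: group G by fact
  interpret \<iota>: group_hom N G \<iota>
    by (intro group_hom.intro group_hom_axioms.intro N.group_axioms assms)
  interpret s: group_hom H G s
    by (intro group_hom.intro group_hom_axioms.intro H.group_axioms assms)
  show ?thesis
  proof (rule homI)
    fix p p' assume "p \<in> carrier SD" "p' \<in> carrier SD"
    then obtain n h n' h' where p: "p = (n, h)" "p' = (n', h')"
      "n \<in> carrier N" "h \<in> carrier H" "n' \<in> carrier N" "h' \<in> carrier H" by auto
    have "\<iota> n \<otimes>\<^bsub>G\<^esub> \<iota> (\<theta> h n') \<otimes>\<^bsub>G\<^esub> (s h \<otimes>\<^bsub>G\<^esub> s h') =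
        \<iota> n \<otimes>\<^bsub>G\<^esub> (\<iota> (\<theta> h n') \<otimes>\<^bsub>G\<^esub> s h) \<otimes>\<^bsub>G\<^esub> s h'"
      using p by (simp add: G.m_assoc)
    also have "\<dots> = \<iota> n \<otimes>\<^bsub>G\<^esub> s h \<otimes>\<^bsub>G\<^esub> (\<iota> n' \<otimes>\<^bsub>G\<^esub> s h')"
      using p by (simp add: G.m_assoc flip: eq)
    finally show "(\<lambda>(n, h). \<iota> n \<otimes>\<^bsub>G\<^esub> s h) (p \<otimes>\<^bsub>SD\<^esub> p') =
        (\<lambda>(n, h). \<iota> n \<otimes>\<^bsub>G\<^esub> s h) p \<otimes>\<^bsub>G\<^esub> (\<lambda>(n, h). \<iota> n \<otimes>\<^bsub>G\<^esub> s h) p'"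
      using p by simp
  qed auto
qed

text \<open>Written as \<open>\<iota> (\<theta> h n) = G.conjugate (s h) (\<iota> n)\<close>, both
  sides are homomorphisms in \<open>n\<close>, and the admissible \<open>h\<close> form a subgroup.
  Hence generators suffice in both variables.\<close>

lemma equivariant_eqI:
  assumes "group G" "\<iota> \<in> hom N G" "s \<in> hom H G"
    and gen: "A \<subseteq> carrier N" "generate N A = carrier N" "B \<subseteq> carrier H" "generate H B = carrier H"
    and eq: "\<And>x y. x \<in> B \<Longrightarrow> y \<in> A \<Longrightarrow> s x \<otimes>\<^bsub>G\<^esub> \<iota> y = \<iota> (\<theta> x y) \<otimes>\<^bsub>G\<^esub> s x"
    and hn: "h \<in> carrier H" "n \<in> carrier N"
  shows "s h \<otimes>\<^bsub>G\<^esub> \<iota> n = \<iota> (\<theta> h n) \<otimes>\<^bsub>G\<^esub> s h"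
proof -
  interpret G: group G by fact
  interpret \<iota>: group_hom N G \<iota>
    by (intro group_hom.intro group_hom_axioms.intro N.group_axioms assms)
  interpret s: group_hom H G s
    by (intro group_hom.intro group_hom_axioms.intro H.group_axioms assms)
  have conj_iff: "s h \<otimes>\<^bsub>G\<^esub> \<iota> n = \<iota> (\<theta> h n) \<otimes>\<^bsub>G\<^esub> s h \<longleftrightarrow> \<iota> (\<theta> h n) = G.conjugate (s h) (\<iota> n)"
    if "h \<in> carrier H" "n \<in> carrier N" for h n
    using that G.inv_solve_right[of "\<iota> (\<theta> h n)" "s h \<otimes>\<^bsub>G\<^esub> \<iota> n" "s h"]
    by (auto simp: G.conjugate_def simp del: s.hom_inv)
  let ?K = "{h \<in> carrier H. \<forall>n \<in> carrier N. \<iota> (\<theta> h n) = G.conjugate (s h) (\<iota> n)}"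
  have "subgroup ?K H"
  proof (rule subgroup.intro)
    show "\<one>\<^bsub>H\<^esub> \<in> ?K" by (simp add: G.conjugate_def)
  next
    fix h h' assume "h \<in> ?K" "h' \<in> ?K"
    then show "h \<otimes>\<^bsub>H\<^esub> h' \<in> ?K" by (simp add: \<theta>_mult G.conjugate_comp)
  next
    fix h assume h: "h \<in> ?K"
    have "\<iota> (\<theta> (inv\<^bsub>H\<^esub> h) n) = G.conjugate (s (inv\<^bsub>H\<^esub> h)) (\<iota> n)" if n: "n \<in> carrier N" for n
    proof -
      \<comment> \<open>The condition for \<open>h\<close> at this element describes
        \<open>\<iota> n\<close>; undoing the conjugation gives the condition for the
        inverse.\<close>
      let ?m = "\<theta> (inv\<^bsub>H\<^esub> h) n"
      have m: "?m \<in> carrier N" using h n by simp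
      have "\<theta> h ?m = n" using h n \<theta>_mult[of h "inv\<^bsub>H\<^esub> h" n] by simp
      then have "\<iota> n = G.conjugate (s h) (\<iota> ?m)" using h m by auto
      then show ?thesis using h m by (simp add: G.conjugate_inv_cancel)
    qed
    then show "inv\<^bsub>H\<^esub> h \<in> ?K" using h by simp
  qed auto
  moreover have "B \<subseteq> ?K"
  proof
    fix x assume x: "x \<in> B"
    then have xH: "x \<in> carrier H" using gen(3) by auto
    interpret \<theta>x: group_hom N N "\<theta> x" by (rule group_hom_\<theta>[OF xH])
    have "(\<iota> \<circ> \<theta> x) n = (G.conjugate (s x) \<circ> \<iota>) n" if "n \<in> carrier N" for n
    proof (rule hom_eqI[OF N.group_axioms G.group_axioms _ _ gen(1,2) _ that])
      show "\<iota> \<circ> \<theta> x \<in> hom N G"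
        by (rule Group.hom_compose[OF \<theta>x.homh \<iota>.homh])
      show "G.conjugate (s x) \<circ> \<iota> \<in> hom N G"
        by (rule Group.hom_compose[OF \<iota>.homh G.conjugate_hom]) (use xH in simp)
      fix y assume y: "y \<in> A"
      then have "y \<in> carrier N" using gen(1) by auto
      then show "(\<iota> \<circ> \<theta> x) y = (G.conjugate (s x) \<circ> \<iota>) y"
        using eq[OF x y] conj_iff[OF xH] by simp
    qed
    then show "x \<in> ?K" using xH by simp
  qed
  ultimately have "carrier H \<subseteq> ?K"
    using H.generate_subgroup_incl[of B ?K] gen(4) by simp
  then show ?thesis using hn conj_iff by blast
qed

end

section \<open>The splitting\<close>

lemma four_braid_truncated:
  "four_braid (truncated_braid_group 4 d) (truncated_braid_gen 4 d 1)
    (truncated_braid_gen 4 d 2) (truncated_braid_gen 4 d 3) d"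
proof -
  interpret braid_tuple "truncated_braid_group 4 d" 4 "truncated_braid_gen 4 d"
    by (rule braid_tuple_truncated_braid_gen)
  show ?thesis
    by unfold_locales
      (use s_closed[of 1] s_closed[of 2] s_closed[of 3] s_braid[of 1] s_braid[of 2]
        s_commute[of 1 3] truncated_braid_gen_1_pow[of 4 d]
        in \<open>simp_all add: numeral_2_eq_2 numeral_3_eq_3\<close>)
qed

section \<open>Universal properties of the truncated groups on four and three strands\<close>

lemma braid_tuple_4I:
  assumes "group G" "s1 \<in> carrier G" "s2 \<in> carrier G" "s3 \<in> carrier G"
    and "s1 \<otimes>\<^bsub>G\<^esub> s2 \<otimes>\<^bsub>G\<^esub> s1 = s2 \<otimes>\<^bsub>G\<^esub> s1 \<otimes>\<^bsub>G\<^esub> s2"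
    and "s2 \<otimes>\<^bsub>G\<^esub> s3 \<otimes>\<^bsub>G\<^esub> s2 = s3 \<otimes>\<^bsub>G\<^esub> s2 \<otimes>\<^bsub>G\<^esub> s3"
    and "s1 \<otimes>\<^bsub>G\<^esub> s3 = s3 \<otimes>\<^bsub>G\<^esub> s1"
  shows "braid_tuple G 4 (\<lambda>i. if i = 1 then s1 else if i = 2 then s2 else s3)"
proof -
  interpret group G by fact
  show ?thesis
  proof
    fix i j :: nat
    assume "i \<in> {1..<4}" "j \<in> {1..<4}" "\<bar>int i - int j\<bar> > 1"
    then have "i = 1 \<and> j = 3 \<or> i = 3 \<and> j = 1" by auto
    then show "(if i = 1 then s1 else if i = 2 then s2 else s3) \<otimes>\<^bsub>G\<^esub>
        (if j = 1 then s1 else if j = 2 then s2 else s3) =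
      (if j = 1 then s1 else if j = 2 then s2 else s3) \<otimes>\<^bsub>G\<^esub>
        (if i = 1 then s1 else if i = 2 then s2 else s3)"
      using assms(7) by auto
  next
    fix i :: nat
    assume "i \<in> {1..<4}" "i + 1 \<in> {1..<4}"
    then have "i = 1 \<or> i = 2" by auto
    then show "(if i = 1 then s1 else if i = 2 then s2 else s3) \<otimes>\<^bsub>G\<^esub>
        (if i + 1 = 1 then s1 else if i + 1 = 2 then s2 else s3) \<otimes>\<^bsub>G\<^esub>
        (if i = 1 then s1 else if i = 2 then s2 else s3) =
      (if i + 1 = 1 then s1 else if i + 1 = 2 then s2 else s3) \<otimes>\<^bsub>G\<^esub>
        (if i = 1 then s1 else if i = 2 then s2 else s3) \<otimes>\<^bsub>G\<^esub>
        (if i + 1 = 1 then s1 else if i + 1 = 2 then s2 else s3)"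
      using assms(5,6) by auto
  qed (use assms in auto)
qed

lemma braid_tuple_3I:
  assumes "group G" "s1 \<in> carrier G" "s2 \<in> carrier G"
    and "s1 \<otimes>\<^bsub>G\<^esub> s2 \<otimes>\<^bsub>G\<^esub> s1 = s2 \<otimes>\<^bsub>G\<^esub> s1 \<otimes>\<^bsub>G\<^esub> s2"
  shows "braid_tuple G 3 (\<lambda>i. if i = 1 then s1 else s2)"
proof -
  interpret group G by fact
  show ?thesis
  proof
    fix i :: nat
    assume "i \<in> {1..<3}" "i + 1 \<in> {1..<3}"
    then have "i = 1" by auto
    then show "(if i = 1 then s1 else s2) \<otimes>\<^bsub>G\<^esub> (if i + 1 = 1 then s1 else s2) \<otimes>\<^bsub>G\<^esub>
        (if i = 1 then s1 else s2) =
      (if i + 1 = 1 then s1 else s2) \<otimes>\<^bsub>G\<^esub> (if i = 1 then s1 else s2) \<otimes>\<^bsub>G\<^esub>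
        (if i + 1 = 1 then s1 else s2)"
      using assms(4) by simp
  qed (use assms in auto)
qed

lemma hom_truncated_4:
  assumes "group G" "s1 \<in> carrier G" "s2 \<in> carrier G" "s3 \<in> carrier G"
    and "s1 \<otimes>\<^bsub>G\<^esub> s2 \<otimes>\<^bsub>G\<^esub> s1 = s2 \<otimes>\<^bsub>G\<^esub> s1 \<otimes>\<^bsub>G\<^esub> s2"
    and "s2 \<otimes>\<^bsub>G\<^esub> s3 \<otimes>\<^bsub>G\<^esub> s2 = s3 \<otimes>\<^bsub>G\<^esub> s2 \<otimes>\<^bsub>G\<^esub> s3"
    and "s1 \<otimes>\<^bsub>G\<^esub> s3 = s3 \<otimes>\<^bsub>G\<^esub> s1" "s1 [^]\<^bsub>G\<^esub> d = \<one>\<^bsub>G\<^esub>"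
  shows "\<exists>\<phi> \<in> hom (truncated_braid_group 4 d) G. \<phi> (truncated_braid_gen 4 d 1) = s1 \<and>
    \<phi> (truncated_braid_gen 4 d 2) = s2 \<and> \<phi> (truncated_braid_gen 4 d 3) = s3"
proof -
  obtain \<phi> where "\<phi> \<in> hom (truncated_braid_group 4 d) G"
    "\<And>i. i \<in> {1..<4} \<Longrightarrow> \<phi> (truncated_braid_gen 4 d i) =
      (if i = 1 then s1 else if i = 2 then s2 else s3)"
    using hom_truncated_braid_group[OF braid_tuple_4I[OF assms(1-7)], of d] assms(8) by auto
  then show ?thesis by (intro bexI[of _ \<phi>]) simp_all
qed

lemma hom_truncated_3:
  assumes "group G" "s1 \<in> carrier G" "s2 \<in> carrier G"
    and "s1 \<otimes>\<^bsub>G\<^esub> s2 \<otimes>\<^bsub>G\<^esub> s1 = s2 \<otimes>\<^bsub>G\<^esub> s1 \<otimes>\<^bsub>G\<^esub> s2" "s1 [^]\<^bsub>G\<^esub> d = \<one>\<^bsub>G\<^esub>"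
  shows "\<exists>\<phi> \<in> hom (truncated_braid_group 3 d) G. \<phi> (truncated_braid_gen 3 d 1) = s1 \<and>
    \<phi> (truncated_braid_gen 3 d 2) = s2"
proof -
  obtain \<phi> where "\<phi> \<in> hom (truncated_braid_group 3 d) G"
    "\<And>i. i \<in> {1..<3} \<Longrightarrow> \<phi> (truncated_braid_gen 3 d i) = (if i = 1 then s1 else s2)"
    using hom_truncated_braid_group[OF braid_tuple_3I[OF assms(1-4)], of d] assms(5) by auto
  then show ?thesis by (intro bexI[of _ \<phi>]) simp_all
qed

lemma hom_truncated_4_eqI:
  assumes "group G" "\<phi> \<in> hom (truncated_braid_group 4 d) G" "\<psi> \<in> hom (truncated_braid_group 4 d) G"
    and "\<phi> (truncated_braid_gen 4 d 1) = \<psi> (truncated_braid_gen 4 d 1)"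
    "\<phi> (truncated_braid_gen 4 d 2) = \<psi> (truncated_braid_gen 4 d 2)"
    "\<phi> (truncated_braid_gen 4 d 3) = \<psi> (truncated_braid_gen 4 d 3)"
    and g: "g \<in> carrier (truncated_braid_group 4 d)"
  shows "\<phi> g = \<psi> g"
proof (rule hom_eqI[OF group_truncated_braid_group assms(1-3) _ generate_truncated_braid_group _ g])
  show "truncated_braid_gen 4 d ` {1..<4} \<subseteq> carrier (truncated_braid_group 4 d)"
    using truncated_braid_gen_closed by blast
  have "{1..<4} = {1, 2, 3 :: nat}" by auto
  then show "\<phi> x = \<psi> x" if "x \<in> truncated_braid_gen 4 d ` {1..<4}" for x
    using that assms(4-6) by auto
qed

lemma generate_truncated_3:
  "generate (truncated_braid_group 3 d) {truncated_braid_gen 3 d 1, truncated_braid_gen 3 d 2} =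
    carrier (truncated_braid_group 3 d)"
proof -
  have "{1..<3} = {1, 2 :: nat}" by auto
  then show ?thesis using generate_truncated_braid_group[of 3 d] by (simp del: One_nat_def)
qed

lemma hom_truncated_3_eqI:
  assumes "group G" "\<phi> \<in> hom (truncated_braid_group 3 d) G" "\<psi> \<in> hom (truncated_braid_group 3 d) G"
    and eq: "\<phi> (truncated_braid_gen 3 d 1) = \<psi> (truncated_braid_gen 3 d 1)"
    "\<phi> (truncated_braid_gen 3 d 2) = \<psi> (truncated_braid_gen 3 d 2)"
    and h: "h \<in> carrier (truncated_braid_group 3 d)"
  shows "\<phi> h = \<psi> h"
  by (rule hom_eqI[OF group_truncated_braid_group assms(1-3) _ generate_truncated_3 _ h])
    (use eq truncated_braid_gen_closed[of 1 3 d] truncated_braid_gen_closed[of 2 3 d] in auto)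

theorem theorem1p2:
  fixes d :: nat
  assumes "d > 0"
  shows "\<exists>\<psi> \<in> epi (truncated_braid_group 4 d) (truncated_braid_group 3 d).
    \<psi> (truncated_braid_gen 4 d 1) = truncated_braid_gen 3 d 1 \<and>
    \<psi> (truncated_braid_gen 4 d 2) = truncated_braid_gen 3 d 2 \<and>
    \<psi> (truncated_braid_gen 4 d 3) = truncated_braid_gen 3 d 1 \<and>
    (\<forall>\<phi> \<in> hom (truncated_braid_group 4 d) (truncated_braid_group 3 d).
       \<phi> (truncated_braid_gen 4 d 1) = truncated_braid_gen 3 d 1 \<and>
       \<phi> (truncated_braid_gen 4 d 2) = truncated_braid_gen 3 d 2 \<and>
       \<phi> (truncated_braid_gen 4 d 3) = truncated_braid_gen 3 d 1 \<longrightarrow>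
       (\<forall>g \<in> carrier (truncated_braid_group 4 d). \<phi> g = \<psi> g)) \<and>
    (truncated_braid_group 4 d)
       \<lparr>carrier := kernel (truncated_braid_group 4 d) (truncated_braid_group 3 d) \<psi>\<rparr>
      \<cong> primitive_Burnside_group 2 d \<and>
    (\<exists>\<iota> s \<theta>.
       \<iota> \<in> mon (primitive_Burnside_group 2 d) (truncated_braid_group 4 d) \<and>
       \<iota> ` carrier (primitive_Burnside_group 2 d) =
         kernel (truncated_braid_group 4 d) (truncated_braid_group 3 d) \<psi> \<and>
       s \<in> hom (truncated_braid_group 3 d) (truncated_braid_group 4 d) \<and>
       (\<forall>h \<in> carrier (truncated_braid_group 3 d). \<psi> (s h) = h) \<and>
       \<theta> \<in> hom (truncated_braid_group 3 d) (AutoGroup (primitive_Burnside_group 2 d)) \<and>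
       (\<lambda>(n, h). \<iota> n \<otimes>\<^bsub>truncated_braid_group 4 d\<^esub> s h)
         \<in> iso (semidirect_product (primitive_Burnside_group 2 d) (truncated_braid_group 3 d) \<theta>)
               (truncated_braid_group 4 d) \<and>
       truncated_braid_group 4 d \<cong>
         semidirect_product (primitive_Burnside_group 2 d) (truncated_braid_group 3 d) \<theta>)"
proof -
  \<comment> \<open>Keeps the index 1 from becoming \<open>Suc 0\<close>, so that the facts about
    generators match.\<close>
  note [simp del] = One_nat_def
  let ?G = "truncated_braid_group 4 d" and ?H = "truncated_braid_group 3 d"
  let ?s1 = "truncated_braid_gen 4 d 1" and ?s2 = "truncated_braid_gen 4 d 2"
    and ?s3 = "truncated_braid_gen 4 d 3"
  let ?t1 = "truncated_braid_gen 3 d 1" and ?t2 = "truncated_braid_gen 3 d 2"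
  let ?x = "PB_a d" and ?y = "PB_b d"
  interpret G: four_braid ?G ?s1 ?s2 ?s3 d by (rule four_braid_truncated)
  interpret H: group ?H by (rule group_truncated_braid_group)
  interpret P: group "PB d" by (rule group_primitive_Burnside_group)
  have t: "?t1 \<in> carrier ?H" "?t2 \<in> carrier ?H"
    by (rule truncated_braid_gen_closed, simp)+
  have t_braid: "?t1 \<otimes>\<^bsub>?H\<^esub> ?t2 \<otimes>\<^bsub>?H\<^esub> ?t1 = ?t2 \<otimes>\<^bsub>?H\<^esub> ?t1 \<otimes>\<^bsub>?H\<^esub> ?t2"
    using braid_tuple.s_braid[OF braid_tuple_truncated_braid_gen, of 1 3 d]
    by (simp add: numeral_2_eq_2)
  have t_pow: "?t1 [^]\<^bsub>?H\<^esub> d = \<one>\<^bsub>?H\<^esub>"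
    by (rule truncated_braid_gen_1_pow) simp
  note xy = PB_gen_closed[of d]

  obtain \<theta> where \<theta>: "\<theta> \<in> hom ?H (AutoGroup (PB d))"
    "\<theta> ?t1 ?x = ?x" "\<theta> ?t1 ?y = ?y \<otimes>\<^bsub>PB d\<^esub> inv\<^bsub>PB d\<^esub> ?x"
    "\<theta> ?t2 ?x = ?y" "\<theta> ?t2 ?y = ?y \<otimes>\<^bsub>PB d\<^esub> inv\<^bsub>PB d\<^esub> ?x \<otimes>\<^bsub>PB d\<^esub> ?y"
    using three_strand_action[of d] by blast
  interpret semidirect "PB d" ?H \<theta>
    by (intro semidirect.intro semidirect_axioms.intro P.group_axioms H.group_axioms \<theta>(1))
  interpret SD: group SD by (rule group_SD)
  interpret j: group_hom "PB d" SD "\<lambda>n. (n, \<one>\<^bsub>?H\<^esub>)"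
    by (intro group_hom.intro group_hom_axioms.intro P.group_axioms SD.group_axioms inl_hom)
  interpret k: group_hom ?H SD "\<lambda>h. (\<one>\<^bsub>PB d\<^esub>, h)"
    by (intro group_hom.intro group_hom_axioms.intro H.group_axioms SD.group_axioms inr_hom)
  \<comment> \<open>As rewrite rules these turn pairs back into products, against
    \<open>SD_simps\<close>.\<close>
  note [simp del] = j.hom_mult k.hom_mult j.hom_inv k.hom_inv j.hom_one k.hom_one

  obtain \<iota> where \<iota>: "\<iota> \<in> hom (PB d) ?G" "\<iota> ?x = G.a" "\<iota> ?y = G.b"
    using G.hom_PB by blast
  interpret \<iota>: group_hom "PB d" ?G \<iota>
    by (intro group_hom.intro group_hom_axioms.intro P.group_axioms G.group_axioms \<iota>(1))
  obtain s where s: "s \<in> hom ?H ?G" "s ?t1 = ?s1" "s ?t2 = ?s2"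
    using hom_truncated_3[OF G.group_axioms G.closed(1,2) G.braid12 G.s1_pow] by blast
  interpret s: group_hom ?H ?G s
    by (intro group_hom.intro group_hom_axioms.intro H.group_axioms G.group_axioms s(1))

  let ?\<Gamma> = "\<lambda>(n, h). \<iota> n \<otimes>\<^bsub>?G\<^esub> s h"
  have equivariant: "s h \<otimes>\<^bsub>?G\<^esub> \<iota> n = \<iota> (\<theta> h n) \<otimes>\<^bsub>?G\<^esub> s h"
    if "h \<in> carrier ?H" "n \<in> carrier (PB d)" for h n
  proof (rule equivariant_eqI[OF G.group_axioms \<iota>(1) s(1) _ generate_PB _ generate_truncated_3 _ that])
    fix h n assume "h \<in> {?t1, ?t2}" "n \<in> {?x, ?y}"
    then consider "h = ?t1" "n = ?x" | "h = ?t1" "n = ?y" | "h = ?t2" "n = ?x" | "h = ?t2" "n = ?y"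
      by blast
    then show "s h \<otimes>\<^bsub>?G\<^esub> \<iota> n = \<iota> (\<theta> h n) \<otimes>\<^bsub>?G\<^esub> s h"
      using xy by cases (simp_all add: s \<iota>(2,3) \<theta> G.action)
  qed (use xy t in auto)
  have \<Gamma>: "?\<Gamma> \<in> hom SD ?G"
    by (rule hom_SD[OF G.group_axioms \<iota>(1) s(1) equivariant])
  interpret \<Gamma>: group_hom SD ?G ?\<Gamma>
    by (intro group_hom.intro group_hom_axioms.intro SD.group_axioms G.group_axioms \<Gamma>)

  let ?e1 = "(\<one>\<^bsub>PB d\<^esub>, ?t1)" and ?e2 = "(\<one>\<^bsub>PB d\<^esub>, ?t2)"
  let ?jx = "(?x, \<one>\<^bsub>?H\<^esub>)" and ?jy = "(?y, \<one>\<^bsub>?H\<^esub>)"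
  \<comment> \<open>Solving \<open>a = s1 s3^-1\<close> for \<open>s3\<close> gives
    \<open>a^-1 s1\<close>.\<close>
  let ?e3 = "inv\<^bsub>SD\<^esub> ?jx \<otimes>\<^bsub>SD\<^esub> ?e1"
  have e: "?e1 \<in> carrier SD" "?e2 \<in> carrier SD" "?jx \<in> carrier SD" "?jy \<in> carrier SD"
    using t xy by simp_all
  have e_braid: "?e1 \<otimes>\<^bsub>SD\<^esub> ?e2 \<otimes>\<^bsub>SD\<^esub> ?e1 = ?e2 \<otimes>\<^bsub>SD\<^esub> ?e1 \<otimes>\<^bsub>SD\<^esub> ?e2"
    using t t_braid by simp
  have e_pow: "?e1 [^]\<^bsub>SD\<^esub> d = \<one>\<^bsub>SD\<^esub>"
    using k.hom_nat_pow[OF t(1), of d] t_pow k.hom_one by simp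
  have inv_jx: "inv\<^bsub>SD\<^esub> ?jx = (inv\<^bsub>PB d\<^esub> ?x, \<one>\<^bsub>?H\<^esub>)"
    using j.hom_inv[OF xy(1)] by simp
  have e_act: "?e1 \<otimes>\<^bsub>SD\<^esub> ?jx = ?jx \<otimes>\<^bsub>SD\<^esub> ?e1"
    "?e1 \<otimes>\<^bsub>SD\<^esub> ?jy = ?jy \<otimes>\<^bsub>SD\<^esub> inv\<^bsub>SD\<^esub> ?jx \<otimes>\<^bsub>SD\<^esub> ?e1"
    "?e2 \<otimes>\<^bsub>SD\<^esub> ?jx = ?jy \<otimes>\<^bsub>SD\<^esub> ?e2"
    using t xy \<theta>(2-5) by (simp_all add: inv_jx)
  have e3: "?e3 \<in> carrier SD" by (intro SD.m_closed SD.inv_closed e)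
  note e_rel = SD.four_strand_relations[OF e e_braid e_act]
  obtain \<Lambda> where \<Lambda>: "\<Lambda> \<in> hom ?G SD" "\<Lambda> ?s1 = ?e1" "\<Lambda> ?s2 = ?e2" "\<Lambda> ?s3 = ?e3"
    using hom_truncated_4[OF SD.group_axioms e(1,2) e3 e_braid e_rel(2,1) e_pow] by blast
  interpret \<Lambda>: group_hom ?G SD \<Lambda>
    by (intro group_hom.intro group_hom_axioms.intro SD.group_axioms G.group_axioms \<Lambda>(1))
  have \<Lambda>_a: "\<Lambda> G.a = ?jx"
    using e by (simp add: G.a_def \<Lambda> SD.inv_mult_group SD.cancel_left del: SD_simps)
  \<comment> \<open>Two homomorphisms on the Burnside group are compared on its generators; the
    image of \<open>G.b\<close> is the conjugate of \<open>?jx\<close> by \<open>?e2\<close>, which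
    the action turns into \<open>?jy\<close>.\<close>
  have \<Lambda>_\<iota>: "\<Lambda> (\<iota> n) = (n, \<one>\<^bsub>?H\<^esub>)" if n: "n \<in> carrier (PB d)" for n
  proof -
    have "\<Lambda> G.b = ?e2 \<otimes>\<^bsub>SD\<^esub> ?jx \<otimes>\<^bsub>SD\<^esub> inv\<^bsub>SD\<^esub> ?e2"
      by (simp add: G.b_def G.conjugate_def \<Lambda> \<Lambda>_a del: SD_simps)
    also have "\<dots> = ?jy" using e unfolding e_act(3) by (simp add: SD.m_assoc del: SD_simps)
    finally have "\<Lambda> G.b = ?jy" .
    then show ?thesis
      using hom_PB_eqI[OF SD.group_axioms Group.hom_compose[OF \<iota>(1) \<Lambda>(1)] inl_hom _ _ n]
      by (simp add: \<iota> \<Lambda>_a)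
  qed
  have \<Lambda>_s: "\<Lambda> (s h) = (\<one>\<^bsub>PB d\<^esub>, h)" if h: "h \<in> carrier ?H" for h
    using hom_truncated_3_eqI[OF SD.group_axioms Group.hom_compose[OF s(1) \<Lambda>(1)] inr_hom _ _ h]
    by (simp add: s \<Lambda>)
  have \<Lambda>_\<Gamma>: "\<Lambda> (?\<Gamma> p) = p" if "p \<in> carrier SD" for p
    using that by (auto simp: \<Lambda>_\<iota> \<Lambda>_s)
  have \<Gamma>_\<Lambda>: "?\<Gamma> (\<Lambda> g) = g" if g: "g \<in> carrier ?G" for g
  proof -
    have \<Gamma>_e: "?\<Gamma> ?e1 = ?s1" "?\<Gamma> ?e2 = ?s2" "?\<Gamma> ?jx = G.a"
      using xy by (simp_all add: s \<iota>)
    have "?\<Gamma> ?e3 = inv\<^bsub>?G\<^esub> (?\<Gamma> ?jx) \<otimes>\<^bsub>?G\<^esub> ?\<Gamma> ?e1"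
      using e by (simp only: \<Gamma>.hom_mult \<Gamma>.hom_inv SD.inv_closed)
    also have "\<dots> = ?s3"
      unfolding \<Gamma>_e by (simp add: G.a_def G.inv_mult_group G.m_assoc)
    finally have "?\<Gamma> ?e3 = ?s3" .
    moreover have "id \<in> hom ?G ?G" by (simp add: hom_def)
    ultimately have "(?\<Gamma> \<circ> \<Lambda>) g = id g"
      using hom_truncated_4_eqI[OF G.group_axioms Group.hom_compose[OF \<Lambda>(1) \<Gamma>] _ _ _ _ g, of id] \<Gamma>_e
      by (simp only: \<Lambda> o_apply id_apply)
    then show ?thesis by simp
  qed
  have \<Gamma>_iso: "?\<Gamma> \<in> iso SD ?G"
  proof -
    have "bij_betw ?\<Gamma> (carrier SD) (carrier ?G)"
    proof (rule bij_betw_byWitness[where f' = \<Lambda>])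
      show "?\<Gamma> ` carrier SD \<subseteq> carrier ?G" by (intro image_subsetI \<Gamma>.hom_closed)
      show "\<Lambda> ` carrier ?G \<subseteq> carrier SD" by (intro image_subsetI \<Lambda>.hom_closed)
      show "\<forall>p \<in> carrier SD. \<Lambda> (?\<Gamma> p) = p" by (intro ballI \<Lambda>_\<Gamma>)
      show "\<forall>g \<in> carrier ?G. ?\<Gamma> (\<Lambda> g) = g" by (intro ballI \<Gamma>_\<Lambda>)
    qed
    then show ?thesis using \<Gamma> by (simp add: iso_def)
  qed

  \<comment> \<open>With \<open>s3\<close> sent to \<open>?t1\<close>, the relation between
    \<open>s2\<close> and \<open>s3\<close> is the three strand relation read backwards, and
    commutation is trivial.\<close>
  obtain \<psi> where \<psi>: "\<psi> \<in> hom ?G ?H" "\<psi> ?s1 = ?t1" "\<psi> ?s2 = ?t2" "\<psi> ?s3 = ?t1"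
    using hom_truncated_4[OF H.group_axioms t t(1) t_braid t_braid[symmetric] refl t_pow] by blast
  interpret \<psi>: group_hom ?G ?H \<psi>
    by (intro group_hom.intro group_hom_axioms.intro H.group_axioms G.group_axioms \<psi>(1))
  have \<psi>_\<iota>: "\<psi> (\<iota> n) = \<one>\<^bsub>?H\<^esub>" if n: "n \<in> carrier (PB d)" for n
  proof -
    have "(\<lambda>_. \<one>\<^bsub>?H\<^esub>) \<in> hom (PB d) ?H" by (simp add: hom_def)
    moreover have "\<psi> G.a = \<one>\<^bsub>?H\<^esub>" using t by (simp add: G.a_def \<psi>)
    moreover from this have "\<psi> G.b = \<one>\<^bsub>?H\<^esub>"
      using t by (simp add: G.b_def G.conjugate_def \<psi>)
    ultimately show ?thesis
      using hom_PB_eqI[OF H.group_axioms Group.hom_compose[OF \<iota>(1) \<psi>(1)] _ _ _ n] \<iota> by simp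
  qed
  have \<psi>_s: "\<psi> (s h) = h" if h: "h \<in> carrier ?H" for h
  proof -
    have "id \<in> hom ?H ?H" by (simp add: hom_def)
    then show ?thesis
      using hom_truncated_3_eqI[OF H.group_axioms Group.hom_compose[OF s(1) \<psi>(1)] _ _ _ h, of id]
      by (simp add: s \<psi>)
  qed
  have \<psi>_epi: "\<psi> \<in> epi ?G ?H"
  proof -
    have "h \<in> \<psi> ` carrier ?G" if "h \<in> carrier ?H" for h
      by (rule image_eqI[where x = "s h"]) (simp_all add: \<psi>_s that)
    then have "\<psi> ` carrier ?G = carrier ?H" using \<psi>.hom_closed by blast
    then show ?thesis using \<psi>(1) by (simp add: epi_def)
  qed
  \<comment> \<open>\<open>\<Lambda>\<close> recovers the first coordinate. This is where the action
    pays off: it shows that no relations beyond those of the Burnside group hold in the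
    kernel.\<close>
  have \<iota>_inj: "inj_on \<iota> (carrier (PB d))"
  proof (rule inj_onI)
    fix m n assume m: "m \<in> carrier (PB d)" and n: "n \<in> carrier (PB d)" and "\<iota> m = \<iota> n"
    then have "(m, \<one>\<^bsub>?H\<^esub>) = (n, \<one>\<^bsub>?H\<^esub>)"
      using \<Lambda>_\<iota>[OF m] \<Lambda>_\<iota>[OF n] by (simp only:)
    then show "m = n" by (rule Pair_inject)
  qed
  have \<iota>_image: "\<iota> ` carrier (PB d) = kernel ?G ?H \<psi>"
  proof
    show "\<iota> ` carrier (PB d) \<subseteq> kernel ?G ?H \<psi>"
      using \<psi>_\<iota> by (auto simp: kernel_def)
    show "kernel ?G ?H \<psi> \<subseteq> \<iota> ` carrier (PB d)"
    proof
      fix g assume "g \<in> kernel ?G ?H \<psi>"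
      then have g: "g \<in> carrier ?G" "\<psi> g = \<one>\<^bsub>?H\<^esub>" by (simp_all add: kernel_def)
      \<comment> \<open>In the coordinates given by \<open>\<Lambda>\<close>, the map
        \<open>\<psi>\<close> reads off the second one, so an element of the kernel has
        \<open>h\<close> trivial.\<close>
      obtain n h where nh: "\<Lambda> g = (n, h)" "n \<in> carrier (PB d)" "h \<in> carrier ?H"
        using \<Lambda>.hom_closed[OF g(1)] by (cases "\<Lambda> g") simp
      have g_eq: "g = \<iota> n \<otimes>\<^bsub>?G\<^esub> s h" using \<Gamma>_\<Lambda>[OF g(1)] nh(1) by simp
      have "\<psi> g = h" using nh(2,3) by (simp add: g_eq \<psi>_\<iota> \<psi>_s)
      then have "g = \<iota> n" using g(2) nh(2) g_eq by simp
      then show "g \<in> \<iota> ` carrier (PB d)" using nh(2) by (rule image_eqI)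
    qed
  qed
  have kernel_iso: "?G\<lparr>carrier := kernel ?G ?H \<psi>\<rparr> \<cong> PB d"
  proof -
    have "\<iota> \<in> hom (PB d) (?G\<lparr>carrier := kernel ?G ?H \<psi>\<rparr>)"
      by (rule homI) (simp_all flip: \<iota>_image)
    then have "\<iota> \<in> iso (PB d) (?G\<lparr>carrier := kernel ?G ?H \<psi>\<rparr>)"
      using \<iota>_inj \<iota>_image by (simp add: iso_def bij_betw_def)
    then show ?thesis by (rule P.iso_sym[OF is_isoI])
  qed
  have unique: "\<forall>\<phi> \<in> hom ?G ?H. \<phi> ?s1 = ?t1 \<and> \<phi> ?s2 = ?t2 \<and> \<phi> ?s3 = ?t1 \<longrightarrow>
      (\<forall>g \<in> carrier ?G. \<phi> g = \<psi> g)"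
  proof (intro ballI impI, elim conjE)
    fix \<phi> g assume "\<phi> \<in> hom ?G ?H" "\<phi> ?s1 = ?t1" "\<phi> ?s2 = ?t2" "\<phi> ?s3 = ?t1" "g \<in> carrier ?G"
    then show "\<phi> g = \<psi> g"
      using hom_truncated_4_eqI[OF H.group_axioms _ \<psi>(1), of \<phi> g] \<psi>(2-4) by simp
  qed
  have G_iso: "?G \<cong> SD" using \<Gamma>_iso by (rule SD.iso_sym[OF is_isoI])
  have \<iota>_mon: "\<iota> \<in> mon (PB d) ?G" using \<iota>(1) \<iota>_inj by (simp add: mon_def)
  have s_section: "\<forall>h \<in> carrier ?H. \<psi> (s h) = h" using \<psi>_s by blast
  show ?thesis
    by (intro bexI[of _ \<psi>] conjI exI[of _ \<iota>] exI[of _ s] exI[of _ \<theta>])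
      (rule \<psi> unique kernel_iso \<iota>_mon \<iota>_image s(1) s_section \<theta>(1) \<Gamma>_iso G_iso \<psi>_epi)+
qed

end
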